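(* Let $L\to M$ be a spin bundle over a compact, oriented Riemannian surface $(M,g)$, and denote by $\bar\partial$ the Dirac structure on $L$, where $M$ is regarded as a Riemann surface via the conformal class of $g$. For non-negative $\epsilon=(\epsilon_1,\epsilon_2,\epsilon_3)$ the family of functionals $E_\epsilon\colon\Gamma(L^\times)\to\mathbb{R}$ on nowhere vanishing sections of $L$, given by \[ E_{\epsilon}(\psi)=\epsilon_1\int_M \frac{\langle*\bar\partial\psi\wedge\bar\partial\psi\rangle}{|\psi|^2}+(\epsilon_2-\epsilon_1)\int_M\frac{\langle *\bar\partial\psi\wedge\psi(\psi,\psi)\rangle^2}{|\psi|^8}+(\epsilon_3-\epsilon_1)\int_M\frac{\langle *\bar\partial\psi\wedge J\psi(\psi,\psi)\rangle^2}{|\psi|^8} \] subject to the constraint $|\psi|^4=g$, is well-defined on the Riemannian surface $(M,g)$. For $\epsilon_3=0$ and arbitrary $\epsilon_1,\epsilon_2>0$ the functional assumes its minimum value, zero, at a section $\psi\in\Gamma(L^\times)$ which gives rise to an isometric immersion $f\colon M\to\mathbb{R}^3$ satisfying $df=(\psi,\psi)$ in the prescribed regular homotopy class given by the spin bundle $L$.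
   Context: All objects are smooth. $\mathbb{H}$ denotes the quaternions and $\mathbb{R}^3=\operatorname{Im}\mathbb{H}$. On the Riemann surface $M$, $*$ is precomposition of $1$-forms with the complex structure of $TM$ (the negative of the Hodge star). $\Gamma(L^\times)$ is the space of nowhere vanishing sections of $L$. Spin bundle. A spin bundle over the Riemann surface $M$ is a right quaternionic line bundle $L\to M$ together with a spin pairing $(\cdot,\cdot)\colon L\times L\to\operatorname{Hom}(TM,\mathbb{H})$, i.e. real bilinear with $(\psi\lambda,\varphi\mu)=\bar\lambda(\psi,\varphi)\mu$ for $\lambda,\mu\in\mathbb{H}$, $\overline{(\psi,\varphi)}=-(\varphi,\psi)$, and $(\psi,\psi)_X\neq0$ for all non-zero $\psi\in L$, $X\in TM$; it is compatible with the Riemann surface: the metrics $|(\psi,\psi)|^2$ are in the conformal class of $M$ for $\psi$ nowhere vanishing, and $J\in\Gamma(\operatorname{End}(L))$ denotes the unique quaternionic linear complex structure with $*(\psi,\varphi)=(J\psi,\varphi)=(\psi,J\varphi)$. Two spin bundles are isomorphic if there is a quaternionic linear bundle isomorphism over the identity of $M$ intertwining the spin pairings. For $L$-valued $1$-forms $\mu$ the pairing is extended by $(\mu,\psi)_{X,Y}=(\mu_X,\psi)_Y-(\mu_Y,\psi)_X$ and $(\psi,\mu)_{X,Y}=(\psi,\mu_X)_Y-(\psi,\mu_Y)_X$. $\bar KL$ is the bundle of $L$-valued $1$-forms $\mu$ with $*\mu=-J\mu$, and $\mu^{0,1}=\frac12(\mu+J*\mu)$. Dirac structure. $\bar\partial\colon\Gamma(L)\to\Gamma(\bar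 KL)$ is the unique real linear operator with $[J,\bar\partial]=0$, $\bar\partial(\psi\lambda)=(\bar\partial\psi)\lambda+(\psi\,d\lambda)^{0,1}$ for $\lambda\in C^\infty(M,\mathbb{H})$, and $d(\psi,\varphi)=(\bar\partial\psi,\varphi)+(\psi,\bar\partial\varphi)$. Half-densities. $|K|\to M$ is the real oriented line bundle with fiber $|K|_x=\mathbb{R}\sqrt{g_x}$. $|K|^2$ is identified with $\Lambda^2TM^*$ by sending a metric in the conformal class to its volume form. $|\psi|^2:=|(\psi,\psi)|\in|K|$ is a quadratic form on $L$ with polarization $\langle\cdot,\cdot\rangle\colon L\times L\to|K|$, so $\langle\psi\lambda,\psi\mu\rangle=\operatorname{Re}(\bar\lambda\mu)|\psi|^2$; thus $|\psi|^4=|(\psi,\psi)|^2$ is a metric in the conformal class, and the constraint $|\psi|^4=g$ means $|(\psi,\psi)_X|^2=g(X,X)$. For $L$-valued $1$-forms $\mu,\nu$, the $|K|\otimes\Lambda^2TM^*$-valued wedge is normalized by $\langle\mu\wedge\nu\rangle_{X,Y}=\frac12(\langle\mu_X,\nu_Y\rangle-\langle\mu_Y,\nu_X\rangle)$. Expressions such as $\psi(\psi,\psi)$ and $J\psi(\psi,\psi)$ are the $L$-valued $1$-forms $X\mapsto\psi\,(\psi,\psi)_X$ and $X\mapsto J\psi\,(\psi,\psi)_X$. The quotients in $E_\epsilon$ are sections of $|K|^2\cong\Lambda^2TM^*$. Regular homotopy class given by $L$. For a conformal immersion $f\colon M\to\mathbb{R}^3$, the induced spin bundle is $L_f:=M\times\mathbb{H}$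 with pairing $(\psi,\varphi)=\bar\psi\,df\,\varphi$; a general immersion $h$, with $dh=\omega\circ B$ where $\omega$ is conformal and $B$ is positive self-adjoint with $\det B=1$, induces the bundle $M\times\mathbb{H}$ with pairing $\bar\psi\,\omega\,\varphi$. Isomorphism classes of spin bundles over $M$ correspond in this way bijectively to regular homotopy classes of immersions $M\to\mathbb{R}^3$; the regular homotopy class given by $L$ consists of the immersions whose induced spin bundle is isomorphic to $L$. Standing assumption on periods. A closed $1$-form $(\psi,\psi)$ a priori only gives an immersion of the universal cover with translation periods; it is assumed throughout that the resulting immersions are defined on $M$, i.e. that the periods $\int_\gamma(\psi,\psi)$, $\gamma\in H_1(M,\mathbb{Z})$, vanish (this can be enforced by adding the squared periods $\sum_\gamma|\int_\gamma(\psi,\psi)|^2$, over a basis of $H_1(M,\mathbb{Z})$, to the functional).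
   Formalization: Attainment of zero fails for smooth sections in general (e.g. hyperbolic genus 2), so it is replaced: E≥0, and a constrained ψ with vanishing periods has E=0 iff it yields an isometric immersion f with df=(ψ,ψ) in the class of L; every such f arises from a zero of E. *)

theory Defs
  imports "HOL-Analysis.Analysis"
begin

section \<open>Quaternions\<close>

text \<open>
  A quaternion is a pair of its real and its imaginary part; the imaginary quaternions are \<open>\<real>\<^sup>3\<close>, embedded as
  \<open>v \<mapsto> (0, v)\<close>. Norm and inner product of the product type are those of the quaternions.
\<close>

type_synonym quat = "real \<times> (real^3)"

definition qmult :: "quat \<Rightarrow> quat \<Rightarrow> quat" (infixl \<open>\<odot>\<close> 70) where
  "p \<odot> q = (fst p * fst q - snd p \<bullet> snd q,
            fst p *\<^sub>R snd q + fst q *\<^sub>R snd p + cross3 (snd p) (snd q))"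

definition qcnj :: "quat \<Rightarrow> quat" where
  "qcnj q = (fst q, - snd q)"

definition qreal :: "real \<Rightarrow> quat" where
  "qreal r = (r, 0)"

definition qimag :: "real^3 \<Rightarrow> quat" where
  "qimag v = (0, v)"


section \<open>Smooth functions on open sets\<close>

fun ck_on :: "nat \<Rightarrow> 'a::euclidean_space set \<Rightarrow> ('a \<Rightarrow> 'b::real_normed_vector) \<Rightarrow> bool" where
  "ck_on 0 S f \<longleftrightarrow> continuous_on S f"
| "ck_on (Suc n) S f \<longleftrightarrow> (\<forall>x\<in>S. f differentiable (at x)) \<and>
     (\<forall>v. ck_on n S (\<lambda>x. frechet_derivative f (at x) v))"

definition smooth_on :: "'a::euclidean_space set \<Rightarrow> ('a \<Rightarrow> 'b::real_normed_vector) \<Rightarrow> bool" where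
  "smooth_on S f \<longleftrightarrow> (\<forall>n. ck_on n S f)"


section \<open>Oriented surfaces\<close>

type_synonym 'm chart = "'m set \<times> ('m \<Rightarrow> real^2)"

definition chart_inv :: "'m chart \<Rightarrow> real^2 \<Rightarrow> 'm" where
  "chart_inv c = inv_into (fst c) (snd c)"

text \<open>The underlying point set of the surface is the whole type.\<close>

definition oriented_surface :: "'m::t2_space chart set \<Rightarrow> bool" where
  "oriented_surface A \<longleftrightarrow>
     (\<Union>c\<in>A. fst c) = UNIV \<and>
     (\<forall>c\<in>A. open (fst c) \<and> open (snd c ` fst c) \<and>
        homeomorphism (fst c) (snd c ` fst c) (snd c) (chart_inv c)) \<and>
     (\<forall>c\<in>A. \<forall>d\<in>A. smooth_on (snd c ` (fst c \<inter> fst d)) (snd d \<circ> chart_inv c) \<and>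
        (\<forall>y \<in> snd c ` (fst c \<inter> fst d).
           0 < det (matrix (frechet_derivative (snd d \<circ> chart_inv c) (at y)))))"

definition smooth_map ::
    "'m::t2_space chart set \<Rightarrow> 'm set \<Rightarrow> ('m \<Rightarrow> 'b::real_normed_vector) \<Rightarrow> bool" where
  "smooth_map A U h \<longleftrightarrow> (\<forall>c\<in>A. smooth_on (snd c ` (U \<inter> fst c)) (h \<circ> chart_inv c))"


section \<open>Tangent vectors and forms\<close>

text \<open>
  A tangent vector at \<open>x\<close> is represented by its coordinates in a preferred chart \<open>chart_at A x\<close>
  around \<open>x\<close>, so that the tangent space at \<open>x\<close> is the vector space \<open>real^2\<close>, oriented in the
  standard way; \<open>tvec A c x w\<close> is the tangent vector at \<open>x\<close> whose coordinates in the chart \<open>c\<close>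
  are \<open>w\<close>. As \<open>chart_at A x\<close> jumps with \<open>x\<close>, smoothness of a form is tested on the
  coordinate fields \<open>\<lambda>x. tvec A c x w\<close>.
\<close>

definition chart_at :: "'m chart set \<Rightarrow> 'm \<Rightarrow> 'm chart" where
  "chart_at A x = (SOME c. c \<in> A \<and> x \<in> fst c)"

definition tvec :: "'m chart set \<Rightarrow> 'm chart \<Rightarrow> 'm \<Rightarrow> real^2 \<Rightarrow> real^2" where
  "tvec A c x w = frechet_derivative (snd (chart_at A x) \<circ> chart_inv c) (at (snd c x)) w"

definition differential ::
    "'m chart set \<Rightarrow> ('m \<Rightarrow> 'b::real_normed_vector) \<Rightarrow> 'm \<Rightarrow> real^2 \<Rightarrow> 'b" where
  "differential A h x X =
     frechet_derivative (h \<circ> chart_inv (chart_at A x)) (at (snd (chart_at A x) x)) X"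

definition local_form ::
    "'m chart set \<Rightarrow> 'm chart \<Rightarrow> ('m \<Rightarrow> real^2 \<Rightarrow> 'b) \<Rightarrow> real^2 \<Rightarrow> real^2 \<Rightarrow> 'b" where
  "local_form A c \<alpha> w y = \<alpha> (chart_inv c y) (tvec A c (chart_inv c y) w)"

definition smooth_form ::
    "'m::t2_space chart set \<Rightarrow> 'm set \<Rightarrow> ('m \<Rightarrow> real^2 \<Rightarrow> 'b::real_normed_vector) \<Rightarrow> bool" where
  "smooth_form A U \<alpha> \<longleftrightarrow> (\<forall>x\<in>U. linear (\<alpha> x)) \<and>
     (\<forall>c\<in>A. \<forall>w. smooth_on (snd c ` (U \<inter> fst c)) (local_form A c \<alpha> w))"

definition ext_deriv ::
    "'m chart set \<Rightarrow> ('m \<Rightarrow> real^2 \<Rightarrow> 'b::real_normed_vector) \<Rightarrow> 'm \<Rightarrow> real^2 \<Rightarrow> real^2 \<Rightarrow> 'b" where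
  "ext_deriv A \<alpha> x X Y = (let c = chart_at A x in
     frechet_derivative (local_form A c \<alpha> Y) (at (snd c x)) X -
     frechet_derivative (local_form A c \<alpha> X) (at (snd c x)) Y)"

definition closed_form ::
    "'m chart set \<Rightarrow> ('m \<Rightarrow> real^2 \<Rightarrow> 'b::real_normed_vector) \<Rightarrow> bool" where
  "closed_form A \<alpha> \<longleftrightarrow> (\<forall>x X Y. ext_deriv A \<alpha> x X Y = 0)"


section \<open>Riemannian metrics and the induced complex structure\<close>

type_synonym 'm bilin = "'m \<Rightarrow> real^2 \<Rightarrow> real^2 \<Rightarrow> real"

definition riemannian_metric :: "'m::t2_space chart set \<Rightarrow> 'm bilin \<Rightarrow> bool" where
  "riemannian_metric A g \<longleftrightarrow>
     (\<forall>x. bilinear (g x) \<and> (\<forall>X Y. g x X Y = g x Y X) \<and> (\<forall>X. X \<noteq> 0 \<longrightarrow> 0 < g x X X)) \<and>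
     (\<forall>c\<in>A. \<forall>v w. smooth_on (snd c ` fst c)
        (\<lambda>y. g (chart_inv c y) (tvec A c (chart_inv c y) v) (tvec A c (chart_inv c y) w)))"

text \<open>\<open>rot g x\<close> is the complex structure of the tangent space at \<open>x\<close>: the positive quarter turn.\<close>

definition rot :: "'m bilin \<Rightarrow> 'm \<Rightarrow> real^2 \<Rightarrow> real^2" where
  "rot g x X = (THE Y. g x X Y = 0 \<and> g x Y Y = g x X X \<and> 0 \<le> X$1 * Y$2 - X$2 * Y$1)"

definition star :: "'m bilin \<Rightarrow> ('m \<Rightarrow> real^2 \<Rightarrow> 'b) \<Rightarrow> 'm \<Rightarrow> real^2 \<Rightarrow> 'b" where
  "star g \<mu> x X = \<mu> x (rot g x X)"

definition vol :: "'m bilin \<Rightarrow> 'm bilin" where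
  "vol g x X Y = g x (rot g x X) Y"


section \<open>Integration of 2-forms\<close>

definition borel_partition ::
    "'m::t2_space chart set \<Rightarrow> nat \<Rightarrow> (nat \<Rightarrow> 'm chart) \<Rightarrow> (nat \<Rightarrow> 'm set) \<Rightarrow> bool" where
  "borel_partition A n c P \<longleftrightarrow>
     (\<Union>i<n. P i) = UNIV \<and> disjoint_family_on P {..<n} \<and>
     (\<forall>i<n. c i \<in> A \<and> P i \<in> sets borel \<and> P i \<subseteq> fst (c i))"

definition local_density :: "'m chart set \<Rightarrow> 'm chart \<Rightarrow> 'm bilin \<Rightarrow> real^2 \<Rightarrow> real" where
  "local_density A c \<sigma> y =
     \<sigma> (chart_inv c y) (tvec A c (chart_inv c y) (axis 1 1)) (tvec A c (chart_inv c y) (axis 2 1))"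

text \<open>
  The integral exists if the local integrals exist for every finite Borel partition subordinate
  to the atlas and their sum does not depend on the partition.
\<close>

definition has_surface_integral :: "'m::t2_space chart set \<Rightarrow> 'm bilin \<Rightarrow> real \<Rightarrow> bool" where
  "has_surface_integral A \<sigma> I \<longleftrightarrow>
     (\<forall>n c P. borel_partition A n c P \<longrightarrow>
        (\<forall>i<n. local_density A (c i) \<sigma> absolutely_integrable_on snd (c i) ` P i) \<and>
        (\<Sum>i<n. integral (snd (c i) ` P i) (local_density A (c i) \<sigma>)) = I)"

definition surface_integral :: "'m::t2_space chart set \<Rightarrow> 'm bilin \<Rightarrow> real" where
  "surface_integral A \<sigma> = (THE I. has_surface_integral A \<sigma> I)"


section \<open>Half-densities\<close>

text \<open>
  An element of the \<open>n\<close>-th power of the line \<open>|K|\<close> at \<open>x\<close> is a function of a tangent vector: a real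
  multiple of \<open>X \<mapsto> sqrt (g(X,X)) ^ n\<close>. Products and quotients are taken pointwise. Since
  \<open>vol g (X, rot X) = g(X,X)\<close>, the identification of 2-forms with squares of half-densities
  sends a 2-form \<open>\<sigma>\<close> to \<open>X \<mapsto> \<sigma>(X, rot X)\<close>; its inverse sends \<open>r * g\<close> to \<open>r * vol g\<close>.
\<close>

definition K_power :: "'m bilin \<Rightarrow> nat \<Rightarrow> 'm \<Rightarrow> (real^2 \<Rightarrow> real) set" where
  "K_power g n x = {k. \<exists>r. \<forall>X. k X = r * sqrt (g x X X) ^ n}"

definition form_of_density :: "'m bilin \<Rightarrow> ('m \<Rightarrow> real^2 \<Rightarrow> real) \<Rightarrow> 'm bilin" where
  "form_of_density g q x X Y = q x X / g x X X * vol g x X Y"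


section \<open>Spin bundles\<close>

text \<open>
  The type \<open>'l\<close> is the total space. The smooth structure of the bundle is given by local frames
  \<open>(U, s)\<close> with \<open>s\<close> a nowhere vanishing section over \<open>U\<close>. The pairing \<open>spair L v w X\<close> is
  evaluated for \<open>v\<close>, \<open>w\<close> in the same fibre.
\<close>

record ('m, 'l) spin_data =
  lproj :: "'l \<Rightarrow> 'm"
  ladd :: "'l \<Rightarrow> 'l \<Rightarrow> 'l"
  lscale :: "'l \<Rightarrow> quat \<Rightarrow> 'l"
  lframes :: "('m set \<times> ('m \<Rightarrow> 'l)) set"
  spair :: "'l \<Rightarrow> 'l \<Rightarrow> real^2 \<Rightarrow> quat"

definition lzero :: "('m, 'l) spin_data \<Rightarrow> 'l \<Rightarrow> bool" where
  "lzero L v \<longleftrightarrow> v = lscale L v 0"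

definition lneg :: "('m, 'l) spin_data \<Rightarrow> 'l \<Rightarrow> 'l" where
  "lneg L v = lscale L v (qreal (-1))"

definition coef :: "('m, 'l) spin_data \<Rightarrow> 'l \<Rightarrow> 'l \<Rightarrow> quat" where
  "coef L b v = (THE q. v = lscale L b q)"

text \<open>
  Every fibre is of the form \<open>s\<cdot>\<H>\<close> with unique coefficients; hence the remaining axioms of a right
  vector space (in particular the group axioms of \<open>ladd\<close>) follow from those listed.
\<close>

definition quaternionic_line_bundle ::
    "'m::t2_space chart set \<Rightarrow> ('m, 'l) spin_data \<Rightarrow> bool" where
  "quaternionic_line_bundle A L \<longleftrightarrow>
     (\<forall>v w. lproj L v = lproj L w \<longrightarrow> lproj L (ladd L v w) = lproj L v) \<and>
     (\<forall>v q. lproj L (lscale L v q) = lproj L v) \<and>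
     (\<forall>v. lscale L v (qreal 1) = v) \<and>
     (\<forall>v p q. lscale L (lscale L v p) q = lscale L v (p \<odot> q)) \<and>
     (\<forall>v p q. lscale L v (p + q) = ladd L (lscale L v p) (lscale L v q)) \<and>
     (\<forall>v w q. lproj L v = lproj L w \<longrightarrow>
        lscale L (ladd L v w) q = ladd L (lscale L v q) (lscale L w q)) \<and>
     (\<Union>(U, s)\<in>lframes L. U) = UNIV \<and>
     (\<forall>(U, s)\<in>lframes L. open U \<and>
        (\<forall>x\<in>U. lproj L (s x) = x \<and> (\<forall>v. lproj L v = x \<longrightarrow> (\<exists>!q. v = lscale L (s x) q)))) \<and>
     (\<forall>(U, s)\<in>lframes L. \<forall>(V, t)\<in>lframes L.
        smooth_map A (U \<inter> V) (\<lambda>x. coef L (s x) (t x)))"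

definition spin_pairing ::
    "'m::t2_space chart set \<Rightarrow> ('m, 'l) spin_data \<Rightarrow> bool" where
  "spin_pairing A L \<longleftrightarrow>
     (\<forall>v w. lproj L v = lproj L w \<longrightarrow> linear (spair L v w)) \<and>
     (\<forall>u v w X. lproj L u = lproj L v \<and> lproj L v = lproj L w \<longrightarrow>
        spair L (ladd L u v) w X = spair L u w X + spair L v w X \<and>
        spair L u (ladd L v w) X = spair L u v X + spair L u w X) \<and>
     (\<forall>v w p q X. lproj L v = lproj L w \<longrightarrow>
        spair L (lscale L v p) (lscale L w q) X = qcnj p \<odot> spair L v w X \<odot> q) \<and>
     (\<forall>v w X. lproj L v = lproj L w \<longrightarrow> qcnj (spair L v w X) = - spair L w v X) \<and>
     (\<forall>v X. \<not> lzero L v \<and> X \<noteq> 0 \<longrightarrow> spair L v v X \<noteq> 0) \<and>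
     (\<forall>(U, s)\<in>lframes L. smooth_form A U (\<lambda>x. spair L (s x) (s x)))"

definition spin_bundle ::
    "'m::t2_space chart set \<Rightarrow> 'm bilin \<Rightarrow> ('m, 'l) spin_data \<Rightarrow> bool" where
  "spin_bundle A g L \<longleftrightarrow> quaternionic_line_bundle A L \<and> spin_pairing A L \<and>
     (\<forall>v. \<not> lzero L v \<longrightarrow>
        (\<exists>\<rho>>0. \<forall>X. (norm (spair L v v X))\<^sup>2 = \<rho> * g (lproj L v) X X))"

definition section_of :: "'m::t2_space chart set \<Rightarrow> ('m, 'l) spin_data \<Rightarrow> ('m \<Rightarrow> 'l) set" where
  "section_of A L = {\<psi>. (\<forall>x. lproj L (\<psi> x) = x) \<and>
     (\<forall>(U, s)\<in>lframes L. smooth_map A U (\<lambda>x. coef L (s x) (\<psi> x)))}"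

definition nonvanishing_section ::
    "'m::t2_space chart set \<Rightarrow> ('m, 'l) spin_data \<Rightarrow> ('m \<Rightarrow> 'l) set" where
  "nonvanishing_section A L = {\<psi> \<in> section_of A L. \<forall>x. \<not> lzero L (\<psi> x)}"

definition bundle_form ::
    "'m::t2_space chart set \<Rightarrow> ('m, 'l) spin_data \<Rightarrow> ('m \<Rightarrow> real^2 \<Rightarrow> 'l) set" where
  "bundle_form A L = {\<mu>. (\<forall>x X. lproj L (\<mu> x X) = x) \<and>
     (\<forall>x X Y. \<mu> x (X + Y) = ladd L (\<mu> x X) (\<mu> x Y)) \<and>
     (\<forall>x r X. \<mu> x (r *\<^sub>R X) = lscale L (\<mu> x X) (qreal r)) \<and>
     (\<forall>(U, s)\<in>lframes L. smooth_form A U (\<lambda>x X. coef L (s x) (\<mu> x X)))}"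

definition spin_iso ::
    "'m::t2_space chart set \<Rightarrow> ('m, 'l) spin_data \<Rightarrow> ('m, 'k) spin_data \<Rightarrow> bool" where
  "spin_iso A L L' \<longleftrightarrow> (\<exists>\<Phi>. bij \<Phi> \<and>
     (\<forall>v. lproj L' (\<Phi> v) = lproj L v) \<and>
     (\<forall>v w. lproj L v = lproj L w \<longrightarrow> \<Phi> (ladd L v w) = ladd L' (\<Phi> v) (\<Phi> w)) \<and>
     (\<forall>v q. \<Phi> (lscale L v q) = lscale L' (\<Phi> v) q) \<and>
     (\<forall>(U, s)\<in>lframes L. \<forall>(V, t)\<in>lframes L'.
        smooth_map A (U \<inter> V) (\<lambda>x. coef L' (t x) (\<Phi> (s x)))) \<and>
     (\<forall>v w X. lproj L v = lproj L w \<longrightarrow> spair L' (\<Phi> v) (\<Phi> w) X = spair L v w X))"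

definition spin_complex_structure ::
    "'m::t2_space chart set \<Rightarrow> 'm bilin \<Rightarrow> ('m, 'l) spin_data \<Rightarrow> ('l \<Rightarrow> 'l) \<Rightarrow> bool" where
  "spin_complex_structure A g L J \<longleftrightarrow>
     (\<forall>v. lproj L (J v) = lproj L v) \<and>
     (\<forall>v w. lproj L v = lproj L w \<longrightarrow> J (ladd L v w) = ladd L (J v) (J w)) \<and>
     (\<forall>v q. J (lscale L v q) = lscale L (J v) q) \<and>
     (\<forall>v. J (J v) = lneg L v) \<and>
     (\<forall>\<psi>\<in>section_of A L. J \<circ> \<psi> \<in> section_of A L) \<and>
     (\<forall>v w X. lproj L v = lproj L w \<longrightarrow>
        spair L v w (rot g (lproj L v) X) = spair L (J v) w X \<and>
        spair L v w (rot g (lproj L v) X) = spair L v (J w) X)"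


section \<open>Dirac structure\<close>

definition Kbar_form ::
    "'m::t2_space chart set \<Rightarrow> 'm bilin \<Rightarrow> ('m, 'l) spin_data \<Rightarrow> ('l \<Rightarrow> 'l) \<Rightarrow>
     ('m \<Rightarrow> real^2 \<Rightarrow> 'l) set" where
  "Kbar_form A g L J = {\<mu> \<in> bundle_form A L. \<forall>x X. star g \<mu> x X = lneg L (J (\<mu> x X))}"

definition Kbar_part ::
    "'m bilin \<Rightarrow> ('m, 'l) spin_data \<Rightarrow> ('l \<Rightarrow> 'l) \<Rightarrow> ('m \<Rightarrow> real^2 \<Rightarrow> 'l) \<Rightarrow> 'm \<Rightarrow> real^2 \<Rightarrow> 'l" where
  "Kbar_part g L J \<mu> x X = lscale L (ladd L (\<mu> x X) (J (star g \<mu> x X))) (qreal (1/2))"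

definition dirac_structure ::
    "'m::t2_space chart set \<Rightarrow> 'm bilin \<Rightarrow> ('m, 'l) spin_data \<Rightarrow> ('l \<Rightarrow> 'l) \<Rightarrow>
     (('m \<Rightarrow> 'l) \<Rightarrow> 'm \<Rightarrow> real^2 \<Rightarrow> 'l) \<Rightarrow> bool" where
  "dirac_structure A g L J D \<longleftrightarrow>
     (\<forall>\<psi>\<in>section_of A L. D \<psi> \<in> Kbar_form A g L J) \<and>
     (\<forall>\<psi>\<in>section_of A L. \<forall>\<phi>\<in>section_of A L. \<forall>x X.
        D (\<lambda>y. ladd L (\<psi> y) (\<phi> y)) x X = ladd L (D \<psi> x X) (D \<phi> x X)) \<and>
     (\<forall>\<psi>\<in>section_of A L. \<forall>r x X.
        D (\<lambda>y. lscale L (\<psi> y) (qreal r)) x X = lscale L (D \<psi> x X) (qreal r)) \<and>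
     (\<forall>\<psi>\<in>section_of A L. \<forall>x X. D (J \<circ> \<psi>) x X = J (D \<psi> x X)) \<and>
     (\<forall>\<psi>\<in>section_of A L. \<forall>l. smooth_map A UNIV l \<longrightarrow> (\<forall>x X.
        D (\<lambda>y. lscale L (\<psi> y) (l y)) x X =
          ladd L (lscale L (D \<psi> x X) (l x))
            (Kbar_part g L J (\<lambda>y Y. lscale L (\<psi> y) (differential A l y Y)) x X))) \<and>
     (\<forall>\<psi>\<in>section_of A L. \<forall>\<phi>\<in>section_of A L. \<forall>x X Y.
        ext_deriv A (\<lambda>y. spair L (\<psi> y) (\<phi> y)) x X Y =
          (spair L (D \<psi> x X) (\<phi> x) Y - spair L (D \<psi> x Y) (\<phi> x) X) +
          (spair L (\<psi> x) (D \<phi> x X) Y - spair L (\<psi> x) (D \<phi> x Y) X))"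


section \<open>The functional\<close>

text \<open>\<open>lnorm2 L v\<close> is the half-density \<open>|v|\<^sup>2\<close> and \<open>linner\<close> its polarization.\<close>

definition lnorm2 :: "('m, 'l) spin_data \<Rightarrow> 'l \<Rightarrow> real^2 \<Rightarrow> real" where
  "lnorm2 L v X = norm (spair L v v X)"

definition linner :: "('m, 'l) spin_data \<Rightarrow> 'l \<Rightarrow> 'l \<Rightarrow> real^2 \<Rightarrow> real" where
  "linner L v w X = (lnorm2 L (ladd L v w) X - lnorm2 L v X - lnorm2 L w X) / 2"

definition wedge ::
    "('m, 'l) spin_data \<Rightarrow> ('m \<Rightarrow> real^2 \<Rightarrow> 'l) \<Rightarrow> ('m \<Rightarrow> real^2 \<Rightarrow> 'l) \<Rightarrow>
     'm \<Rightarrow> real^2 \<Rightarrow> real^2 \<Rightarrow> real^2 \<Rightarrow> real" where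
  "wedge L \<mu> \<nu> x X Y Z = (linner L (\<mu> x X) (\<nu> x Y) Z - linner L (\<mu> x Y) (\<nu> x X) Z) / 2"

text \<open>The half-density valued 2-form \<open>wedge\<close>, regarded as a section of the third power of \<open>|K|\<close>.\<close>

definition wedge_density ::
    "'m bilin \<Rightarrow> ('m, 'l) spin_data \<Rightarrow> ('m \<Rightarrow> real^2 \<Rightarrow> 'l) \<Rightarrow> ('m \<Rightarrow> real^2 \<Rightarrow> 'l) \<Rightarrow>
     'm \<Rightarrow> real^2 \<Rightarrow> real" where
  "wedge_density g L \<mu> \<nu> x Z = wedge L \<mu> \<nu> x Z (rot g x Z) Z"

definition integrand1 ::
    "'m bilin \<Rightarrow> ('m, 'l) spin_data \<Rightarrow> (('m \<Rightarrow> 'l) \<Rightarrow> 'm \<Rightarrow> real^2 \<Rightarrow> 'l) \<Rightarrow> ('m \<Rightarrow> 'l) \<Rightarrow>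
     'm \<Rightarrow> real^2 \<Rightarrow> real" where
  "integrand1 g L D \<psi> x Z = wedge_density g L (star g (D \<psi>)) (D \<psi>) x Z / lnorm2 L (\<psi> x) Z"

definition integrand2 ::
    "'m bilin \<Rightarrow> ('m, 'l) spin_data \<Rightarrow> (('m \<Rightarrow> 'l) \<Rightarrow> 'm \<Rightarrow> real^2 \<Rightarrow> 'l) \<Rightarrow> ('m \<Rightarrow> 'l) \<Rightarrow>
     'm \<Rightarrow> real^2 \<Rightarrow> real" where
  "integrand2 g L D \<psi> x Z =
     (wedge_density g L (star g (D \<psi>))
        (\<lambda>y X. lscale L (\<psi> y) (spair L (\<psi> y) (\<psi> y) X)) x Z)\<^sup>2 / lnorm2 L (\<psi> x) Z ^ 4"

definition integrand3 ::
    "'m bilin \<Rightarrow> ('m, 'l) spin_data \<Rightarrow> ('l \<Rightarrow> 'l) \<Rightarrow> (('m \<Rightarrow> 'l) \<Rightarrow> 'm \<Rightarrow> real^2 \<Rightarrow> 'l) \<Rightarrow>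
     ('m \<Rightarrow> 'l) \<Rightarrow> 'm \<Rightarrow> real^2 \<Rightarrow> real" where
  "integrand3 g L J D \<psi> x Z =
     (wedge_density g L (star g (D \<psi>))
        (\<lambda>y X. lscale L (J (\<psi> y)) (spair L (\<psi> y) (\<psi> y) X)) x Z)\<^sup>2 / lnorm2 L (\<psi> x) Z ^ 4"

definition energy ::
    "'m::t2_space chart set \<Rightarrow> 'm bilin \<Rightarrow> ('m, 'l) spin_data \<Rightarrow> ('l \<Rightarrow> 'l) \<Rightarrow>
     (('m \<Rightarrow> 'l) \<Rightarrow> 'm \<Rightarrow> real^2 \<Rightarrow> 'l) \<Rightarrow> real \<Rightarrow> real \<Rightarrow> real \<Rightarrow> ('m \<Rightarrow> 'l) \<Rightarrow> real" where
  "energy A g L J D \<epsilon>\<^sub>1 \<epsilon>\<^sub>2 \<epsilon>\<^sub>3 \<psi> =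
     \<epsilon>\<^sub>1 * surface_integral A (form_of_density g (integrand1 g L D \<psi>)) +
     (\<epsilon>\<^sub>2 - \<epsilon>\<^sub>1) * surface_integral A (form_of_density g (integrand2 g L D \<psi>)) +
     (\<epsilon>\<^sub>3 - \<epsilon>\<^sub>1) * surface_integral A (form_of_density g (integrand3 g L J D \<psi>))"

definition integrable_density ::
    "'m::t2_space chart set \<Rightarrow> 'm bilin \<Rightarrow> ('m \<Rightarrow> real^2 \<Rightarrow> real) \<Rightarrow> bool" where
  "integrable_density A g q \<longleftrightarrow> (\<forall>x. q x \<in> K_power g 2 x) \<and>
     (\<exists>!I. has_surface_integral A (form_of_density g q) I)"

definition metric_constraint :: "'m bilin \<Rightarrow> ('m, 'l) spin_data \<Rightarrow> ('m \<Rightarrow> 'l) \<Rightarrow> bool" where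
  "metric_constraint g L \<psi> \<longleftrightarrow> (\<forall>x X. (lnorm2 L (\<psi> x) X)\<^sup>2 = g x X X)"


section \<open>Periods\<close>

text \<open>A closed curve is given as a list of smooth pieces, each parametrized over \<open>[0,1]\<close>.\<close>

definition smooth_curve :: "'m::t2_space chart set \<Rightarrow> (real \<Rightarrow> 'm) \<Rightarrow> bool" where
  "smooth_curve A \<gamma> \<longleftrightarrow> (\<exists>T. open T \<and> {0..1} \<subseteq> T \<and> continuous_on T \<gamma> \<and>
     (\<forall>c\<in>A. smooth_on (T \<inter> \<gamma> -` fst c) (snd c \<circ> \<gamma>)))"

definition velocity :: "'m chart set \<Rightarrow> (real \<Rightarrow> 'm) \<Rightarrow> real \<Rightarrow> real^2" where
  "velocity A \<gamma> t = vector_derivative (snd (chart_at A (\<gamma> t)) \<circ> \<gamma>) (at t)"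

definition closed_curve :: "'m::t2_space chart set \<Rightarrow> (real \<Rightarrow> 'm) list \<Rightarrow> bool" where
  "closed_curve A \<gamma>s \<longleftrightarrow> \<gamma>s \<noteq> [] \<and> (\<forall>\<gamma>\<in>set \<gamma>s. smooth_curve A \<gamma>) \<and>
     (\<forall>i<length \<gamma>s. (\<gamma>s ! i) 1 = (\<gamma>s ! (Suc i mod length \<gamma>s)) 0)"

definition curve_integral ::
    "'m chart set \<Rightarrow> ('m \<Rightarrow> real^2 \<Rightarrow> 'b::euclidean_space) \<Rightarrow> (real \<Rightarrow> 'm) list \<Rightarrow> 'b" where
  "curve_integral A \<alpha> \<gamma>s = (\<Sum>\<gamma>\<leftarrow>\<gamma>s. integral {0..1} (\<lambda>t. \<alpha> (\<gamma> t) (velocity A \<gamma> t)))"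

text \<open>
  Periods are only defined for closed 1-forms, where the integral over a closed curve depends on
  its homology class alone.
\<close>

definition vanishing_periods ::
    "'m::t2_space chart set \<Rightarrow> ('m \<Rightarrow> real^2 \<Rightarrow> 'b::euclidean_space) \<Rightarrow> bool" where
  "vanishing_periods A \<alpha> \<longleftrightarrow>
     (closed_form A \<alpha> \<longrightarrow> (\<forall>\<gamma>s. closed_curve A \<gamma>s \<longrightarrow> curve_integral A \<alpha> \<gamma>s = 0))"


section \<open>Immersions and regular homotopy classes\<close>

definition immersion :: "'m::t2_space chart set \<Rightarrow> ('m \<Rightarrow> real^3) \<Rightarrow> bool" where
  "immersion A f \<longleftrightarrow> smooth_map A UNIV f \<and> (\<forall>x. inj (differential A f x))"

definition isometric_immersion ::
    "'m::t2_space chart set \<Rightarrow> 'm bilin \<Rightarrow> ('m \<Rightarrow> real^3) \<Rightarrow> bool" where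
  "isometric_immersion A g f \<longleftrightarrow> immersion A f \<and>
     (\<forall>x X Y. differential A f x X \<bullet> differential A f x Y = g x X Y)"

definition conformal_form ::
    "'m::t2_space chart set \<Rightarrow> 'm bilin \<Rightarrow> ('m \<Rightarrow> real^2 \<Rightarrow> real^3) \<Rightarrow> bool" where
  "conformal_form A g \<omega> \<longleftrightarrow> smooth_form A UNIV \<omega> \<and>
     (\<forall>x. \<exists>\<rho>>0. \<forall>X Y. \<omega> x X \<bullet> \<omega> x Y = \<rho> * g x X Y)"

definition induced_bundle :: "('m \<Rightarrow> real^2 \<Rightarrow> real^3) \<Rightarrow> ('m, 'm \<times> quat) spin_data" where
  "induced_bundle \<omega> =
     \<lparr> lproj = fst,
       ladd = (\<lambda>v w. (fst v, snd v + snd w)),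
       lscale = (\<lambda>v q. (fst v, snd v \<odot> q)),
       lframes = {(UNIV, \<lambda>x. (x, qreal 1))},
       spair = (\<lambda>v w X. qcnj (snd v) \<odot> qimag (\<omega> (fst v) X) \<odot> snd w) \<rparr>"

definition in_regular_homotopy_class ::
    "'m::t2_space chart set \<Rightarrow> 'm bilin \<Rightarrow> ('m, 'l) spin_data \<Rightarrow> ('m \<Rightarrow> real^3) \<Rightarrow> bool" where
  "in_regular_homotopy_class A g L h \<longleftrightarrow> immersion A h \<and>
     (\<exists>\<omega> B. conformal_form A g \<omega> \<and>
        (\<forall>x. linear (B x) \<and> (\<forall>X Y. g x (B x X) Y = g x X (B x Y)) \<and>
           (\<forall>X. X \<noteq> 0 \<longrightarrow> 0 < g x (B x X) X) \<and> det (matrix (B x)) = 1) \<and>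
        (\<forall>x X. differential A h x X = \<omega> x (B x X)) \<and>
        spin_iso A (induced_bundle \<omega>) L)"

end

theory Submission
  imports Defs
begin

text \<open>
  Use \<open>\<psi>\<close> itself as frame of \<open>L\<close>. At a point write \<open>\<sigma> = (\<psi>,\<psi>)\<close>, \<open>J\<psi> = \<psi>n\<close> and \<open>D\<psi> = \<psi>m\<close>, where \<open>n\<^sup>2 = -1\<close>,
  \<open>\<sigma>\<close> is imaginary, and \<open>*\<sigma> = -n\<sigma>\<close>, \<open>*m = -nm\<close>. The three integrands become \<open>|m|\<^sup>2\<close>, \<open>\<langle>m,\<sigma>\<rangle>\<^sup>2/|\<sigma>|\<^sup>2\<close> and
  \<open>\<langle>m,n\<sigma>\<rangle>\<^sup>2/|\<sigma>|\<^sup>2\<close>. As \<open>\<sigma>\<close> and \<open>n\<sigma>\<close> are orthogonal of equal length, Bessel's inequality makes the energy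
  density non-negative, and for \<open>\<epsilon>\<^sub>3 = 0\<close> it vanishes iff \<open>m\<close> is a real multiple of \<open>n\<sigma>\<close>. On the other hand
  \<open>d\<sigma>(X, rot X) = -4 Im (n\<sigma>m)\<close>, which vanishes under the same condition. Hence zero energy means that
  \<open>(\<psi>,\<psi>)\<close> is closed; without periods it integrates along chains of curves to \<open>f\<close> with \<open>df = (\<psi>,\<psi>)\<close>, and
  \<open>(x,q) \<mapsto> \<psi>(x)q\<close> identifies the spin bundle induced by \<open>f\<close> with \<open>L\<close>. Conversely, for an isometric \<open>f\<close> in
  the regular homotopy class of \<open>L\<close>, the image of the constant section 1 under the bundle isomorphism is \<open>\<psi>\<close>.
\<close>

section \<open>Smooth functions\<close>

text \<open>The differences of weights in the functional come from an orthogonal decomposition: m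
  splits into components along \<sigma> and n\<sigma> and a remainder, and the energy density is
  \<open>\<epsilon>\<^sub>1\<close> times the squared remainder plus
  \<open>\<epsilon>\<^sub>2\<close> and \<open>\<epsilon>\<^sub>3\<close> times the squares of the
  two components. For \<open>\<epsilon>\<^sub>3 = 0\<close> the component along n\<sigma> is free;
  for an isometric immersion its coefficient is, up to a constant factor, the mean curvature.

  Two features of the encoding shape the analysis. Tangent vectors are coordinates in a chart that
  jumps with the point, so continuity makes sense only for values on the coordinate fields
  \<open>tvec A c x w\<close>, and densities have to be rewritten in terms of these. An integral is
  a number common to all finite Borel partitions, so even its existence needs the change of
  variables formula; to pass from zero energy to a density vanishing everywhere, continuity is
  combined with a partition that has a whole chart domain as a piece. The surface may have several
  components, so the primitive of a form is normalized in each of them separately.\<close>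

lemma frechet_derivative_cong_open:
  assumes "open S" "x \<in> S" "\<And>y. y \<in> S \<Longrightarrow> f y = g y"
  shows "frechet_derivative f (at x) = frechet_derivative g (at x)"
proof -
  have "(f has_derivative D) (at x) \<longleftrightarrow> (g has_derivative D) (at x)" for D
    using assms has_derivative_transform_within_open[of f D x UNIV S g]
      has_derivative_transform_within_open[of g D x UNIV S f] by auto
  then show ?thesis unfolding frechet_derivative_def by simp
qed

lemma differentiable_cong_open:
  assumes "open S" "x \<in> S" "\<And>y. y \<in> S \<Longrightarrow> f y = g y"
  shows "f differentiable (at x) \<longleftrightarrow> g differentiable (at x)"
  unfolding differentiable_def
  using assms has_derivative_transform_within_open[of f _ x UNIV S g]
    has_derivative_transform_within_open[of g _ x UNIV S f] by metis

lemma ck_on_cong: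
  assumes "open S" "\<And>x. x \<in> S \<Longrightarrow> f x = g x"
  shows "ck_on n S f \<longleftrightarrow> ck_on n S g"
  using assms(2)
proof (induction n arbitrary: f g)
  case 0
  then show ?case by (simp cong: continuous_on_cong)
next
  case (Suc n)
  have "frechet_derivative f (at x) = frechet_derivative g (at x)"
    and "f differentiable (at x) \<longleftrightarrow> g differentiable (at x)" if "x \<in> S" for x
    using frechet_derivative_cong_open[OF assms(1) that] differentiable_cong_open[OF assms(1) that]
      Suc.prems by auto
  then show ?case
    using Suc.IH[of "\<lambda>x. frechet_derivative f (at x) v" "\<lambda>x. frechet_derivative g (at x) v" for v]
    by auto
qed

lemma smooth_on_cong:
  assumes "open S" "\<And>x. x \<in> S \<Longrightarrow> f x = g x"
  shows "smooth_on S f \<longleftrightarrow> smooth_on S g"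
  unfolding smooth_on_def using ck_on_cong[of S f g] assms by blast

text \<open>The clause for \<open>Suc n\<close> does not contain the one for \<open>n\<close>; at
  the bottom of the induction differentiability supplies continuity.\<close>

lemma ck_on_SucD: "ck_on (Suc n) S f \<Longrightarrow> ck_on n S f"
proof (induction n arbitrary: f)
  case 0
  then show ?case
    by (simp add: continuous_at_imp_continuous_on differentiable_imp_continuous_within)
next
  case (Suc n)
  then show ?case by (metis ck_on.simps(2))
qed

lemma smooth_on_continuous: "smooth_on S f \<Longrightarrow> continuous_on S f"
  unfolding smooth_on_def by (metis ck_on.simps(1))

lemma smooth_on_differentiable: "smooth_on S f \<Longrightarrow> x \<in> S \<Longrightarrow> f differentiable (at x)"
  unfolding smooth_on_def by (metis ck_on.simps(2))

lemma smooth_on_has_derivative: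
  "smooth_on S f \<Longrightarrow> x \<in> S \<Longrightarrow> (f has_derivative frechet_derivative f (at x)) (at x)"
  using smooth_on_differentiable frechet_derivative_works by blast

lemma smooth_on_frechet_derivative:
  "smooth_on S f \<Longrightarrow> smooth_on S (\<lambda>x. frechet_derivative f (at x) v)"
  unfolding smooth_on_def by (metis ck_on.simps(2))

text \<open>For functions known through their derivative, such as the primitive of a smooth
  form.\<close>

lemma smooth_onI_derivative:
  assumes "\<And>x. x \<in> S \<Longrightarrow> f differentiable (at x)"
    and "\<And>v. smooth_on S (\<lambda>x. frechet_derivative f (at x) v)"
  shows "smooth_on S f"
  unfolding smooth_on_def
proof
  fix n
  have "ck_on (Suc n) S f" using assms by (auto simp: smooth_on_def)
  then show "ck_on n S f" by (rule ck_on_SucD)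
qed

text \<open>Derivatives are taken at points within the whole space, so each clause can be checked in
  a neighbourhood. Bundle frames provide regularity on such pieces only.\<close>

lemma ck_on_local:
  assumes "\<And>x. x \<in> S \<Longrightarrow> \<exists>T. open T \<and> x \<in> T \<and> ck_on n T f"
  shows "ck_on n S f"
  using assms
proof (induction n arbitrary: f)
  case 0
  have "isCont f x" if "x \<in> S" for x
    using 0[OF that] continuous_on_eq_continuous_at by auto
  then show ?case by (simp add: continuous_at_imp_continuous_on)
next
  case (Suc n)
  have "f differentiable (at x)" if "x \<in> S" for x
    using Suc.prems[OF that] by auto
  moreover have "ck_on n S (\<lambda>x. frechet_derivative f (at x) v)" for v
    by (rule Suc.IH) (use Suc.prems in \<open>auto, blast\<close>)
  ultimately show ?case by auto
qed

lemma smooth_on_local: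
  assumes "\<And>x. x \<in> S \<Longrightarrow> \<exists>T. open T \<and> x \<in> T \<and> smooth_on T f"
  shows "smooth_on S f"
  unfolding smooth_on_def using ck_on_local[of S _ f] assms unfolding smooth_on_def by metis

section \<open>Sums, products and compositions\<close>

lemma ck_on_add:
  assumes "open S"
  shows "ck_on n S f \<Longrightarrow> ck_on n S g \<Longrightarrow> ck_on n S (\<lambda>x. f x + g x)"
proof (induction n arbitrary: f g)
  case 0
  then show ?case by (auto intro: continuous_intros)
next
  case (Suc n)
  have "ck_on n S (\<lambda>x. frechet_derivative (\<lambda>x. f x + g x) (at x) v)" for v
  proof -
    have "ck_on n S (\<lambda>x. frechet_derivative f (at x) v + frechet_derivative g (at x) v)"
      using Suc by auto
    moreover have "frechet_derivative (\<lambda>x. f x + g x) (at x) v =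
        frechet_derivative f (at x) v + frechet_derivative g (at x) v" if "x \<in> S" for x
      using Suc.prems that
      by (intro frechet_derivative_at[symmetric, THEN fun_cong] has_derivative_add)
        (auto simp: frechet_derivative_works[symmetric])
    ultimately show ?thesis using ck_on_cong[OF assms] by (metis (no_types, lifting))
  qed
  then show ?case using Suc.prems by auto
qed

text \<open>The product rule brings back \<open>f\<close> and \<open>g\<close> undifferentiated, so
  the induction also uses their regularity at the lower order, from
  \<open>ck_on_SucD\<close>.\<close>

lemma ck_on_bounded_bilinear:
  assumes "bounded_bilinear p" "open S"
  shows "ck_on n S f \<Longrightarrow> ck_on n S g \<Longrightarrow> ck_on n S (\<lambda>x. p (f x) (g x))"
proof (induction n arbitrary: f g)
  case 0
  then show ?case by (auto intro: bounded_bilinear.continuous_on[OF assms(1)])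
next
  case (Suc n)
  have d: "((\<lambda>x. p (f x) (g x)) has_derivative
      (\<lambda>v. p (f x) (frechet_derivative g (at x) v) + p (frechet_derivative f (at x) v) (g x))) (at x)"
    if "x \<in> S" for x
    using Suc.prems that
    by (intro bounded_bilinear.FDERIV[OF assms(1)]) (auto simp: frechet_derivative_works[symmetric])
  have "ck_on n S (\<lambda>x. frechet_derivative (\<lambda>x. p (f x) (g x)) (at x) v)" for v
  proof -
    have "ck_on n S (\<lambda>x. p (f x) (frechet_derivative g (at x) v) + p (frechet_derivative f (at x) v) (g x))"
      using Suc ck_on_SucD[OF Suc.prems(1)] ck_on_SucD[OF Suc.prems(2)]
      by (intro ck_on_add assms Suc.IH) auto
    moreover have "frechet_derivative (\<lambda>x. p (f x) (g x)) (at x) v =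
        p (f x) (frechet_derivative g (at x) v) + p (frechet_derivative f (at x) v) (g x)"
      if "x \<in> S" for x
      using frechet_derivative_at[OF d[OF that]] by metis
    ultimately show ?thesis using ck_on_cong[OF assms(2)] by (metis (no_types, lifting))
  qed
  then show ?case using d unfolding ck_on.simps differentiable_def by blast
qed

lemma smooth_on_bounded_bilinear:
  "bounded_bilinear p \<Longrightarrow> open S \<Longrightarrow> smooth_on S f \<Longrightarrow> smooth_on S g \<Longrightarrow>
    smooth_on S (\<lambda>x. p (f x) (g x))"
  unfolding smooth_on_def using ck_on_bounded_bilinear by blast

lemma ck_on_bounded_linear:
  assumes "bounded_linear l" "open S"
  shows "ck_on n S f \<Longrightarrow> ck_on n S (\<lambda>x. l (f x))"
proof (induction n arbitrary: f)
  case 0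
  then show ?case by (auto intro: bounded_linear.continuous_on[OF assms(1)])
next
  case (Suc n)
  have d: "((\<lambda>x. l (f x)) has_derivative (\<lambda>v. l (frechet_derivative f (at x) v))) (at x)"
    if "x \<in> S" for x
    using Suc.prems that
    by (intro bounded_linear.has_derivative[OF assms(1)]) (auto simp: frechet_derivative_works[symmetric])
  have "ck_on n S (\<lambda>x. frechet_derivative (\<lambda>x. l (f x)) (at x) v)" for v
  proof -
    have "ck_on n S (\<lambda>x. l (frechet_derivative f (at x) v))"
      using Suc by auto
    moreover have "frechet_derivative (\<lambda>x. l (f x)) (at x) v = l (frechet_derivative f (at x) v)"
      if "x \<in> S" for x
      using frechet_derivative_at[OF d[OF that]] by metis
    ultimately show ?thesis using ck_on_cong[OF assms(2)] by (metis (no_types, lifting))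
  qed
  then show ?case using d unfolding ck_on.simps differentiable_def by blast
qed

lemma smooth_on_bounded_linear:
  "bounded_linear l \<Longrightarrow> open S \<Longrightarrow> smooth_on S f \<Longrightarrow> smooth_on S (\<lambda>x. l (f x))"
  unfolding smooth_on_def using ck_on_bounded_linear by blast

text \<open>Along an affine line the direction of differentiation stays constant, so the derivative
  is again a function composed with the same line and the induction closes. The curves to be built
  are segments in charts and reversals of given curves.\<close>

lemma ck_on_compose_line:
  fixes a h :: "'a::euclidean_space" and f :: "'a \<Rightarrow> 'b::real_normed_vector"
  assumes "open T" "\<And>t::real. t \<in> T \<Longrightarrow> a + t *\<^sub>R h \<in> S"
  shows "ck_on n S f \<Longrightarrow> ck_on n T (\<lambda>t. f (a + t *\<^sub>R h))"
proof (induction n arbitrary: f)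
  case 0
  then show ?case
    by (auto intro!: continuous_on_compose2[where g=f and f="\<lambda>t. a + t *\<^sub>R h"] continuous_intros assms)
next
  case (Suc n)
  have d: "((\<lambda>t. f (a + t *\<^sub>R h)) has_derivative
      (\<lambda>s. frechet_derivative f (at (a + t *\<^sub>R h)) (s *\<^sub>R h))) (at t)"
    if "t \<in> T" for t
  proof (rule has_derivative_compose[where f="\<lambda>t. a + t *\<^sub>R h" and g=f])
    show "((\<lambda>t. a + t *\<^sub>R h) has_derivative (\<lambda>s. s *\<^sub>R h)) (at t)"
      by (auto intro!: derivative_eq_intros)
    show "(f has_derivative frechet_derivative f (at (a + t *\<^sub>R h))) (at (a + t *\<^sub>R h))"
      using Suc.prems assms(2)[OF that] by (auto simp: frechet_derivative_works[symmetric])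
  qed
  have "ck_on n T (\<lambda>t. frechet_derivative (\<lambda>t. f (a + t *\<^sub>R h)) (at t) v)" for v
  proof -
    have "ck_on n T (\<lambda>t. frechet_derivative f (at (a + t *\<^sub>R h)) (v *\<^sub>R h))"
      using Suc.IH[of "\<lambda>x. frechet_derivative f (at x) (v *\<^sub>R h)"] Suc.prems by auto
    moreover have "frechet_derivative (\<lambda>t. f (a + t *\<^sub>R h)) (at t) v =
        frechet_derivative f (at (a + t *\<^sub>R h)) (v *\<^sub>R h)" if "t \<in> T" for t
      using frechet_derivative_at[OF d[OF that]] by metis
    ultimately show ?thesis using ck_on_cong[OF assms(1)] by (metis (no_types, lifting))
  qed
  then show ?case using d unfolding ck_on.simps differentiable_def by blast
qed

lemma smooth_on_compose_line:
  fixes a h :: "'a::euclidean_space"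
  assumes "open T" "\<And>t::real. t \<in> T \<Longrightarrow> a + t *\<^sub>R h \<in> S" "smooth_on S f"
  shows "smooth_on T (\<lambda>t. f (a + t *\<^sub>R h))"
  using ck_on_compose_line[OF assms(1,2)] assms(3) unfolding smooth_on_def by blast

section \<open>Symmetry of second derivatives\<close>

lemma second_difference_mean_value:
  fixes f :: "'a::euclidean_space \<Rightarrow> real"
  assumes f: "ck_on 2 S f" and h: "0 < h"
    and S: "\<And>s t. 0 \<le> s \<Longrightarrow> s \<le> h \<Longrightarrow> 0 \<le> t \<Longrightarrow> t \<le> h \<Longrightarrow> x + s *\<^sub>R u + t *\<^sub>R v \<in> S"
  shows "\<exists>\<xi> \<eta>. 0 \<le> \<xi> \<and> \<xi> \<le> h \<and> 0 \<le> \<eta> \<and> \<eta> \<le> h \<and>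
    f (x + h *\<^sub>R u + h *\<^sub>R v) - f (x + h *\<^sub>R u) - f (x + h *\<^sub>R v) + f x =
    h\<^sup>2 * frechet_derivative (\<lambda>y. frechet_derivative f (at y) u) (at (x + \<xi> *\<^sub>R u + \<eta> *\<^sub>R v)) v"
proof -
  have d1: "(f has_derivative frechet_derivative f (at y)) (at y)" if "y \<in> S" for y
    using f that by (auto simp: numeral_2_eq_2 frechet_derivative_works[symmetric])
  have d2: "((\<lambda>y. frechet_derivative f (at y) u) has_derivative
      frechet_derivative (\<lambda>y. frechet_derivative f (at y) u) (at y)) (at y)" if "y \<in> S" for y
    using f that by (auto simp: numeral_2_eq_2 frechet_derivative_works[symmetric])
  have line: "((\<lambda>s. g (a + s *\<^sub>R w)) has_real_derivative frechet_derivative g (at (a + s *\<^sub>R w)) w) (at s)"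
    if "(g has_derivative frechet_derivative g (at (a + s *\<^sub>R w))) (at (a + s *\<^sub>R w))"
    for g :: "'a \<Rightarrow> real" and a w s
  proof -
    have "((\<lambda>s. g (a + s *\<^sub>R w)) has_derivative
        (\<lambda>r. frechet_derivative g (at (a + s *\<^sub>R w)) (r *\<^sub>R w))) (at s)"
      by (rule has_derivative_compose[where f="\<lambda>s. a + s *\<^sub>R w" and g=g, OF _ that])
        (auto intro!: derivative_eq_intros)
    then show ?thesis
      unfolding has_field_derivative_def
      using linear_scale[OF has_derivative_linear[OF that]] by (simp add: mult.commute[of _ "frechet_derivative _ _ _"])
  qed
  \<comment> \<open>The second difference is the increment over \<open>[0,h]\<close>, along
    \<open>u\<close>, of the first difference in direction \<open>v\<close>. The mean value theorem
    is applied to it, and then along \<open>v\<close> to the derivative in direction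
    \<open>u\<close>.\<close>
  define \<phi> where "\<phi> s = f ((x + h *\<^sub>R v) + s *\<^sub>R u) - f (x + s *\<^sub>R u)" for s
  have "\<exists>\<xi>. \<xi> > 0 \<and> \<xi> < h \<and> \<phi> h - \<phi> 0 = (h - 0) *
      (frechet_derivative f (at ((x + h *\<^sub>R v) + \<xi> *\<^sub>R u)) u - frechet_derivative f (at (x + \<xi> *\<^sub>R u)) u)"
    unfolding \<phi>_def
    using S[of _ 0] S[of _ h] h
    by (intro MVT2 DERIV_diff line d1) (auto simp: algebra_simps)
  then obtain \<xi> where \<xi>: "\<xi> > 0" "\<xi> < h" and e1: "\<phi> h - \<phi> 0 = (h - 0) *
      (frechet_derivative f (at ((x + h *\<^sub>R v) + \<xi> *\<^sub>R u)) u - frechet_derivative f (at (x + \<xi> *\<^sub>R u)) u)"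
    by blast
  define \<theta> where "\<theta> t = frechet_derivative f (at ((x + \<xi> *\<^sub>R u) + t *\<^sub>R v)) u" for t
  have "\<exists>\<eta>. \<eta> > 0 \<and> \<eta> < h \<and> \<theta> h - \<theta> 0 = (h - 0) *
      frechet_derivative (\<lambda>y. frechet_derivative f (at y) u) (at ((x + \<xi> *\<^sub>R u) + \<eta> *\<^sub>R v)) v"
    unfolding \<theta>_def
    using S[of \<xi>] h \<xi>
    by (intro MVT2 line[where g="\<lambda>y. frechet_derivative f (at y) u"] d2) auto
  then obtain \<eta> where \<eta>: "\<eta> > 0" "\<eta> < h" and e2: "\<theta> h - \<theta> 0 = (h - 0) *
      frechet_derivative (\<lambda>y. frechet_derivative f (at y) u) (at ((x + \<xi> *\<^sub>R u) + \<eta> *\<^sub>R v)) v"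
    by blast
  have "f (x + h *\<^sub>R u + h *\<^sub>R v) - f (x + h *\<^sub>R u) - f (x + h *\<^sub>R v) + f x = \<phi> h - \<phi> 0"
    by (simp add: \<phi>_def algebra_simps)
  also have "\<dots> = h * (\<theta> h - \<theta> 0)" using e1 by (simp add: \<theta>_def algebra_simps)
  also have "\<dots> = h\<^sup>2 * frechet_derivative (\<lambda>y. frechet_derivative f (at y) u) (at (x + \<xi> *\<^sub>R u + \<eta> *\<^sub>R v)) v"
    by (simp add: e2 power2_eq_square)
  finally show ?thesis using \<xi> \<eta> by (intro exI[of _ \<xi>] exI[of _ \<eta>]) auto
qed

text \<open>The second difference is symmetric in \<open>u\<close> and \<open>v\<close>, so the two
  mixed derivatives take equal values at two points close to \<open>x\<close>; continuity then
  excludes a gap at \<open>x\<close>.\<close>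

lemma second_derivative_symmetric_real:
  fixes f :: "'a::euclidean_space \<Rightarrow> real"
  assumes S: "open S" "x \<in> S" and f: "ck_on 2 S f"
  shows "frechet_derivative (\<lambda>y. frechet_derivative f (at y) u) (at x) v =
    frechet_derivative (\<lambda>y. frechet_derivative f (at y) v) (at x) u" (is "?a x = ?b x")
proof (rule ccontr)
  assume neq: "?a x \<noteq> ?b x"
  define e where "e = \<bar>?a x - ?b x\<bar> / 2"
  have e: "e > 0" using neq by (simp add: e_def)
  have "isCont ?a x" "isCont ?b x"
    using f S by (auto simp: numeral_2_eq_2 continuous_on_eq_continuous_at)
  then have "\<exists>d>0. \<forall>y. dist y x < d \<longrightarrow> dist (?a y) (?a x) < e"
    and "\<exists>d>0. \<forall>y. dist y x < d \<longrightarrow> dist (?b y) (?b x) < e"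
    using e unfolding continuous_at_eps_delta by auto
  then obtain d1 d2 where d: "d1 > 0" "\<And>y. dist y x < d1 \<Longrightarrow> dist (?a y) (?a x) < e"
      "d2 > 0" "\<And>y. dist y x < d2 \<Longrightarrow> dist (?b y) (?b x) < e"
    by metis
  obtain d3 where d3: "d3 > 0" "ball x d3 \<subseteq> S" using S openE by blast
  define k where "k = norm u + norm v"
  have k: "k \<ge> 0" by (simp add: k_def)
  \<comment> \<open>The denominator exceeds \<open>k\<close> and is positive even for
    \<open>u = v = 0\<close>, so the whole parallelogram stays within all three radii.\<close>
  define h where "h = min d1 (min d2 d3) / (2 * (k + 1))"
  have h: "h > 0" using d(1,3) d3(1) k by (simp add: h_def)
  have "h * (2 * (k + 1)) = min d1 (min d2 d3)"
    unfolding h_def using k by simp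
  moreover have "h * (2 * (k + 1)) = h * k + h * (k + 2)" by (simp add: algebra_simps)
  moreover have "0 < h * (k + 2)" using h k by simp
  ultimately have hd: "h * k < min d1 (min d2 d3)" by linarith
  have near: "dist (x + s *\<^sub>R u + t *\<^sub>R v) x < min d1 (min d2 d3)"
    if "0 \<le> s" "s \<le> h" "0 \<le> t" "t \<le> h" for s t
  proof -
    have "dist (x + s *\<^sub>R u + t *\<^sub>R v) x \<le> s * norm u + t * norm v"
      using norm_triangle_ineq[of "s *\<^sub>R u" "t *\<^sub>R v"] that by (simp add: dist_norm add.assoc)
    also have "\<dots> \<le> h * norm u + h * norm v"
      using that by (intro add_mono mult_right_mono) auto
    finally show ?thesis using hd by (simp add: distrib_left k_def)
  qed
  have inS: "x + s *\<^sub>R u + t *\<^sub>R v \<in> S" if "0 \<le> s" "s \<le> h" "0 \<le> t" "t \<le> h" for s t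
    using near[OF that] d3 by (auto simp: dist_commute)
  obtain \<xi> \<eta> where 1: "0 \<le> \<xi>" "\<xi> \<le> h" "0 \<le> \<eta>" "\<eta> \<le> h"
    "f (x + h *\<^sub>R u + h *\<^sub>R v) - f (x + h *\<^sub>R u) - f (x + h *\<^sub>R v) + f x = h\<^sup>2 * ?a (x + \<xi> *\<^sub>R u + \<eta> *\<^sub>R v)"
    using second_difference_mean_value[OF f h inS] by blast
  have inS': "x + s *\<^sub>R v + t *\<^sub>R u \<in> S" if "0 \<le> s" "s \<le> h" "0 \<le> t" "t \<le> h" for s t
    using inS[of t s] that by (simp add: algebra_simps)
  obtain \<xi>' \<eta>' where 2: "0 \<le> \<xi>'" "\<xi>' \<le> h" "0 \<le> \<eta>'" "\<eta>' \<le> h"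
    "f (x + h *\<^sub>R v + h *\<^sub>R u) - f (x + h *\<^sub>R v) - f (x + h *\<^sub>R u) + f x = h\<^sup>2 * ?b (x + \<xi>' *\<^sub>R v + \<eta>' *\<^sub>R u)"
    using second_difference_mean_value[OF f h inS'] by blast
  have "h\<^sup>2 * ?a (x + \<xi> *\<^sub>R u + \<eta> *\<^sub>R v) = h\<^sup>2 * ?b (x + \<eta>' *\<^sub>R u + \<xi>' *\<^sub>R v)"
    using 1(5) 2(5) by (simp add: algebra_simps)
  then have "?a (x + \<xi> *\<^sub>R u + \<eta> *\<^sub>R v) = ?b (x + \<eta>' *\<^sub>R u + \<xi>' *\<^sub>R v)" using h by simp
  moreover have "\<bar>?a (x + \<xi> *\<^sub>R u + \<eta> *\<^sub>R v) - ?a x\<bar> < e" using near[of \<xi> \<eta>] 1 d(2) by (simp add: dist_real_def)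
  moreover have "\<bar>?b (x + \<eta>' *\<^sub>R u + \<xi>' *\<^sub>R v) - ?b x\<bar> < e" using near[of \<eta>' \<xi>'] 2 d(4) by (simp add: dist_real_def)
  ultimately have "\<bar>?a x - ?b x\<bar> < 2 * e" by linarith
  then show False by (simp add: e_def)
qed

lemma second_derivative_symmetric:
  fixes f :: "'a::euclidean_space \<Rightarrow> 'b::euclidean_space"
  assumes S: "open S" "x \<in> S" and f: "smooth_on S f"
  shows "frechet_derivative (\<lambda>y. frechet_derivative f (at y) u) (at x) v =
    frechet_derivative (\<lambda>y. frechet_derivative f (at y) v) (at x) u"
proof (rule euclidean_eqI)
  fix b :: 'b assume "b \<in> Basis"
  have inner: "frechet_derivative (\<lambda>y. h y \<bullet> b) (at y) w = frechet_derivative h (at y) w \<bullet> b"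
    if "smooth_on S h" "y \<in> S" for h :: "'a \<Rightarrow> 'b" and y w
    using frechet_derivative_at[OF has_derivative_inner_left[OF smooth_on_has_derivative[OF that]], of b]
    by metis
  have D: "frechet_derivative (\<lambda>y. frechet_derivative (\<lambda>y. f y \<bullet> b) (at y) w) (at x) z =
      frechet_derivative (\<lambda>y. frechet_derivative f (at y) w) (at x) z \<bullet> b" for w z
  proof -
    have "frechet_derivative (\<lambda>y. frechet_derivative (\<lambda>y. f y \<bullet> b) (at y) w) (at x) =
        frechet_derivative (\<lambda>y. frechet_derivative f (at y) w \<bullet> b) (at x)"
      by (rule frechet_derivative_cong_open[OF S]) (simp add: inner[OF f])
    then show ?thesis using inner[OF smooth_on_frechet_derivative[OF f] S(2)] by simp
  qed
  have "smooth_on S (\<lambda>y. f y \<bullet> b)"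
    by (rule smooth_on_bounded_linear[OF bounded_linear_inner_left S(1) f])
  then have "ck_on 2 S (\<lambda>y. f y \<bullet> b)" by (simp add: smooth_on_def)
  from second_derivative_symmetric_real[OF S this, of u v]
  show "frechet_derivative (\<lambda>y. frechet_derivative f (at y) u) (at x) v \<bullet> b =
    frechet_derivative (\<lambda>y. frechet_derivative f (at y) v) (at x) u \<bullet> b"
    by (simp add: D)
qed

section \<open>Charts and tangent vectors\<close>

locale surface_atlas =
  fixes A :: "'m::t2_space chart set"
  assumes atlas: "oriented_surface A"
begin

lemma chart_inv_left [simp]: "c \<in> A \<Longrightarrow> x \<in> fst c \<Longrightarrow> chart_inv c (snd c x) = x"
  using atlas unfolding oriented_surface_def homeomorphism_def by blast

lemma chart_inv_right [simp]: "c \<in> A \<Longrightarrow> y \<in> snd c ` fst c \<Longrightarrow> snd c (chart_inv c y) = y"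
  by auto

lemma chart_inv_in: "c \<in> A \<Longrightarrow> y \<in> snd c ` fst c \<Longrightarrow> chart_inv c y \<in> fst c"
  by auto

lemma open_chart_domain: "c \<in> A \<Longrightarrow> open (fst c)"
  and open_chart_range: "c \<in> A \<Longrightarrow> open (snd c ` fst c)"
  and continuous_chart: "c \<in> A \<Longrightarrow> continuous_on (fst c) (snd c)"
  and continuous_chart_inv: "c \<in> A \<Longrightarrow> continuous_on (snd c ` fst c) (chart_inv c)"
  using atlas unfolding oriented_surface_def homeomorphism_def by blast+

lemma inj_on_chart: "c \<in> A \<Longrightarrow> inj_on (snd c) (fst c)"
  by (metis chart_inv_left inj_onI)

lemma ex_chart: "\<exists>c\<in>A. x \<in> fst c"
  using atlas unfolding oriented_surface_def by blast

lemma chart_at: "chart_at A x \<in> A" "x \<in> fst (chart_at A x)"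
  unfolding chart_at_def using someI_ex[of "\<lambda>c. c \<in> A \<and> x \<in> fst c"] ex_chart by blast+

lemma chart_image_eq_vimage:
  "c \<in> A \<Longrightarrow> snd c ` (U \<inter> fst c) = chart_inv c -` U \<inter> snd c ` fst c"
  by force

lemma open_chart_image: "c \<in> A \<Longrightarrow> open U \<Longrightarrow> open (snd c ` (U \<inter> fst c))"
  unfolding chart_image_eq_vimage
  using continuous_open_preimage[OF continuous_chart_inv open_chart_range]
  by (metis inf_commute)

lemma open_chart_preimage: "c \<in> A \<Longrightarrow> open V \<Longrightarrow> open (snd c -` V \<inter> fst c)"
  using continuous_open_preimage[OF continuous_chart open_chart_domain] by (metis inf_commute)

lemma smooth_transition:
  "c \<in> A \<Longrightarrow> d \<in> A \<Longrightarrow> smooth_on (snd c ` (fst c \<inter> fst d)) (snd d \<circ> chart_inv c)"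
  using atlas unfolding oriented_surface_def by blast

lemma transition_has_derivative:
  assumes "c \<in> A" "d \<in> A" "x \<in> fst c" "x \<in> fst d"
  shows "((snd d \<circ> chart_inv c) has_derivative
      frechet_derivative (snd d \<circ> chart_inv c) (at (snd c x))) (at (snd c x))"
  using smooth_on_has_derivative[OF smooth_transition] assms by blast

lemma det_transition_pos:
  assumes "c \<in> A" "d \<in> A" "x \<in> fst c" "x \<in> fst d"
  shows "0 < det (matrix (frechet_derivative (snd d \<circ> chart_inv c) (at (snd c x))))"
  using atlas assms unfolding oriented_surface_def by blast

lemma chart_overlap:
  assumes "c \<in> A" "d \<in> A" "x \<in> fst c" "x \<in> fst d"
  shows "open (snd c ` (fst d \<inter> fst c))" "snd c x \<in> snd c ` (fst d \<inter> fst c)"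
    "\<And>y. y \<in> snd c ` (fst d \<inter> fst c) \<Longrightarrow> chart_inv d (snd d (chart_inv c y)) = chart_inv c y"
  using assms open_chart_image open_chart_domain by auto

section \<open>Independence of the chart\<close>

lemma has_derivative_change_chart:
  assumes "c \<in> A" "d \<in> A" "x \<in> fst c" "x \<in> fst d"
    and "(h \<circ> chart_inv d has_derivative h') (at (snd d x))"
  shows "(h \<circ> chart_inv c has_derivative
     (\<lambda>w. h' (frechet_derivative (snd d \<circ> chart_inv c) (at (snd c x)) w))) (at (snd c x))"
proof -
  have "((h \<circ> chart_inv d) \<circ> (snd d \<circ> chart_inv c) has_derivative
     h' \<circ> (frechet_derivative (snd d \<circ> chart_inv c) (at (snd c x)))) (at (snd c x))"
    using assms by (intro diff_chain_at transition_has_derivative) auto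
  then have "((h \<circ> chart_inv d) \<circ> (snd d \<circ> chart_inv c) has_derivative
     (\<lambda>w. h' (frechet_derivative (snd d \<circ> chart_inv c) (at (snd c x)) w))) (at (snd c x))"
    by (simp add: o_def)
  then show ?thesis
    by (rule has_derivative_transform_within_open[OF _ chart_overlap(1,2)[OF assms(1-4)]])
      (use chart_overlap(3)[OF assms(1-4)] in auto)
qed

lemma frechet_derivative_change_chart:
  assumes "c \<in> A" "d \<in> A" "x \<in> fst c" "x \<in> fst d"
    and "h \<circ> chart_inv d differentiable (at (snd d x))"
  shows "frechet_derivative (h \<circ> chart_inv c) (at (snd c x)) w =
    frechet_derivative (h \<circ> chart_inv d) (at (snd d x))
      (frechet_derivative (snd d \<circ> chart_inv c) (at (snd c x)) w)"
  using frechet_derivative_at[OF has_derivative_change_chart[OF assms(1-4)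
        assms(5)[unfolded frechet_derivative_works]]] by metis

lemma tvec_change_chart:
  assumes "c \<in> A" "d \<in> A" "x \<in> fst c" "x \<in> fst d"
  shows "tvec A c x w = tvec A d x (frechet_derivative (snd d \<circ> chart_inv c) (at (snd c x)) w)"
  unfolding tvec_def
  using assms chart_at transition_has_derivative[of d "chart_at A x" x]
  by (intro frechet_derivative_change_chart) (auto simp: differentiable_def)

lemma transition_self:
  assumes "c \<in> A" "x \<in> fst c"
  shows "frechet_derivative (snd c \<circ> chart_inv c) (at (snd c x)) = (\<lambda>w. w)"
proof -
  have "frechet_derivative (snd c \<circ> chart_inv c) (at (snd c x)) = frechet_derivative (\<lambda>y. y) (at (snd c x))"
    by (rule frechet_derivative_cong_open[OF open_chart_range[OF assms(1)]]) (use assms in auto)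
  then show ?thesis by simp
qed

lemma tvec_chart_at [simp]: "tvec A (chart_at A x) x w = w"
  unfolding tvec_def using transition_self[OF chart_at] by simp

lemma linear_tvec: "c \<in> A \<Longrightarrow> x \<in> fst c \<Longrightarrow> linear (tvec A c x)"
  unfolding tvec_def
  using transition_has_derivative[OF _ chart_at(1) _ chart_at(2)] has_derivative_linear by blast

lemma differential_tvec:
  assumes "c \<in> A" "x \<in> fst c" "h \<circ> chart_inv (chart_at A x) differentiable (at (snd (chart_at A x) x))"
  shows "differential A h x (tvec A c x w) = frechet_derivative (h \<circ> chart_inv c) (at (snd c x)) w"
  unfolding differential_def tvec_def
  using frechet_derivative_change_chart[OF assms(1) chart_at(1) assms(2) chart_at(2) assms(3)] by metis

lemma smooth_map_differentiable:
  assumes "smooth_map A U h" "c \<in> A" "x \<in> fst c" "x \<in> U"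
  shows "h \<circ> chart_inv c differentiable (at (snd c x))"
  using assms smooth_on_differentiable unfolding smooth_map_def by blast

text \<open>In a chart the differential is the ordinary derivative, which reduces smoothness and
  closedness of differentials to open subsets of the plane.\<close>

lemma local_form_differential:
  assumes "smooth_map A UNIV h" "c \<in> A" "y \<in> snd c ` fst c"
  shows "local_form A c (differential A h) w y = frechet_derivative (h \<circ> chart_inv c) (at y) w"
  unfolding local_form_def
  using differential_tvec[of c "chart_inv c y" h w] smooth_map_differentiable[OF assms(1) chart_at]
    chart_inv_in assms by simp

lemma linear_differential:
  assumes "smooth_map A UNIV h"
  shows "linear (differential A h x)"
proof -
  have "differential A h x = frechet_derivative (h \<circ> chart_inv (chart_at A x)) (at (snd (chart_at A x) x))"
    by (auto simp: differential_def)
  then show ?thesis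
    using smooth_map_differentiable[OF assms chart_at] has_derivative_linear frechet_derivative_works
    by (metis UNIV_I)
qed

lemma smooth_form_differential:
  assumes "smooth_map A UNIV h"
  shows "smooth_form A UNIV (differential A h)"
  unfolding smooth_form_def
proof (intro conjI ballI allI)
  fix x show "linear (differential A h x)" by (rule linear_differential[OF assms])
next
  fix c w assume c: "c \<in> A"
  have "smooth_on (snd c ` fst c) (\<lambda>y. frechet_derivative (h \<circ> chart_inv c) (at y) w)"
    using assms c by (intro smooth_on_frechet_derivative) (simp add: smooth_map_def)
  then show "smooth_on (snd c ` (UNIV \<inter> fst c)) (local_form A c (differential A h) w)"
    using smooth_on_cong[OF open_chart_range[OF c], of "local_form A c (differential A h) w"]
      local_form_differential[OF assms c] by auto
qed

lemma ext_deriv_differential: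
  fixes h :: "'m \<Rightarrow> 'b::euclidean_space"
  assumes "smooth_map A UNIV h"
  shows "ext_deriv A (differential A h) x X Y = 0"
proof -
  let ?c = "chart_at A x"
  have D: "frechet_derivative (local_form A ?c (differential A h) w) (at (snd ?c x)) =
      frechet_derivative (\<lambda>y. frechet_derivative (h \<circ> chart_inv ?c) (at y) w) (at (snd ?c x))" for w
    by (rule frechet_derivative_cong_open[OF open_chart_range[OF chart_at(1)]])
      (use chart_at(2) local_form_differential[OF assms chart_at(1)] in auto)
  have "smooth_on (snd ?c ` fst ?c) (h \<circ> chart_inv ?c)"
    using assms chart_at(1) by (auto simp: smooth_map_def)
  from second_derivative_symmetric[OF open_chart_range[OF chart_at(1)] _ this, of "snd ?c x"]
  show ?thesis unfolding ext_deriv_def Let_def D using chart_at(2) by auto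
qed

end

section \<open>Integration of 2-forms\<close>

text \<open>The reference form on each tangent space: below, being alternating is expressed as being
  a multiple of \<open>area2\<close>.\<close>

abbreviation area2 :: "real^2 \<Rightarrow> real^2 \<Rightarrow> real" where
  "area2 X Y \<equiv> X$1 * Y$2 - X$2 * Y$1"

lemma vec2_eq_axis_sum: "(X::real^2) = X$1 *\<^sub>R axis 1 1 + X$2 *\<^sub>R axis 2 1"
  by (simp add: vec_eq_iff forall_2 axis_def)

lemma area2_linear:
  fixes T :: "real^2 \<Rightarrow> real^2"
  assumes "linear T"
  shows "area2 (T X) (T Y) = det (matrix T) * area2 X Y"
proof -
  have "T Z = Z$1 *\<^sub>R T (axis 1 1) + Z$2 *\<^sub>R T (axis 2 1)" for Z
    using vec2_eq_axis_sum[of Z] linear_add[OF assms] linear_scale[OF assms] by metis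
  then have *: "T Z $ i = Z$1 * T (axis 1 1) $ i + Z$2 * T (axis 2 1) $ i" for Z i
    by (metis vector_add_component vector_scaleR_component real_scaleR_def)
  show ?thesis
    unfolding *[of X] *[of Y] by (simp add: det_2 matrix_def algebra_simps)
qed

context surface_atlas
begin

text \<open>The image under a chart is the preimage under its continuous inverse, so measurability
  passes to the image.\<close>

lemma borel_chart_image:
  assumes "c \<in> A" "P \<in> sets borel" "P \<subseteq> fst c"
  shows "snd c ` P \<in> sets borel"
proof -
  have "chart_inv c \<in> measurable (restrict_space borel (snd c ` fst c)) borel"
    by (rule borel_measurable_continuous_on_restrict[OF continuous_chart_inv[OF assms(1)]])
  from measurable_sets[OF this assms(2)]
  have "chart_inv c -` P \<inter> snd c ` fst c \<in> sets (restrict_space borel (snd c ` fst c))"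
    by (simp add: space_restrict_space)
  then have "chart_inv c -` P \<inter> snd c ` fst c \<in> sets borel"
    using open_chart_range[OF assms(1)] by (simp add: sets_restrict_space_iff)
  moreover have "snd c ` P = chart_inv c -` P \<inter> snd c ` fst c"
    using chart_image_eq_vimage[OF assms(1), of P] assms(3) by (simp add: Int_absorb2)
  ultimately show ?thesis by simp
qed

section \<open>Change of variables for 2-forms\<close>

lemma local_density_change_chart:
  assumes "c \<in> A" "d \<in> A" "x \<in> fst c" "x \<in> fst d"
    and alt: "\<And>X Y. \<sigma> x X Y = k * area2 X Y"
  shows "local_density A c \<sigma> (snd c x) =
    det (matrix (frechet_derivative (snd d \<circ> chart_inv c) (at (snd c x)))) * local_density A d \<sigma> (snd d x)"
proof -
  let ?D = "frechet_derivative (snd d \<circ> chart_inv c) (at (snd c x))"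
  have D: "linear ?D"
    using transition_has_derivative[OF assms(1-4)] has_derivative_linear by blast
  have "area2 (tvec A c x X) (tvec A c x Y) = det (matrix ?D) * area2 (tvec A d x X) (tvec A d x Y)" for X Y
    unfolding tvec_change_chart[OF assms(1-4)]
    using area2_linear[OF linear_tvec[OF assms(2,4)]] area2_linear[OF D] by simp
  then show ?thesis
    unfolding local_density_def chart_inv_left[OF assms(1,3)] chart_inv_left[OF assms(2,4)] alt by simp
qed

text \<open>Transition maps preserve orientation, so the determinant equals its absolute value and
  the densities in the two charts match in the change of variables formula.\<close>

lemma surface_change_of_variables:
  assumes c: "c \<in> A" and d: "d \<in> A" and Q: "Q \<in> sets borel" "Q \<subseteq> fst c \<inter> fst d"
    and alt: "\<And>x. \<exists>k. \<forall>X Y. \<sigma> x X Y = k * area2 X Y"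
    and int: "local_density A d \<sigma> absolutely_integrable_on snd d ` Q"
  shows "local_density A c \<sigma> absolutely_integrable_on snd c ` Q"
    and "integral (snd c ` Q) (local_density A c \<sigma>) = integral (snd d ` Q) (local_density A d \<sigma>)"
proof -
  let ?g = "snd d \<circ> chart_inv c" and ?S = "snd c ` Q"
  let ?h = "\<lambda>y. \<bar>det (matrix (frechet_derivative ?g (at y)))\<bar> * local_density A d \<sigma> (?g y)"
  have gS: "?g ` ?S = snd d ` Q"
    using Q c by (force simp: image_image)
  have eq: "?h y = local_density A c \<sigma> y" if "y \<in> ?S" for y
  proof -
    obtain x where x: "x \<in> Q" "y = snd c x" using \<open>y \<in> ?S\<close> by blast
    then have xx: "x \<in> fst c" "x \<in> fst d" using Q by auto
    obtain k where "\<And>X Y. \<sigma> x X Y = k * area2 X Y" using alt by blast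
    from local_density_change_chart[where \<sigma>=\<sigma> and k=k, OF c d xx this] det_transition_pos[OF c d xx]
    show ?thesis using x c xx by simp
  qed
  have der: "(?g has_derivative frechet_derivative ?g (at y)) (at y within ?S)" if "y \<in> ?S" for y
    using transition_has_derivative[OF c d] that Q has_derivative_at_withinI by blast
  have inj: "inj_on ?g ?S"
  proof (rule inj_onI)
    fix y z assume "y \<in> ?S" "z \<in> ?S" and e: "?g y = ?g z"
    then obtain p q where p: "p \<in> Q" "y = snd c p" and q: "q \<in> Q" "z = snd c q" by blast
    then have "p \<in> fst c" "q \<in> fst c" "p \<in> fst d" "q \<in> fst d" using Q by auto
    with e p q c have "snd d p = snd d q" by simp
    then show "y = z"
      using inj_onD[OF inj_on_chart[OF d]] \<open>p \<in> fst d\<close> \<open>q \<in> fst d\<close> p q by blast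
  qed
  have S: "?S \<in> sets lebesgue" using borel_chart_image[OF c Q(1)] Q(2) by simp
  \<comment> \<open>The change of variables theorem speaks of functions into \<open>real^_\<close>,
    so the density passes through \<open>real^1\<close>; as \<open>b\<close> is arbitrary, one
    equivalence yields both integrability and the value.\<close>
  have "(\<lambda>y. \<bar>det (matrix (frechet_derivative ?g (at y)))\<bar> *\<^sub>R (vec (local_density A d \<sigma> (?g y)) :: real^1))
      absolutely_integrable_on ?S \<and>
      integral ?S (\<lambda>y. \<bar>det (matrix (frechet_derivative ?g (at y)))\<bar> *\<^sub>R (vec (local_density A d \<sigma> (?g y)) :: real^1)) = vec b
      \<longleftrightarrow> (\<lambda>y. vec (local_density A d \<sigma> y) :: real^1) absolutely_integrable_on (?g ` ?S) \<and>
      integral (?g ` ?S) (\<lambda>y. vec (local_density A d \<sigma> y) :: real^1) = vec b" for b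
    by (rule has_absolute_integral_change_of_variables[OF S der inj])
  then have "?h absolutely_integrable_on ?S \<and> integral ?S ?h = b \<longleftrightarrow>
      local_density A d \<sigma> absolutely_integrable_on (?g ` ?S) \<and> integral (?g ` ?S) (local_density A d \<sigma>) = b" for b
    by (simp add: absolutely_integrable_on_1_iff integral_on_1_eq)
  then have *: "?h absolutely_integrable_on ?S" "integral ?S ?h = integral (snd d ` Q) (local_density A d \<sigma>)"
    using int unfolding gS by blast+
  have "?h absolutely_integrable_on ?S \<longleftrightarrow> local_density A c \<sigma> absolutely_integrable_on ?S"
    by (rule set_integrable_cong[OF refl refl]) (rule eq)
  then show "local_density A c \<sigma> absolutely_integrable_on ?S" using *(1) by simp
  have "integral ?S ?h = integral ?S (local_density A c \<sigma>)"
    by (rule integral_cong) (rule eq)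
  then show "integral ?S (local_density A c \<sigma>) = integral (snd d ` Q) (local_density A d \<sigma>)"
    using *(2) by simp
qed

section \<open>Finite covers and Borel partitions\<close>

lemma borel_partition_disjointed:
  assumes "\<And>i. i < n \<Longrightarrow> c i \<in> A \<and> open (U i) \<and> U i \<subseteq> fst (c i)" "(\<Union>i<n. U i) = UNIV"
  shows "borel_partition A n c (disjointed U)"
  unfolding borel_partition_def
proof (intro conjI allI impI)
  show "(\<Union>i<n. disjointed U i) = UNIV"
    using finite_UN_disjointed_eq[of U n] assms(2) by (simp add: lessThan_atLeast0)
  show "disjoint_family_on (disjointed U) {..<n}"
    using disjoint_family_disjointed by (metis disjoint_family_on_mono subset_UNIV)
  fix i assume i: "i < n"
  show "c i \<in> A" using assms(1) i by blast
  show "disjointed U i \<subseteq> fst (c i)" using assms(1)[OF i] disjointed_subset[of U i] by blast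
  have "(\<Union>j\<in>{0..<i}. U j) \<in> sets borel"
    using assms(1) i by (intro sets.finite_UN borel_open) auto
  then show "disjointed U i \<in> sets borel"
    unfolding disjointed_def using assms(1)[OF i] by auto
qed

text \<open>A density that is continuous on an open chart range need not be integrable there.
  Compact boxes inside the ranges make it integrable on the pieces.\<close>

lemma finite_cover_by_boxes:
  assumes "compact (UNIV :: 'm set)"
  obtains n c U a b where "\<And>i::nat. i < n \<Longrightarrow> c i \<in> A \<and> open (U i) \<and> U i \<subseteq> fst (c i)"
    "(\<Union>i<n. U i) = UNIV"
    "\<And>i. i < n \<Longrightarrow> snd (c i) ` U i \<subseteq> cbox (a i) (b i)" "\<And>i. i < n \<Longrightarrow> cbox (a i) (b i) \<subseteq> snd (c i) ` fst (c i)"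
proof -
  have "\<exists>c a b. c \<in> A \<and> x \<in> fst c \<and> snd c x \<in> box a b \<and> cbox a b \<subseteq> snd c ` fst c" for x
  proof -
    obtain c where c: "c \<in> A" "x \<in> fst c" using ex_chart by blast
    then show ?thesis using open_contains_cbox open_chart_range[OF c(1)] by (metis imageI)
  qed
  then obtain c a b where c: "\<And>x. c x \<in> A" "\<And>x. x \<in> fst (c x)"
      "\<And>x. snd (c x) x \<in> box (a x) (b x)" "\<And>x. cbox (a x) (b x) \<subseteq> snd (c x) ` fst (c x)"
    by metis
  define V where "V x = snd (c x) -` box (a x) (b x) \<inter> fst (c x)" for x
  have V: "open (V x)" "x \<in> V x" for x
    unfolding V_def using c open_chart_preimage[OF c(1)[of x], of "box (a x) (b x)"] by auto
  have "UNIV \<subseteq> (\<Union>x\<in>UNIV. V x)" using V(2) by blast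
  then obtain F where "finite F" "UNIV \<subseteq> (\<Union>x\<in>F. V x)"
    by (rule compactE_image[OF assms V(1)])
  then have F: "finite F" "(\<Union>x\<in>F. V x) = UNIV" by auto
  obtain h :: "nat \<Rightarrow> 'm" and n where h: "F = h ` {i. i < n}"
    using finite_imp_nat_seg_image_inj_on[OF F(1)] by metis
  show ?thesis
  proof (rule that[of n "\<lambda>i. c (h i)" "\<lambda>i. V (h i)" "\<lambda>i. a (h i)" "\<lambda>i. b (h i)"])
    show "(\<Union>i<n. V (h i)) = UNIV" using F(2) unfolding h by auto
    show "snd (c (h i)) ` V (h i) \<subseteq> cbox (a (h i)) (b (h i))" for i
      unfolding V_def using box_subset_cbox by blast
    show "c (h i) \<in> A \<and> open (V (h i)) \<and> V (h i) \<subseteq> fst (c (h i))" for i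
      using c V by (auto simp: V_def)
  qed (use c in auto)
qed

section \<open>Existence of the surface integral\<close>

lemma absolutely_integrable_chart_UN:
  assumes "c \<in> A" "finite I" "\<And>i. i \<in> I \<Longrightarrow> P i \<subseteq> fst c" "disjoint_family_on P I"
    and int: "\<And>i. i \<in> I \<Longrightarrow> f absolutely_integrable_on snd c ` P i"
  shows "f absolutely_integrable_on snd c ` (\<Union>i\<in>I. P i)"
    "integral (snd c ` (\<Union>i\<in>I. P i)) f = (\<Sum>i\<in>I. integral (snd c ` P i) (f :: _ \<Rightarrow> real))"
proof -
  show "f absolutely_integrable_on snd c ` (\<Union>i\<in>I. P i)"
    using assms(2) int
  proof (induction I)
    case (insert i I)
    then show ?case using absolutely_integrable_Un[of "snd c ` P i" f] by (simp add: image_Un)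
  qed auto
  have "(f has_integral (\<Sum>i\<in>I. integral (snd c ` P i) f)) (\<Union>i\<in>I. snd c ` P i)"
  proof (rule has_integral_UN[OF assms(2)])
    show "(f has_integral integral (snd c ` P i) f) (snd c ` P i)" if "i \<in> I" for i
      using int[OF that] set_lebesgue_integral_eq_integral(1) integrable_integral by blast
    have "snd c ` P i \<inter> snd c ` P j = {}" if "i \<in> I" "j \<in> I" "i \<noteq> j" for i j
      using assms(3,4) that inj_onD[OF inj_on_chart[OF assms(1)]] unfolding disjoint_family_on_def by blast
    then show "pairwise (\<lambda>i j. negligible (snd c ` P i \<inter> snd c ` P j)) I"
      by (simp add: pairwise_def)
  qed
  then show "integral (snd c ` (\<Union>i\<in>I. P i)) f = (\<Sum>i\<in>I. integral (snd c ` P i) f)"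
    by (simp add: image_UN integral_unique)
qed

text \<open>A fixed partition with images in compact boxes defines the candidate value. Any other
  partition is compared with it on the common refinement, to which integrability is carried by
  change of variables.\<close>

lemma ex_surface_integral:
  assumes cpt: "compact (UNIV :: 'm set)"
    and alt: "\<And>x. \<exists>k. \<forall>X Y. \<sigma> x X Y = k * area2 X Y"
    and cont: "\<And>c. c \<in> A \<Longrightarrow> continuous_on (snd c ` fst c) (local_density A c \<sigma>)"
  shows "\<exists>I. has_surface_integral A \<sigma> I"
proof -
  obtain N :: nat and d U a b where U: "\<And>i. i < N \<Longrightarrow> d i \<in> A \<and> open (U i) \<and> U i \<subseteq> fst (d i)"
      "(\<Union>i<N. U i) = UNIV"
      "\<And>i. i < N \<Longrightarrow> snd (d i) ` U i \<subseteq> cbox (a i) (b i)" "\<And>i. i < N \<Longrightarrow> cbox (a i) (b i) \<subseteq> snd (d i) ` fst (d i)"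
    using finite_cover_by_boxes[OF cpt] by blast
  define Q where "Q = disjointed U"
  have part: "borel_partition A N d Q"
    unfolding Q_def using borel_partition_disjointed U by blast
  have Q: "(\<Union>j<N. Q j) = UNIV" "disjoint_family_on Q {..<N}"
    "\<And>j. j < N \<Longrightarrow> d j \<in> A" "\<And>j. j < N \<Longrightarrow> Q j \<in> sets borel" "\<And>j. j < N \<Longrightarrow> Q j \<subseteq> fst (d j)"
    using part unfolding borel_partition_def by auto
  have int: "local_density A (d j) \<sigma> absolutely_integrable_on snd (d j) ` B"
    if "j < N" "B \<in> sets borel" "B \<subseteq> Q j" for j B
  proof (rule set_integrable_subset)
    show "local_density A (d j) \<sigma> absolutely_integrable_on cbox (a j) (b j)"
      using continuous_on_subset[OF cont U(4)] U(1) that(1) by (intro absolutely_integrable_continuous) auto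
    show "snd (d j) ` B \<in> sets lebesgue"
      using borel_chart_image[of "d j" B] U(1)[OF that(1)] Q(5)[OF that(1)] that by auto
    show "snd (d j) ` B \<subseteq> cbox (a j) (b j)"
      using U(3)[OF that(1)] that(3) disjointed_subset[of U j] unfolding Q_def by blast
  qed
  define I where "I = (\<Sum>j<N. integral (snd (d j) ` Q j) (local_density A (d j) \<sigma>))"
  have "has_surface_integral A \<sigma> I"
    unfolding has_surface_integral_def
  proof (intro allI impI)
    fix n c P assume "borel_partition A n c P"
    then have P: "(\<Union>i<n. P i) = UNIV" "disjoint_family_on P {..<n}"
      "\<And>i. i < n \<Longrightarrow> c i \<in> A" "\<And>i. i < n \<Longrightarrow> P i \<in> sets borel" "\<And>i. i < n \<Longrightarrow> P i \<subseteq> fst (c i)"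
      unfolding borel_partition_def by auto
    have PQ: "local_density A (d j) \<sigma> absolutely_integrable_on snd (d j) ` (P i \<inter> Q j)"
      "local_density A (c i) \<sigma> absolutely_integrable_on snd (c i) ` (P i \<inter> Q j)"
      "integral (snd (c i) ` (P i \<inter> Q j)) (local_density A (c i) \<sigma>) =
        integral (snd (d j) ` (P i \<inter> Q j)) (local_density A (d j) \<sigma>)" if "i < n" "j < N" for i j
    proof -
      have B: "P i \<inter> Q j \<in> sets borel" "P i \<inter> Q j \<subseteq> fst (c i) \<inter> fst (d j)"
        using P(4,5)[OF that(1)] Q(4,5)[OF that(2)] by auto
      show 1: "local_density A (d j) \<sigma> absolutely_integrable_on snd (d j) ` (P i \<inter> Q j)"
        by (rule int[OF that(2) B(1)]) auto
      note 2 = surface_change_of_variables[OF P(3)[OF that(1)] Q(3)[OF that(2)] B alt 1]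
      show "local_density A (c i) \<sigma> absolutely_integrable_on snd (c i) ` (P i \<inter> Q j)"
        "integral (snd (c i) ` (P i \<inter> Q j)) (local_density A (c i) \<sigma>) =
        integral (snd (d j) ` (P i \<inter> Q j)) (local_density A (d j) \<sigma>)" using 2 by auto
    qed
    have Pi: "local_density A (c i) \<sigma> absolutely_integrable_on snd (c i) ` P i"
      "integral (snd (c i) ` P i) (local_density A (c i) \<sigma>) =
        (\<Sum>j<N. integral (snd (d j) ` (P i \<inter> Q j)) (local_density A (d j) \<sigma>))" if "i < n" for i
    proof -
      have "P i = (\<Union>j\<in>{..<N}. P i \<inter> Q j)" using Q(1) by auto
      moreover have "disjoint_family_on (\<lambda>j. P i \<inter> Q j) {..<N}"
        using Q(2) unfolding disjoint_family_on_def by blast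
      ultimately show "local_density A (c i) \<sigma> absolutely_integrable_on snd (c i) ` P i"
      "integral (snd (c i) ` P i) (local_density A (c i) \<sigma>) =
        (\<Sum>j<N. integral (snd (d j) ` (P i \<inter> Q j)) (local_density A (d j) \<sigma>))"
        using absolutely_integrable_chart_UN[of "c i" "{..<N}" "\<lambda>j. P i \<inter> Q j" "local_density A (c i) \<sigma>"]
          P(3,5) PQ that by (auto simp: le_infI1)
    qed
    have Qj: "integral (snd (d j) ` Q j) (local_density A (d j) \<sigma>) =
        (\<Sum>i<n. integral (snd (d j) ` (P i \<inter> Q j)) (local_density A (d j) \<sigma>))" if "j < N" for j
    proof -
      have "Q j = (\<Union>i\<in>{..<n}. P i \<inter> Q j)" using P(1) by auto
      moreover have "disjoint_family_on (\<lambda>i. P i \<inter> Q j) {..<n}"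
        using P(2) unfolding disjoint_family_on_def by blast
      ultimately show ?thesis
        using absolutely_integrable_chart_UN(2)[of "d j" "{..<n}" "\<lambda>i. P i \<inter> Q j" "local_density A (d j) \<sigma>"]
          Q(3,5) PQ that by (auto simp: le_infI2)
    qed
    show "(\<forall>i<n. local_density A (c i) \<sigma> absolutely_integrable_on snd (c i) ` P i) \<and>
        (\<Sum>i<n. integral (snd (c i) ` P i) (local_density A (c i) \<sigma>)) = I"
    proof (intro conjI allI impI)
      \<comment> \<open>The double sum over the common refinement, grouped by the pieces of
        \<open>P\<close> and then by those of \<open>Q\<close>.\<close>
      have "(\<Sum>i<n. integral (snd (c i) ` P i) (local_density A (c i) \<sigma>)) =
        (\<Sum>j<N. \<Sum>i<n. integral (snd (d j) ` (P i \<inter> Q j)) (local_density A (d j) \<sigma>))"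
        using Pi(2) by (simp add: sum.swap[of _ "{..<N}"])
      also have "\<dots> = I" unfolding I_def using Qj by simp
      finally show "(\<Sum>i<n. integral (snd (c i) ` P i) (local_density A (c i) \<sigma>)) = I" .
    qed (use Pi(1) in blast)
  qed
  then show ?thesis by blast
qed

text \<open>With a whole chart domain as a single piece, the vanishing of the total integral can be
  read in that chart. \<open>disjointed\<close> removes only earlier sets, so the set with index 0
  stays intact.\<close>

lemma borel_partition_starting_with:
  assumes "compact (UNIV :: 'm set)" "c\<^sub>0 \<in> A"
  obtains n c P where "borel_partition A (Suc n) c P" "c 0 = c\<^sub>0" "P 0 = fst c\<^sub>0"
proof -
  obtain N :: nat and d U a b where U: "\<And>i. i < N \<Longrightarrow> d i \<in> A \<and> open (U i) \<and> U i \<subseteq> fst (d i)"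
      "(\<Union>i<N. U i) = UNIV"
    using finite_cover_by_boxes[OF assms(1)] by metis
  let ?d = "case_nat c\<^sub>0 d" and ?U = "case_nat (fst c\<^sub>0) U"
  have "borel_partition A (Suc N) ?d (disjointed ?U)"
  proof (rule borel_partition_disjointed)
    show "?d i \<in> A \<and> open (?U i) \<and> ?U i \<subseteq> fst (?d i)" if "i < Suc N" for i
      using that U(1) assms(2) open_chart_domain[OF assms(2)] by (cases i) auto
    show "(\<Union>i<Suc N. ?U i) = UNIV"
    proof -
      have "U i \<subseteq> (\<Union>i<Suc N. ?U i)" if "i < N" for i
        using that by (force intro!: bexI[of _ "Suc i"])
      then have "(\<Union>i<N. U i) \<subseteq> (\<Union>i<Suc N. ?U i)" by (intro UN_least) simp
      then show ?thesis unfolding U(2) by (rule top.extremum_uniqueI)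
    qed
  qed
  then show ?thesis
    by (rule that) (auto simp: disjointed_def)
qed

text \<open>Without any partition \<open>has_surface_integral\<close> would hold vacuously for every
  number; compactness provides one.\<close>

lemma has_surface_integral_unique:
  assumes "compact (UNIV :: 'm set)" "has_surface_integral A \<sigma> I" "has_surface_integral A \<sigma> I'"
  shows "I = I'"
proof -
  obtain c where "c \<in> A" using ex_chart by blast
  then obtain n d P where "borel_partition A n d P"
    using borel_partition_starting_with[OF assms(1)] by metis
  then show ?thesis using assms(2,3) unfolding has_surface_integral_def by blast
qed

lemma surface_integral_eqI:
  assumes "compact (UNIV :: 'm set)" "has_surface_integral A \<sigma> I"
  shows "surface_integral A \<sigma> = I"
  unfolding surface_integral_def using has_surface_integral_unique[OF assms(1)] assms(2) by blast

lemma has_surface_integral_linear_combination: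
  assumes "has_surface_integral A \<sigma> I" "has_surface_integral A \<tau> I'"
  shows "has_surface_integral A (\<lambda>x X Y. r * \<sigma> x X Y + s * \<tau> x X Y) (r * I + s * I')"
  unfolding has_surface_integral_def
proof (intro allI impI)
  fix n c P assume p: "borel_partition A n c P"
  have *: "local_density A e (\<lambda>x X Y. r * \<sigma> x X Y + s * \<tau> x X Y) =
      (\<lambda>y. r * local_density A e \<sigma> y + s * local_density A e \<tau> y)" for e
    by (auto simp: local_density_def)
  have int: "local_density A (c i) \<sigma> absolutely_integrable_on snd (c i) ` P i"
      "local_density A (c i) \<tau> absolutely_integrable_on snd (c i) ` P i" if "i < n" for i
    using assms p that unfolding has_surface_integral_def by blast+
  have I: "(\<Sum>i<n. integral (snd (c i) ` P i) (local_density A (c i) \<sigma>)) = I"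
    "(\<Sum>i<n. integral (snd (c i) ` P i) (local_density A (c i) \<tau>)) = I'"
    using assms p unfolding has_surface_integral_def by blast+
  have "integral (snd (c i) ` P i) (\<lambda>y. r * local_density A (c i) \<sigma> y + s * local_density A (c i) \<tau> y) =
      r * integral (snd (c i) ` P i) (local_density A (c i) \<sigma>) +
      s * integral (snd (c i) ` P i) (local_density A (c i) \<tau>)" if "i < n" for i
    using int[OF that, THEN set_lebesgue_integral_eq_integral(1)]
    by (subst integral_add) (auto intro!: integrable_on_mult_right)
  then show "(\<forall>i<n. local_density A (c i) (\<lambda>x X Y. r * \<sigma> x X Y + s * \<tau> x X Y) absolutely_integrable_on snd (c i) ` P i) \<and>
    (\<Sum>i<n. integral (snd (c i) ` P i) (local_density A (c i) (\<lambda>x X Y. r * \<sigma> x X Y + s * \<tau> x X Y))) = r * I + s * I'"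
    unfolding * using int I by (auto simp: sum.distrib sum_distrib_left[symmetric] intro!: set_integral_add)
qed

lemma surface_integral_nonneg:
  assumes "compact (UNIV :: 'm set)" "has_surface_integral A \<sigma> I"
    and "\<And>c y. c \<in> A \<Longrightarrow> y \<in> snd c ` fst c \<Longrightarrow> 0 \<le> local_density A c \<sigma> y"
  shows "0 \<le> I"
proof -
  obtain c\<^sub>0 where "c\<^sub>0 \<in> A" using ex_chart by blast
  then obtain n c P where p: "borel_partition A n c P"
    using borel_partition_starting_with[OF assms(1)] by metis
  then have "I = (\<Sum>i<n. integral (snd (c i) ` P i) (local_density A (c i) \<sigma>))"
    using assms(2) unfolding has_surface_integral_def by blast
  also have "\<dots> \<ge> 0"
  proof (intro sum_nonneg integral_nonneg)
    fix i assume "i \<in> {..<n}"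
    then have i: "c i \<in> A" "P i \<subseteq> fst (c i)"
      and "local_density A (c i) \<sigma> absolutely_integrable_on snd (c i) ` P i"
      using p assms(2) unfolding borel_partition_def has_surface_integral_def by auto
    then show "local_density A (c i) \<sigma> integrable_on snd (c i) ` P i"
      using set_lebesgue_integral_eq_integral(1) by blast
    show "0 \<le> local_density A (c i) \<sigma> y" if "y \<in> snd (c i) ` P i" for y
      using assms(3)[OF i(1)] i(2) that by blast
  qed
  finally show ?thesis .
qed

text \<open>The integrals over the pieces are nonnegative with sum 0, so the one over the domain of
  \<open>c\<^sub>0\<close> vanishes, and with it the one over a box around \<open>y\<close>. A
  continuous nonnegative function with integral 0 over a box is 0 there.\<close>

lemma surface_integral_zero_imp:
  assumes cpt: "compact (UNIV :: 'm set)" and I: "has_surface_integral A \<sigma> 0"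
    and nonneg: "\<And>c y. c \<in> A \<Longrightarrow> y \<in> snd c ` fst c \<Longrightarrow> 0 \<le> local_density A c \<sigma> y"
    and cont: "\<And>c. c \<in> A \<Longrightarrow> continuous_on (snd c ` fst c) (local_density A c \<sigma>)"
    and c\<^sub>0: "c\<^sub>0 \<in> A" "y \<in> snd c\<^sub>0 ` fst c\<^sub>0"
  shows "local_density A c\<^sub>0 \<sigma> y = 0"
proof -
  obtain n c P where p: "borel_partition A (Suc n) c P" "c 0 = c\<^sub>0" "P 0 = fst c\<^sub>0"
    using borel_partition_starting_with[OF cpt c\<^sub>0(1)] .
  let ?J = "\<lambda>i. integral (snd (c i) ` P i) (local_density A (c i) \<sigma>)"
  have int: "local_density A (c i) \<sigma> integrable_on snd (c i) ` P i" if "i < Suc n" for i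
    using p(1) I that set_lebesgue_integral_eq_integral(1) unfolding has_surface_integral_def by blast
  have sum: "(\<Sum>i<Suc n. ?J i) = 0"
    using p(1) I unfolding has_surface_integral_def by blast
  have nn: "0 \<le> ?J i" if "i < Suc n" for i
  proof (rule integral_nonneg[OF int[OF that]])
    have i: "c i \<in> A" "P i \<subseteq> fst (c i)"
      using p(1) that unfolding borel_partition_def by auto
    show "0 \<le> local_density A (c i) \<sigma> y" if "y \<in> snd (c i) ` P i" for y
      using nonneg[OF i(1)] i(2) that by blast
  qed
  have "?J 0 = 0"
    using sum_nonneg_eq_0_iff[of "{..<Suc n}" ?J] sum nn by auto
  then have 0: "integral (snd c\<^sub>0 ` fst c\<^sub>0) (local_density A c\<^sub>0 \<sigma>) = 0" using p by simp
  obtain a b where ab: "y \<in> box a b" "cbox a b \<subseteq> snd c\<^sub>0 ` fst c\<^sub>0"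
    using open_chart_range[OF c\<^sub>0(1)] c\<^sub>0(2) by (metis open_contains_cbox)
  have cab: "continuous_on (cbox a b) (local_density A c\<^sub>0 \<sigma>)"
    using cont[OF c\<^sub>0(1)] ab(2) continuous_on_subset by blast
  have "integral (cbox a b) (local_density A c\<^sub>0 \<sigma>) \<le> integral (snd c\<^sub>0 ` fst c\<^sub>0) (local_density A c\<^sub>0 \<sigma>)"
    using int[of 0] p(2,3) nonneg[OF c\<^sub>0(1)] ab(2)
    by (intro integral_subset_le integrable_continuous[OF cab]) auto
  moreover have "0 \<le> integral (cbox a b) (local_density A c\<^sub>0 \<sigma>)"
    using nonneg[OF c\<^sub>0(1)] ab(2) by (intro integral_nonneg integrable_continuous[OF cab]) auto
  ultimately have "integral (cbox a b) (local_density A c\<^sub>0 \<sigma>) = 0" using 0 by simp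
  then show ?thesis
    using integral_cbox_eq_0_iff[OF cab] nonneg[OF c\<^sub>0(1)] ab box_subset_cbox[of a b] by blast
qed

end

section \<open>Primitives of 1-forms without periods\<close>

lemma has_vector_derivative_along_line:
  assumes "(f has_derivative f') (at (y + t *\<^sub>R h))"
  shows "((\<lambda>t. f (y + t *\<^sub>R h)) has_vector_derivative f' h) (at t)"
proof -
  have "((\<lambda>t. f (y + t *\<^sub>R h)) has_derivative (\<lambda>s. f' (s *\<^sub>R h))) (at t)"
    by (rule has_derivative_compose[where f="\<lambda>t. y + t *\<^sub>R h" and g=f, OF _ assms])
      (auto intro!: derivative_eq_intros)
  then show ?thesis
    unfolding has_vector_derivative_def using linear_scale[OF has_derivative_linear[OF assms]] by simp
qed

primrec curve_chain :: "'m::t2_space chart set \<Rightarrow> 'm \<Rightarrow> (real \<Rightarrow> 'm) list \<Rightarrow> 'm \<Rightarrow> bool" where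
  "curve_chain A x [] y \<longleftrightarrow> x = y"
| "curve_chain A x (\<gamma> # \<gamma>s) y \<longleftrightarrow> smooth_curve A \<gamma> \<and> \<gamma> 0 = x \<and> curve_chain A (\<gamma> 1) \<gamma>s y"

lemma curve_chain_append:
  "curve_chain A x \<gamma>s y \<Longrightarrow> curve_chain A y \<delta>s z \<Longrightarrow> curve_chain A x (\<gamma>s @ \<delta>s) z"
  by (induction \<gamma>s arbitrary: x) auto

text \<open>Matches the recursive description with the indexing used by
  \<open>closed_curve\<close>.\<close>

lemma curve_chain_nth:
  "curve_chain A x \<gamma>s y \<Longrightarrow> \<gamma>s \<noteq> [] \<Longrightarrow>
    (\<forall>\<gamma>\<in>set \<gamma>s. smooth_curve A \<gamma>) \<and> (\<gamma>s ! 0) 0 = x \<and> (\<gamma>s ! (length \<gamma>s - 1)) 1 = y \<and>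
    (\<forall>i. Suc i < length \<gamma>s \<longrightarrow> (\<gamma>s ! i) 1 = (\<gamma>s ! Suc i) 0)"
proof (induction \<gamma>s arbitrary: x)
  case (Cons \<gamma> \<gamma>s)
  show ?case
  proof (cases "\<gamma>s = []")
    case True
    then show ?thesis using Cons.prems by auto
  next
    case False
    have "(\<forall>\<gamma>\<in>set \<gamma>s. smooth_curve A \<gamma>) \<and> (\<gamma>s ! 0) 0 = \<gamma> 1 \<and> (\<gamma>s ! (length \<gamma>s - 1)) 1 = y \<and>
        (\<forall>i. Suc i < length \<gamma>s \<longrightarrow> (\<gamma>s ! i) 1 = (\<gamma>s ! Suc i) 0)"
      using Cons False by auto
    then show ?thesis using Cons.prems False by (auto simp: nth_Cons split: nat.splits)
  qed
qed simp

lemma curve_chain_closed: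
  assumes "curve_chain A x \<gamma>s x" "\<gamma>s \<noteq> []"
  shows "closed_curve A \<gamma>s"
  unfolding closed_curve_def
proof (intro conjI allI impI)
  note * = curve_chain_nth[OF assms]
  fix i assume i: "i < length \<gamma>s"
  show "(\<gamma>s ! i) 1 = (\<gamma>s ! (Suc i mod length \<gamma>s)) 0"
  proof (cases "Suc i < length \<gamma>s")
    case False
    \<comment> \<open>For the last curve the index modulo the length wraps around to 0.\<close>
    then have "i = length \<gamma>s - 1" "Suc i = length \<gamma>s" using i by auto
    then show ?thesis using * by simp
  qed (use * in simp)
qed (use curve_chain_nth[OF assms] assms in auto)

lemma curve_integral_append: "curve_integral A \<alpha> (\<gamma>s @ \<delta>s) = curve_integral A \<alpha> \<gamma>s + curve_integral A \<alpha> \<delta>s"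
  by (simp add: curve_integral_def)

context surface_atlas
begin

section \<open>Reversed curves and segments in charts\<close>

lemma smooth_curve_reverse:
  assumes "smooth_curve A \<gamma>"
  shows "smooth_curve A (\<lambda>t. \<gamma> (1 - t))"
proof -
  obtain T where T: "open T" "{0..1} \<subseteq> T" "continuous_on T \<gamma>"
      "\<And>c. c \<in> A \<Longrightarrow> smooth_on (T \<inter> \<gamma> -` fst c) (snd c \<circ> \<gamma>)"
    using assms unfolding smooth_curve_def by blast
  let ?r = "\<lambda>t::real. 1 - t"
  have op: "open (?r -` S)" if "open S" for S
    using that by (intro open_vimage continuous_intros) auto
  show ?thesis
    unfolding smooth_curve_def
  proof (intro exI[of _ "?r -` T"] conjI ballI)
    show "open (?r -` T)" using op T(1) .
    show "{0..1} \<subseteq> ?r -` T" using T(2) by (auto intro!: subsetD[OF T(2)])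
    show "continuous_on (?r -` T) (\<lambda>t. \<gamma> (1 - t))"
      by (rule continuous_on_compose2[OF T(3)]) (auto intro!: continuous_intros)
    fix c assume c: "c \<in> A"
    have "open (T \<inter> \<gamma> -` fst c)"
      using continuous_open_preimage[OF T(3,1) open_chart_domain[OF c]] .
    then have "open (?r -` (T \<inter> \<gamma> -` fst c))" by (rule op)
    moreover have eq: "?r -` T \<inter> (\<lambda>t. \<gamma> (1 - t)) -` fst c = ?r -` (T \<inter> \<gamma> -` fst c)" by auto
    \<comment> \<open>Written as \<open>1 + t *\<^sub>R (-1)\<close>, the reversal is an affine
      line.\<close>
    ultimately have "smooth_on (?r -` T \<inter> (\<lambda>t. \<gamma> (1 - t)) -` fst c) (\<lambda>t. (snd c \<circ> \<gamma>) (1 + t *\<^sub>R (-1)))"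
      by (intro smooth_on_compose_line[OF _ _ T(4)[OF c]]) auto
    then show "smooth_on (?r -` T \<inter> (\<lambda>t. \<gamma> (1 - t)) -` fst c) (snd c \<circ> (\<lambda>t. \<gamma> (1 - t)))"
      by (simp add: o_def)
  qed
qed

text \<open>Only the existence of some way back matters: its integral will cancel when the periods
  vanish, so the integrals over a curve and over its reverse are never compared.\<close>

lemma curve_chain_reverse: "curve_chain A x \<gamma>s y \<Longrightarrow> \<exists>\<delta>s. curve_chain A y \<delta>s x"
proof (induction \<gamma>s arbitrary: x)
  case Nil
  then show ?case by (auto intro: exI[of _ "[]"])
next
  case (Cons \<gamma> \<gamma>s)
  then obtain \<delta>s where "curve_chain A y \<delta>s (\<gamma> 1)" by auto
  moreover have "curve_chain A (\<gamma> 1) [\<lambda>t. \<gamma> (1 - t)] x"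
    using Cons.prems smooth_curve_reverse by auto
  ultimately show ?case using curve_chain_append by blast
qed

lemma smooth_curve_segment:
  assumes c: "c \<in> A" and seg: "\<And>t. t \<in> {0..1} \<Longrightarrow> y + t *\<^sub>R h \<in> snd c ` fst c"
  shows "smooth_curve A (\<lambda>t. chart_inv c (y + t *\<^sub>R h))"
proof -
  let ?l = "\<lambda>t::real. y + t *\<^sub>R h"
  have op: "open (?l -` S)" if "open S" for S
    using that by (intro open_vimage continuous_intros) auto
  show ?thesis
    unfolding smooth_curve_def
  proof (intro exI[of _ "?l -` (snd c ` fst c)"] conjI ballI)
    show "open (?l -` (snd c ` fst c))" using op open_chart_range[OF c] .
    show "{0..1} \<subseteq> ?l -` (snd c ` fst c)" using seg by auto
    show "continuous_on (?l -` (snd c ` fst c)) (\<lambda>t. chart_inv c (?l t))"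
      by (rule continuous_on_compose2[OF continuous_chart_inv[OF c]]) (auto intro!: continuous_intros)
    fix d assume d: "d \<in> A"
    have eq: "?l -` (snd c ` fst c) \<inter> (\<lambda>t. chart_inv c (?l t)) -` fst d = ?l -` (snd c ` (fst d \<inter> fst c))"
      unfolding chart_image_eq_vimage[OF c] by auto
    have "smooth_on (snd c ` (fst d \<inter> fst c)) (snd d \<circ> chart_inv c)"
      using smooth_transition[OF c d] by (simp add: Int_commute)
    then have "smooth_on (?l -` (snd c ` (fst d \<inter> fst c))) (\<lambda>t. (snd d \<circ> chart_inv c) (?l t))"
      by (rule smooth_on_compose_line[rotated 2])
        (auto intro!: op open_chart_image c open_chart_domain d)
    then show "smooth_on (?l -` (snd c ` fst c) \<inter> (\<lambda>t. chart_inv c (?l t)) -` fst d)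
        (snd d \<circ> (\<lambda>t. chart_inv c (?l t)))"
      unfolding eq by (simp add: o_def)
  qed
qed

text \<open>The preferred chart in \<open>velocity\<close> is fixed by the point at time
  \<open>t\<close>, so the velocity is the derivative of a single transition map along a
  line.\<close>

lemma velocity_segment:
  assumes c: "c \<in> A" and t: "y + t *\<^sub>R h \<in> snd c ` fst c"
  shows "velocity A (\<lambda>t. chart_inv c (y + t *\<^sub>R h)) t = tvec A c (chart_inv c (y + t *\<^sub>R h)) h"
proof -
  let ?x = "chart_inv c (y + t *\<^sub>R h)"
  have x: "?x \<in> fst c" "snd c ?x = y + t *\<^sub>R h" using c t by auto
  have "((snd (chart_at A ?x) \<circ> chart_inv c) has_derivative tvec A c ?x) (at (y + t *\<^sub>R h))"
    using transition_has_derivative[OF c chart_at(1) x(1) chart_at(2)] unfolding x(2)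
    by (simp add: tvec_def[abs_def] x(2))
  from has_vector_derivative_along_line[OF this] show ?thesis
    unfolding velocity_def by (simp add: o_def vector_derivative_at)
qed

lemma curve_integral_segment:
  assumes c: "c \<in> A" and seg: "\<And>t. t \<in> {0..1} \<Longrightarrow> y + t *\<^sub>R h \<in> snd c ` fst c"
  shows "curve_integral A \<alpha> [\<lambda>t. chart_inv c (y + t *\<^sub>R h)] =
    integral {0..1} (\<lambda>t. local_form A c \<alpha> h (y + t *\<^sub>R h))"
  unfolding curve_integral_def
  using velocity_segment[OF c seg] by (auto simp: local_form_def intro!: integral_cong)

section \<open>Construction of the primitive\<close>

lemma linear_local_form:
  assumes "linear (\<alpha> (chart_inv c y))" "c \<in> A" "y \<in> snd c ` fst c"
  shows "linear (\<lambda>w. local_form A c \<alpha> w y)"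
  unfolding local_form_def
  using linear_compose[OF linear_tvec[OF assms(2) chart_inv_in[OF assms(2,3)]] assms(1)] by (simp add: o_def)

text \<open>The increment of \<open>F\<close> is the mean of the form over the segment, which by
  continuity is close to the value at its initial point.\<close>

lemma primitive_has_derivative:
  fixes \<alpha> :: "'m \<Rightarrow> real^2 \<Rightarrow> 'b::euclidean_space"
  assumes \<alpha>: "smooth_form A UNIV \<alpha>" and c: "c \<in> A" and y: "y \<in> snd c ` fst c"
    and F: "\<And>z h. (\<And>t. t \<in> {0..1} \<Longrightarrow> z + t *\<^sub>R h \<in> snd c ` fst c) \<Longrightarrow>
      F (z + h) = F z + integral {0..1} (\<lambda>t. local_form A c \<alpha> h (z + t *\<^sub>R h))"
  shows "(F has_derivative (\<lambda>h. local_form A c \<alpha> h y)) (at y)"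
  unfolding has_derivative_at_alt
proof (intro conjI allI impI)
  let ?\<beta> = "local_form A c \<alpha>"
  have cont: "continuous_on (snd c ` fst c) (?\<beta> w)" for w
    using \<alpha> c smooth_on_continuous unfolding smooth_form_def by fastforce
  have lin: "linear (\<lambda>w. ?\<beta> w z)" if "z \<in> snd c ` fst c" for z
    using \<alpha> that c by (intro linear_local_form) (auto simp: smooth_form_def)
  show "bounded_linear (\<lambda>h. ?\<beta> h y)" using lin[OF y] by (rule linear_conv_bounded_linear[THEN iffD1])
  \<comment> \<open>Continuity is known for each fixed direction; expanding in the basis makes the
    estimate uniform in the direction \<open>h\<close>.\<close>
  have expand: "?\<beta> h z = h$1 *\<^sub>R ?\<beta> (axis 1 1) z + h$2 *\<^sub>R ?\<beta> (axis 2 1) z" if "z \<in> snd c ` fst c" for z h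
    using vec2_eq_axis_sum[of h] linear_add[OF lin[OF that]] linear_scale[OF lin[OF that]] by metis
  fix e :: real assume e: "e > 0"
  have "isCont (?\<beta> w) y" for w
    using cont[of w] open_chart_range[OF c] y by (auto simp: continuous_on_eq_continuous_at)
  then have "\<exists>d>0. \<forall>z. dist z y < d \<longrightarrow> dist (?\<beta> w z) (?\<beta> w y) < e/2" for w
    using e half_gt_zero unfolding continuous_at_eps_delta by blast
  then obtain d1 d2 where d: "d1 > 0" "\<And>z. dist z y < d1 \<Longrightarrow> dist (?\<beta> (axis 1 1) z) (?\<beta> (axis 1 1) y) < e/2"
      "d2 > 0" "\<And>z. dist z y < d2 \<Longrightarrow> dist (?\<beta> (axis 2 1) z) (?\<beta> (axis 2 1) y) < e/2"
    by metis
  obtain d3 where d3: "d3 > 0" "ball y d3 \<subseteq> snd c ` fst c"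
    using open_chart_range[OF c] y openE by blast
  let ?d = "min d1 (min d2 d3)"
  show "\<exists>d>0. \<forall>z. norm (z - y) < d \<longrightarrow> norm (F z - F y - ?\<beta> (z - y) y) \<le> e * norm (z - y)"
  proof (intro exI[of _ ?d] conjI allI impI)
    show "?d > 0" using d d3 by simp
    fix z assume z: "norm (z - y) < ?d"
    define h where "h = z - y"
    have near: "dist (y + t *\<^sub>R h) y < ?d" if "t \<in> {0..1}" for t
    proof -
      have "dist (y + t *\<^sub>R h) y \<le> 1 * norm h"
        using that by (simp add: dist_norm mult_left_le_one_le)
      then show ?thesis using z by (simp add: h_def)
    qed
    have seg: "y + t *\<^sub>R h \<in> snd c ` fst c" if "t \<in> {0..1}" for t
      using near[OF that] d3 by (auto simp: dist_commute)
    have "continuous_on {0..1} (\<lambda>t. ?\<beta> h (y + t *\<^sub>R h))"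
      by (rule continuous_on_compose2[OF cont]) (use seg in \<open>auto intro!: continuous_intros\<close>)
    then have "((\<lambda>t. ?\<beta> h (y + t *\<^sub>R h)) has_integral integral {0..1} (\<lambda>t. ?\<beta> h (y + t *\<^sub>R h))) {0..1}"
      using integrable_continuous_real integrable_integral by blast
    moreover have "((\<lambda>t. ?\<beta> h y) has_integral ?\<beta> h y) {0..1::real}"
      using has_integral_const_real[of "?\<beta> h y" 0 1] by simp
    ultimately have I: "((\<lambda>t. ?\<beta> h (y + t *\<^sub>R h) - ?\<beta> h y) has_integral
        integral {0..1} (\<lambda>t. ?\<beta> h (y + t *\<^sub>R h)) - ?\<beta> h y) {0..1}"
      by (rule has_integral_diff)
    have bound: "norm (?\<beta> h (y + t *\<^sub>R h) - ?\<beta> h y) \<le> e * norm h" if "t \<in> {0..1}" for t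
    proof -
      let ?z = "y + t *\<^sub>R h"
      have "?\<beta> h ?z - ?\<beta> h y = h$1 *\<^sub>R (?\<beta> (axis 1 1) ?z - ?\<beta> (axis 1 1) y) + h$2 *\<^sub>R (?\<beta> (axis 2 1) ?z - ?\<beta> (axis 2 1) y)"
        unfolding expand[OF seg[OF that], of h] expand[OF y, of h] by (simp add: algebra_simps)
      also have "norm \<dots> \<le> \<bar>h$1\<bar> * norm (?\<beta> (axis 1 1) ?z - ?\<beta> (axis 1 1) y) + \<bar>h$2\<bar> * norm (?\<beta> (axis 2 1) ?z - ?\<beta> (axis 2 1) y)"
        by (metis norm_triangle_ineq norm_scaleR)
      also have "\<dots> \<le> norm h * (e/2) + norm h * (e/2)"
      proof -
        have "norm (?\<beta> (axis 1 1) ?z - ?\<beta> (axis 1 1) y) \<le> e/2" "norm (?\<beta> (axis 2 1) ?z - ?\<beta> (axis 2 1) y) \<le> e/2"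
          using d(2)[of ?z] d(4)[of ?z] near[OF that] unfolding dist_norm by linarith+
        then show ?thesis using e by (intro add_mono mult_mono component_le_norm_cart) auto
      qed
      finally show ?thesis by (simp add: field_simps)
    qed
    have "norm (integral {0..1} (\<lambda>t. ?\<beta> h (y + t *\<^sub>R h)) - ?\<beta> h y) \<le> e * norm h * measure lborel {0..1::real}"
      by (rule has_integral_bound_real[OF _ _ I, of _ "{}"]) (use bound e in auto)
    moreover have "F z = F y + integral {0..1} (\<lambda>t. ?\<beta> h (y + t *\<^sub>R h))"
      using F[OF seg] by (simp add: h_def)
    ultimately show "norm (F z - F y - ?\<beta> (z - y) y) \<le> e * norm (z - y)"
      by (simp add: h_def)
  qed
qed

text \<open>\<open>F\<close> integrates along a chosen chain from a base point. As the surface may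
  be disconnected, a base point is chosen in each class of mutually reachable points.\<close>

lemma primitive_along_chains:
  fixes \<alpha> :: "'m \<Rightarrow> real^2 \<Rightarrow> 'b::euclidean_space"
  assumes per: "\<And>\<gamma>s. closed_curve A \<gamma>s \<Longrightarrow> curve_integral A \<alpha> \<gamma>s = 0"
  obtains F where "\<And>x \<gamma>s y. curve_chain A x \<gamma>s y \<Longrightarrow> F y = F x + curve_integral A \<alpha> \<gamma>s"
proof -
  define R where "R x = {b. \<exists>\<gamma>s. curve_chain A x \<gamma>s b}" for x
  have R: "R x = R y" if "curve_chain A x \<gamma>s y" for x y \<gamma>s
    using that curve_chain_reverse[OF that] curve_chain_append unfolding R_def by blast
  \<comment> \<open>Equal sets of reachable points give equal choices, so \<open>base\<close> is
    constant along chains.\<close>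
  define base where "base x = (SOME b. b \<in> R x)" for x
  have "x \<in> R x" for x
    unfolding R_def by (auto intro: exI[of _ "[]"])
  then have "base x \<in> R x" for x
    unfolding base_def by (rule someI)
  then have "\<exists>\<gamma>s. curve_chain A (base x) \<gamma>s x" for x
    using curve_chain_reverse unfolding R_def by blast
  then obtain p where p: "\<And>x. curve_chain A (base x) (p x) x" by metis
  have zero: "curve_integral A \<alpha> \<gamma>s = 0" if "curve_chain A x \<gamma>s x" for x \<gamma>s
    using curve_chain_closed[OF that] per by (cases "\<gamma>s = []") (auto simp: curve_integral_def)
  show ?thesis
  proof (rule that[of "\<lambda>x. curve_integral A \<alpha> (p x)"])
    fix x \<gamma>s y assume ch: "curve_chain A x \<gamma>s y"
    have b: "base y = base x" unfolding base_def using R[OF ch] by simp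
    obtain \<delta>s where \<delta>s: "curve_chain A y \<delta>s (base x)"
      using curve_chain_reverse[OF p[of y]] b by auto
    \<comment> \<open>Both ways from the base point to \<open>y\<close> are closed up by the same
      return chain, whose integral then cancels.\<close>
    have "curve_integral A \<alpha> (p x @ \<gamma>s @ \<delta>s) = 0"
      using curve_chain_append[OF p curve_chain_append[OF ch \<delta>s]] zero by blast
    moreover have "curve_integral A \<alpha> (p y @ \<delta>s) = 0"
      using curve_chain_append[OF p[of y] \<delta>s] b zero by metis
    ultimately show "curve_integral A \<alpha> (p y) = curve_integral A \<alpha> (p x) + curve_integral A \<alpha> \<gamma>s"
      by (simp add: curve_integral_append) (metis add.assoc add_right_cancel)
  qed
qed

lemma ex_primitive:
  fixes \<alpha> :: "'m \<Rightarrow> real^2 \<Rightarrow> 'b::euclidean_space"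
  assumes \<alpha>: "smooth_form A UNIV \<alpha>"
    and per: "\<And>\<gamma>s. closed_curve A \<gamma>s \<Longrightarrow> curve_integral A \<alpha> \<gamma>s = 0"
  obtains F where "smooth_map A UNIV F" "\<And>x X. differential A F x X = \<alpha> x X"
proof -
  obtain F where F: "\<And>x \<gamma>s y. curve_chain A x \<gamma>s y \<Longrightarrow> F y = F x + curve_integral A \<alpha> \<gamma>s"
    using primitive_along_chains[of \<alpha>] per by blast
  have der: "((F \<circ> chart_inv c) has_derivative (\<lambda>h. local_form A c \<alpha> h y)) (at y)"
    if c: "c \<in> A" and y: "y \<in> snd c ` fst c" for c y
  proof (rule primitive_has_derivative[OF \<alpha> c y])
    fix z h assume seg: "\<And>t::real. t \<in> {0..1} \<Longrightarrow> z + t *\<^sub>R h \<in> snd c ` fst c"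
    have "curve_chain A (chart_inv c z) [\<lambda>t. chart_inv c (z + t *\<^sub>R h)] (chart_inv c (z + h))"
      using smooth_curve_segment[OF c seg] by simp
    from F[OF this]
    show "(F \<circ> chart_inv c) (z + h) =
      (F \<circ> chart_inv c) z + integral {0..1} (\<lambda>t. local_form A c \<alpha> h (z + t *\<^sub>R h))"
      using curve_integral_segment[OF c seg, of \<alpha>] by simp
  qed
  show ?thesis
  proof (rule that)
    show "smooth_map A UNIV F"
      unfolding smooth_map_def
    proof
      fix c assume c: "c \<in> A"
      have "frechet_derivative (F \<circ> chart_inv c) (at y) w = local_form A c \<alpha> w y"
        if "y \<in> snd c ` fst c" for y w
        using frechet_derivative_at[OF der[OF c that]] by metis
      then have "smooth_on (snd c ` fst c) (\<lambda>y. frechet_derivative (F \<circ> chart_inv c) (at y) w)" for w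
        using \<alpha> c smooth_on_cong[OF open_chart_range[OF c], of _ "local_form A c \<alpha> w"]
        unfolding smooth_form_def by auto
      moreover have "(F \<circ> chart_inv c) differentiable (at y)" if "y \<in> snd c ` fst c" for y
        using der[OF c that] by (rule differentiableI)
      ultimately have "smooth_on (snd c ` fst c) (F \<circ> chart_inv c)"
        by (rule smooth_onI_derivative[rotated])
      then show "smooth_on (snd c ` (UNIV \<inter> fst c)) (F \<circ> chart_inv c)" by simp
    qed
    fix x X
    have "snd (chart_at A x) x \<in> snd (chart_at A x) ` fst (chart_at A x)" using chart_at(2) by blast
    from fun_cong[OF frechet_derivative_at[OF der[OF chart_at(1) this]], of X]
    show "differential A F x X = \<alpha> x X"
      unfolding differential_def local_form_def chart_inv_left[OF chart_at] by simp
  qed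
qed

end

section \<open>Metrics and densities\<close>

text \<open>The factor between the volume form and \<open>area2\<close>, as the root of the Gram
  determinant. It refers to the preferred chart and need not be continuous in
  \<open>x\<close>.\<close>

definition metric_area :: "'m bilin \<Rightarrow> 'm \<Rightarrow> real" where
  "metric_area g x = sqrt (g x (axis 1 1) (axis 1 1) * g x (axis 2 1) (axis 2 1) - (g x (axis 1 1) (axis 2 1))\<^sup>2)"

lemma metric_coordinates:
  fixes g :: "'m bilin"
  assumes "bilinear (g x)" "\<And>X Y. g x X Y = g x Y X"
  shows "g x X Y = g x (axis 1 1) (axis 1 1) * X$1 * Y$1 +
    g x (axis 1 1) (axis 2 1) * (X$1 * Y$2 + X$2 * Y$1) + g x (axis 2 1) (axis 2 1) * X$2 * Y$2"
proof -
  have "g x X Y = g x (X$1 *\<^sub>R axis 1 1 + X$2 *\<^sub>R axis 2 1) (Y$1 *\<^sub>R axis 1 1 + Y$2 *\<^sub>R axis 2 1)"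
    using vec2_eq_axis_sum by metis
  also have "\<dots> = g x (axis 1 1) (axis 1 1) * X$1 * Y$1 +
    g x (axis 1 1) (axis 2 1) * (X$1 * Y$2 + X$2 * Y$1) + g x (axis 2 1) (axis 2 1) * X$2 * Y$2"
    using assms(2)[of "axis 2 1" "axis 1 1"]
    by (simp add: bilinear_ladd[OF assms(1)] bilinear_radd[OF assms(1)] bilinear_lmul[OF assms(1)]
        bilinear_rmul[OF assms(1)] algebra_simps)
  finally show ?thesis .
qed

locale riemannian_surface = surface_atlas A for A :: "'m::t2_space chart set" +
  fixes g :: "'m bilin"
  assumes metric: "riemannian_metric A g"
begin

lemma metric_bilinear: "bilinear (g x)"
  and metric_sym: "g x X Y = g x Y X"
  and metric_pos: "X \<noteq> 0 \<Longrightarrow> 0 < g x X X"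
  using metric unfolding riemannian_metric_def by blast+

lemmas metric_linear = bilinear_ladd[OF metric_bilinear] bilinear_radd[OF metric_bilinear]
  bilinear_lmul[OF metric_bilinear] bilinear_rmul[OF metric_bilinear]

lemma metric_zero [simp]: "g x 0 Y = 0" "g x Y 0 = 0"
  using bilinear_lzero[OF metric_bilinear] bilinear_rzero[OF metric_bilinear] by auto

lemma metric_nonneg: "0 \<le> g x X X"
  using metric_pos[of X x] by (cases "X = 0") auto

lemma metric_eq_0_iff [simp]: "g x X X = 0 \<longleftrightarrow> X = 0"
  using metric_pos[of X x] by (cases "X = 0") auto

lemma metric_area: "metric_area g x > 0"
  "(metric_area g x)\<^sup>2 = g x (axis 1 1) (axis 1 1) * g x (axis 2 1) (axis 2 1) - (g x (axis 1 1) (axis 2 1))\<^sup>2"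
proof -
  let ?E = "g x (axis 1 1) (axis 1 1)" and ?F = "g x (axis 1 1) (axis 2 1)" and ?G = "g x (axis 2 1) (axis 2 1)"
  \<comment> \<open>This is \<open>?E\<close> times the component of the second basis vector
    orthogonal to the first; its squared length is \<open>?E\<close> times the Gram
    determinant.\<close>
  let ?Z = "(- ?F) *\<^sub>R axis 1 1 + ?E *\<^sub>R axis 2 1 :: real^2"
  have E: "?E > 0" by (rule metric_pos) (simp add: axis_eq_0_iff)
  have c: "?Z $ 1 = - ?F" "?Z $ 2 = ?E" by (auto simp: axis_def)
  then have "?Z \<noteq> 0" using E by (metis less_irrefl zero_index)
  then have "0 < g x ?Z ?Z" by (rule metric_pos)
  also have "g x ?Z ?Z = ?E * (?E * ?G - ?F\<^sup>2)"
    by (subst metric_coordinates[of g x, OF metric_bilinear metric_sym]) (simp only: c, simp add: algebra_simps power2_eq_square)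
  finally have pos: "0 < ?E * ?G - ?F\<^sup>2" using E by (simp add: zero_less_mult_iff)
  then show "metric_area g x > 0" "(metric_area g x)\<^sup>2 = ?E * ?G - ?F\<^sup>2"
    unfolding metric_area_def by simp_all
qed

text \<open>A change of basis multiplies the Gram determinant by the square of its determinant, here
  \<open>area2 X Y\<close>.\<close>

lemma gram_identity:
  "g x X X * g x Y Y - (g x X Y)\<^sup>2 = (metric_area g x * area2 X Y)\<^sup>2"
  unfolding power_mult_distrib metric_area(2)
    metric_coordinates[of g x X X, OF metric_bilinear metric_sym]
    metric_coordinates[of g x Y Y, OF metric_bilinear metric_sym]
    metric_coordinates[of g x X Y, OF metric_bilinear metric_sym]
  by algebra

text \<open>\<open>rot\<close> is a definite description, so the formulas require existence and
  uniqueness. For \<open>X\<close> nonzero, orthogonality and equal length determine the vector up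
  to sign by \<open>gram_identity\<close>, and the orientation condition fixes the sign.\<close>

lemma rot_coordinates:
  "(rot g x X) $ 1 = - (g x (axis 1 1) (axis 2 1) * X$1 + g x (axis 2 1) (axis 2 1) * X$2) / metric_area g x"
  "(rot g x X) $ 2 = (g x (axis 1 1) (axis 1 1) * X$1 + g x (axis 1 1) (axis 2 1) * X$2) / metric_area g x"
proof -
  define E F G W where "E = g x (axis 1 1) (axis 1 1)" "F = g x (axis 1 1) (axis 2 1)"
    "G = g x (axis 2 1) (axis 2 1)" "W = metric_area g x"
  have g: "g x X Y = E * X$1 * Y$1 + F * (X$1 * Y$2 + X$2 * Y$1) + G * X$2 * Y$2" for X Y
    using metric_coordinates[of g x X Y, OF metric_bilinear metric_sym] by (simp add: E_F_G_W_def)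
  have W: "W > 0" "W * W = E * G - F * F"
    using metric_area[of x] by (simp_all add: E_F_G_W_def power2_eq_square)
  define P Q K where "P = E * X$1 + F * X$2" "Q = F * X$1 + G * X$2" "K = g x X X"
  have K: "K = P * X$1 + Q * X$2" by (simp add: P_Q_K_def g algebra_simps)
  define Y :: "real^2" where "Y = (- Q / W) *\<^sub>R axis 1 1 + (P / W) *\<^sub>R axis 2 1"
  have Y: "Y $ 1 = - Q / W" "Y $ 2 = P / W" by (auto simp: Y_def axis_def)
  have gXZ: "g x X Z = P * Z$1 + Q * Z$2" for Z
    by (simp add: g P_Q_K_def algebra_simps)
  have "rot g x X = Y"
    unfolding rot_def
  proof (rule the_equality, intro conjI)
    show "g x X Y = 0" unfolding gXZ Y by simp
    have WY: "W * Y$1 = - Q" "W * Y$2 = P" using W(1) by (simp_all add: Y)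
    have "area2 X Y = K / W"
      unfolding Y K by (simp add: add_divide_distrib mult.commute)
    moreover have "0 \<le> K" unfolding P_Q_K_def by (rule metric_nonneg)
    ultimately show "0 \<le> area2 X Y" using W(1) by simp
    have "W * W * g x Y Y = E * (W * Y$1) * (W * Y$1) + 2 * F * (W * Y$1) * (W * Y$2) + G * (W * Y$2) * (W * Y$2)"
      unfolding g by (simp add: algebra_simps)
    also have "\<dots> = E * Q * Q - 2 * F * P * Q + G * P * P"
      unfolding WY by simp
    also have "\<dots> = (E * G - F * F) * g x X X"
      unfolding P_Q_K_def(1,2) g by algebra
    also have "\<dots> = W * W * g x X X" unfolding W(2) ..
    finally show "g x Y Y = g x X X" using W(1) by simp
    fix Z assume Z: "g x X Z = 0 \<and> g x Z Z = g x X X \<and> 0 \<le> area2 X Z"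
    show "Z = Y"
    proof (cases "X = 0")
      case True
      then have "Z = 0" using Z by simp
      moreover have "Y = 0" using True by (simp add: Y_def P_Q_K_def)
      ultimately show ?thesis by simp
    next
      case False
      then have Kpos: "K > 0" unfolding P_Q_K_def by (rule metric_pos)
      have "K * K = (W * area2 X Z)\<^sup>2"
        using gram_identity[of x X Z] Z by (simp add: P_Q_K_def E_F_G_W_def)
      then have "K\<^sup>2 = (W * area2 X Z)\<^sup>2" by (simp add: power2_eq_square)
      then have a: "W * area2 X Z = K"
        using Z W Kpos by (metis less_imp_le mult_nonneg_nonneg power2_eq_imp_eq)
      have b: "P * Z$1 + Q * Z$2 = 0" using Z gXZ by simp
      \<comment> \<open>Cramer's rule for the linear equations \<open>a\<close> and \<open>b\<close>
        in the components of \<open>Z\<close>, whose determinant is \<open>W * K\<close> up to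
        sign.\<close>
      have "W * (K * Z$1) = - Q * (W * area2 X Z) + W * X$1 * (P * Z$1 + Q * Z$2)"
        unfolding K by (simp add: algebra_simps)
      then have "K * (W * Z$1) = K * (- Q)" unfolding a b by (simp add: algebra_simps)
      then have "W * Z$1 = - Q" using Kpos by (metis less_irrefl mult_left_cancel)
      then have "Z$1 = - Q / W" using W(1) by (simp add: field_simps)
      moreover have "W * (K * Z$2) = P * (W * area2 X Z) + W * X$2 * (P * Z$1 + Q * Z$2)"
        unfolding K by (simp add: algebra_simps)
      then have "K * (W * Z$2) = K * P" unfolding a b by (simp add: algebra_simps)
      then have "W * Z$2 = P" using Kpos by (metis less_irrefl mult_left_cancel)
      then have "Z$2 = P / W" using W(1) by (simp add: field_simps)
      ultimately show ?thesis by (simp add: vec_eq_iff forall_2 Y)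
    qed
  qed
  then show "(rot g x X) $ 1 = - (g x (axis 1 1) (axis 2 1) * X$1 + g x (axis 2 1) (axis 2 1) * X$2) / metric_area g x"
    "(rot g x X) $ 2 = (g x (axis 1 1) (axis 1 1) * X$1 + g x (axis 1 1) (axis 2 1) * X$2) / metric_area g x"
    using Y by (simp_all add: P_Q_K_def E_F_G_W_def)
qed

lemma metric_rot: "g x X (rot g x X) = 0" "g x (rot g x X) (rot g x X) = g x X X"
proof -
  define E F G W where "E = g x (axis 1 1) (axis 1 1)" "F = g x (axis 1 1) (axis 2 1)"
    "G = g x (axis 2 1) (axis 2 1)" "W = metric_area g x"
  have g: "g x X Y = E * X$1 * Y$1 + F * (X$1 * Y$2 + X$2 * Y$1) + G * X$2 * Y$2" for X Y
    using metric_coordinates[of g x X Y, OF metric_bilinear metric_sym] by (simp add: E_F_G_W_def)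
  have W: "W > 0" "W * W = E * G - F * F"
    using metric_area[of x] by (simp_all add: E_F_G_W_def power2_eq_square)
  have r: "rot g x X $ 1 = - (F * X$1 + G * X$2) / W" "rot g x X $ 2 = (E * X$1 + F * X$2) / W"
    unfolding rot_coordinates by (simp_all add: E_F_G_W_def)
  show "g x X (rot g x X) = 0" unfolding g r by (simp add: algebra_simps diff_divide_distrib add_divide_distrib)
  have "W * W * g x (rot g x X) (rot g x X) =
      E * (F * X$1 + G * X$2)\<^sup>2 - 2 * F * (E * X$1 + F * X$2) * (F * X$1 + G * X$2) + G * (E * X$1 + F * X$2)\<^sup>2"
    unfolding g r using W(1) by (simp add: field_simps power2_eq_square)
  also have "\<dots> = (E * G - F * F) * g x X X" unfolding g by algebra
  also have "\<dots> = W * W * g x X X" unfolding W(2) ..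
  finally show "g x (rot g x X) (rot g x X) = g x X X" using W(1) by simp
qed

lemma rot_rot: "rot g x (rot g x X) = - X"
proof -
  define E F G W where "E = g x (axis 1 1) (axis 1 1)" "F = g x (axis 1 1) (axis 2 1)"
    "G = g x (axis 2 1) (axis 2 1)" "W = metric_area g x"
  have W: "W > 0" "W * W = E * G - F * F"
    using metric_area[of x] by (simp_all add: E_F_G_W_def power2_eq_square)
  have r: "rot g x Y $ 1 = - (F * Y$1 + G * Y$2) / W" "rot g x Y $ 2 = (E * Y$1 + F * Y$2) / W" for Y
    unfolding rot_coordinates by (simp_all add: E_F_G_W_def)
  have "W * W * rot g x (rot g x X) $ 1 = - (E * G - F * F) * X $ 1"
    unfolding r using W(1) by (simp add: field_simps)
  moreover have "W * W * rot g x (rot g x X) $ 2 = - (E * G - F * F) * X $ 2"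
    unfolding r using W(1) by (simp add: field_simps)
  ultimately have "W * W * rot g x (rot g x X) $ 1 = W * W * - X $ 1" "W * W * rot g x (rot g x X) $ 2 = W * W * - X $ 2"
    unfolding W(2) by (simp_all add: left_diff_distrib)
  then have "rot g x (rot g x X) $ 1 = - X $ 1" "rot g x (rot g x X) $ 2 = - X $ 2"
    using W(1) by (metis less_irrefl mult_eq_0_iff mult_left_cancel)+
  then show ?thesis by (simp add: vec_eq_iff forall_2)
qed

lemma vol_area2: "vol g x X Y = metric_area g x * area2 X Y"
proof -
  define E F G W where "E = g x (axis 1 1) (axis 1 1)" "F = g x (axis 1 1) (axis 2 1)"
    "G = g x (axis 2 1) (axis 2 1)" "W = metric_area g x"
  have g: "g x X Y = E * X$1 * Y$1 + F * (X$1 * Y$2 + X$2 * Y$1) + G * X$2 * Y$2" for X Y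
    using metric_coordinates[of g x X Y, OF metric_bilinear metric_sym] by (simp add: E_F_G_W_def)
  have W: "W > 0" "W * W = E * G - F * F"
    using metric_area[of x] by (simp_all add: E_F_G_W_def power2_eq_square)
  have r: "rot g x X $ 1 = - (F * X$1 + G * X$2) / W" "rot g x X $ 2 = (E * X$1 + F * X$2) / W"
    unfolding rot_coordinates by (simp_all add: E_F_G_W_def)
  have "W * vol g x X Y = (E * G - F * F) * area2 X Y"
    unfolding vol_def g r using W(1) by (simp add: field_simps)
  then have "W * vol g x X Y = W * (W * area2 X Y)" by (simp flip: W(2))
  then show ?thesis using W(1) by (simp add: E_F_G_W_def)
qed

lemma rot_decomposition:
  assumes "X \<noteq> 0"
  obtains a b where "Y = a *\<^sub>R X + b *\<^sub>R rot g x X" "g x Y Y = (a\<^sup>2 + b\<^sup>2) * g x X X"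
proof -
  \<comment> \<open>Coefficients with respect to the orthogonal vectors \<open>X\<close> and
    \<open>rot g x X\<close>; the second is \<open>vol g x X Y / g x X X\<close>.\<close>
  define a b where "a = g x X Y / g x X X" "b = metric_area g x * area2 X Y / g x X X"
  have K: "g x X X > 0" using assms by (rule metric_pos)
  have "g x X X *\<^sub>R Y = g x X Y *\<^sub>R X + (metric_area g x * area2 X Y) *\<^sub>R rot g x X"
    using metric_area(1)[of x]
    unfolding vec_eq_iff forall_2 vector_add_component vector_scaleR_component real_scaleR_def rot_coordinates
      metric_coordinates[of g x X X, OF metric_bilinear metric_sym]
      metric_coordinates[of g x X Y, OF metric_bilinear metric_sym]
    by (simp add: field_simps)
  then have "(1 / g x X X) *\<^sub>R (g x X X *\<^sub>R Y) = a *\<^sub>R X + b *\<^sub>R rot g x X"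
    by (simp add: scaleR_add_right a_b_def)
  then have 1: "Y = a *\<^sub>R X + b *\<^sub>R rot g x X" using assms by simp
  have "g x Y Y = (a\<^sup>2 + b\<^sup>2) * g x X X"
    unfolding 1 by (simp add: metric_linear metric_rot metric_sym[of x "rot g x X" X] power2_eq_square algebra_simps)
  with 1 show ?thesis by (rule that)
qed

text \<open>Every vector arises from one fixed nonzero vector by scaling and quarter turn, and
  \<open>g\<close> changes by the same factor as \<open>k\<close>, so comparing the two at that
  vector suffices.\<close>

lemma K_powerI:
  assumes "\<And>X a b. X \<noteq> 0 \<Longrightarrow> k (a *\<^sub>R X + b *\<^sub>R rot g x X) = (a\<^sup>2 + b\<^sup>2) * k X"
  shows "k \<in> K_power g 2 x"
  unfolding K_power_def
proof (intro CollectI exI allI)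
  let ?e = "axis 1 1 :: real^2"
  have e: "?e \<noteq> 0" by (simp add: axis_eq_0_iff)
  fix X
  obtain a b where "X = a *\<^sub>R ?e + b *\<^sub>R rot g x ?e" "g x X X = (a\<^sup>2 + b\<^sup>2) * g x ?e ?e"
    using rot_decomposition[OF e] .
  then show "k X = k ?e / g x ?e ?e * sqrt (g x X X) ^ 2"
    using assms[OF e, of a b] metric_nonneg[of x X] e by simp
qed

lemma K_powerE:
  assumes "k \<in> K_power g 2 x"
  obtains r where "\<And>X. k X = r * g x X X"
  using assms metric_nonneg unfolding K_power_def by auto

lemma form_of_density_area2:
  assumes "q x \<in> K_power g 2 x"
  shows "\<exists>k. \<forall>X Y. form_of_density g q x X Y = k * area2 X Y"
proof -
  obtain r where r: "\<And>X. q x X = r * g x X X" using K_powerE[OF assms] by blast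
  \<comment> \<open>At \<open>X = 0\<close> the quotient is 0 / 0 = 0, in accordance with the right
    hand side.\<close>
  have "form_of_density g q x X Y = r * metric_area g x * area2 X Y" for X Y
    unfolding form_of_density_def r vol_area2 by (cases "X = 0") auto
  then show ?thesis by blast
qed

lemma tvec_basis:
  assumes "c \<in> A" "x \<in> fst c"
  shows "area2 (tvec A c x (axis 1 1)) (tvec A c x (axis 2 1)) > 0" "tvec A c x (axis 1 1) \<noteq> 0"
proof -
  have "area2 (tvec A c x (axis 1 1)) (tvec A c x (axis 2 1)) = det (matrix (tvec A c x))"
    unfolding area2_linear[OF linear_tvec[OF assms]] by (simp add: axis_def)
  moreover have "det (matrix (tvec A c x)) > 0"
    unfolding tvec_def[abs_def] using det_transition_pos[OF assms(1) chart_at(1) assms(2) chart_at(2)] by simp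
  ultimately show *: "area2 (tvec A c x (axis 1 1)) (tvec A c x (axis 2 1)) > 0" by simp
  then show "tvec A c x (axis 1 1) \<noteq> 0" by auto
qed

text \<open>\<open>metric_area\<close> refers to the jumping preferred chart. By
  \<open>gram_identity\<close> it is absorbed into the values of the metric on coordinate fields,
  which are smooth.\<close>

lemma local_density_form_of_density:
  fixes c y
  defines "x \<equiv> chart_inv c y"
  defines "X \<equiv> tvec A c x (axis 1 1)" and "Y \<equiv> tvec A c x (axis 2 1)"
  assumes "c \<in> A" "y \<in> snd c ` fst c"
  shows "local_density A c (form_of_density g q) y = q x X / g x X X * sqrt (g x X X * g x Y Y - (g x X Y)\<^sup>2)"
    "0 < g x X X * g x Y Y - (g x X Y)\<^sup>2"
proof -
  have "0 < metric_area g x * area2 X Y"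
    unfolding X_def Y_def x_def using tvec_basis(1)[OF assms(4) chart_inv_in[OF assms(4,5)]] metric_area(1) by simp
  then show "local_density A c (form_of_density g q) y = q x X / g x X X * sqrt (g x X X * g x Y Y - (g x X Y)\<^sup>2)"
    "0 < g x X X * g x Y Y - (g x X Y)\<^sup>2"
    unfolding gram_identity local_density_def form_of_density_def vol_area2 X_def Y_def x_def by auto
qed

lemma continuous_local_density:
  assumes c: "c \<in> A" and q: "continuous_on (snd c ` fst c) (local_form A c q (axis 1 1))"
  shows "continuous_on (snd c ` fst c) (local_density A c (form_of_density g q))"
proof -
  have g: "continuous_on (snd c ` fst c)
      (\<lambda>y. g (chart_inv c y) (tvec A c (chart_inv c y) v) (tvec A c (chart_inv c y) w))" for v w
    using metric c smooth_on_continuous unfolding riemannian_metric_def by blast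
  have "continuous_on (snd c ` fst c) (\<lambda>y. let x = chart_inv c y; X = tvec A c x (axis 1 1); Y = tvec A c x (axis 2 1) in
      q x X / g x X X * sqrt (g x X X * g x Y Y - (g x X Y)\<^sup>2))"
    unfolding Let_def
    using q tvec_basis(2)[OF c chart_inv_in[OF c]] unfolding local_form_def
    by (intro continuous_intros g) auto
  then show ?thesis
    by (rule continuous_on_eq) (simp add: Let_def local_density_form_of_density[OF c])
qed

lemma ex_density_integral:
  assumes "compact (UNIV :: 'm set)" "\<And>x. q x \<in> K_power g 2 x"
    "\<And>c. c \<in> A \<Longrightarrow> continuous_on (snd c ` fst c) (local_form A c q (axis 1 1))"
  shows "\<exists>I. has_surface_integral A (form_of_density g q) I"
  by (rule ex_surface_integral[OF assms(1) form_of_density_area2[of q, OF assms(2)]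
        continuous_local_density[OF _ assms(3)]])

lemma integrable_densityI:
  assumes "compact (UNIV :: 'm set)" "\<And>x. q x \<in> K_power g 2 x"
    "\<And>c. c \<in> A \<Longrightarrow> continuous_on (snd c ` fst c) (local_form A c q (axis 1 1))"
  shows "integrable_density A g q"
  unfolding integrable_density_def
  using assms(2) ex_density_integral[OF assms] has_surface_integral_unique[OF assms(1)] by blast

lemma density_integral_nonneg:
  assumes "compact (UNIV :: 'm set)" "has_surface_integral A (form_of_density g q) I" "\<And>x X. 0 \<le> q x X"
  shows "0 \<le> I"
proof (rule surface_integral_nonneg[OF assms(1,2)])
  show "0 \<le> local_density A c (form_of_density g q) y" if "c \<in> A" "y \<in> snd c ` fst c" for c y
    using local_density_form_of_density(2)[OF that]
    by (simp add: local_density_form_of_density(1)[OF that] assms(3) metric_nonneg)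
qed

lemma density_integral_eq_0_iff:
  assumes "compact (UNIV :: 'm set)" "has_surface_integral A (form_of_density g q) I" "\<And>x X. 0 \<le> q x X"
    and K: "\<And>x. q x \<in> K_power g 2 x"
    and cont: "\<And>c. c \<in> A \<Longrightarrow> continuous_on (snd c ` fst c) (local_form A c q (axis 1 1))"
  shows "I = 0 \<longleftrightarrow> (\<forall>x X. q x X = 0)"
proof
  assume I: "I = 0"
  show "\<forall>x X. q x X = 0"
  proof (intro allI)
    fix x X
    let ?c = "chart_at A x"
    have y: "snd ?c x \<in> snd ?c ` fst ?c" using chart_at(2) by blast
    have "local_density A ?c (form_of_density g q) (snd ?c x) = 0"
    proof (rule surface_integral_zero_imp[OF assms(1) _ _ continuous_local_density[OF _ cont] chart_at(1) y])
      show "0 \<le> local_density A c (form_of_density g q) y" if "c \<in> A" "y \<in> snd c ` fst c" for c y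
        using local_density_form_of_density(2)[OF that]
        by (simp add: local_density_form_of_density(1)[OF that] assms(3) metric_nonneg)
    qed (use assms(2) I in auto)
    \<comment> \<open>The chart is the preferred one, so its first coordinate vector at
      \<open>x\<close> is \<open>axis 1 1\<close> itself.\<close>
    then have "q x (axis 1 1) = 0"
      using local_density_form_of_density(1)[OF chart_at(1) y, where q=q]
        local_density_form_of_density(2)[OF chart_at(1) y] tvec_basis(2)[OF chart_at]
      by (simp add: chart_inv_left[OF chart_at])
    \<comment> \<open>A density that vanishes on one nonzero vector vanishes on all.\<close>
    moreover obtain r where "\<And>X. q x X = r * g x X X" using K_powerE[OF K] by blast
    ultimately show "q x X = 0" by (simp add: axis_eq_0_iff)
  qed
next
  assume z: "\<forall>x X. q x X = 0"
  have "has_surface_integral A (form_of_density g q) 0"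
    unfolding has_surface_integral_def
  proof (intro allI impI)
    fix n :: nat and c :: "nat \<Rightarrow> 'm chart" and P :: "nat \<Rightarrow> 'm set"
    have "local_density A (c i) (form_of_density g q) = (\<lambda>y. 0)" for i
      using z by (auto simp: local_density_def form_of_density_def)
    then show "(\<forall>i<n. local_density A (c i) (form_of_density g q) absolutely_integrable_on snd (c i) ` P i) \<and>
      (\<Sum>i<n. integral (snd (c i) ` P i) (local_density A (c i) (form_of_density g q))) = 0"
      by simp
  qed
  then show "I = 0" using has_surface_integral_unique[OF assms(1,2)] by simp
qed

end

section \<open>Quaternions\<close>

lemmas quat_simps = qmult_def qcnj_def qreal_def prod_eq_iff vec_eq_iff forall_3 cross3_def inner_vec_def
  sum_3 inner_prod_def

lemma qmult_assoc: "(p \<odot> q) \<odot> r = p \<odot> (q \<odot> r)"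
  by (simp add: quat_simps algebra_simps)

lemma qmult_add_left: "(p + q) \<odot> r = p \<odot> r + q \<odot> r"
  and qmult_add_right: "p \<odot> (q + r) = p \<odot> q + p \<odot> r"
  by (simp_all add: quat_simps algebra_simps)

lemma qmult_scaleR_left: "(a *\<^sub>R p) \<odot> q = a *\<^sub>R (p \<odot> q)"
  and qmult_scaleR_right: "p \<odot> (a *\<^sub>R q) = a *\<^sub>R (p \<odot> q)"
  by (simp_all add: quat_simps algebra_simps)

lemma qmult_minus_left: "(- p) \<odot> q = - (p \<odot> q)"
  and qmult_minus_right: "p \<odot> (- q) = - (p \<odot> q)"
  by (simp_all add: quat_simps algebra_simps)

lemma qmult_diff_left: "(p - q) \<odot> r = p \<odot> r - q \<odot> r"
  and qmult_diff_right: "p \<odot> (q - r) = p \<odot> q - p \<odot> r"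
  by (simp_all add: quat_simps algebra_simps)

lemma qmult_qreal [simp]: "q \<odot> qreal a = a *\<^sub>R q" "qreal a \<odot> q = a *\<^sub>R q"
  by (simp_all add: quat_simps algebra_simps)

lemma qmult_zero [simp]: "0 \<odot> q = 0" "q \<odot> 0 = 0"
  by (simp_all add: quat_simps)

lemma qcnj_qmult: "qcnj (p \<odot> q) = qcnj q \<odot> qcnj p"
  by (simp add: quat_simps algebra_simps)

lemma qcnj_simps [simp]: "qcnj (qcnj q) = q" "qcnj (- q) = - qcnj q" "qcnj (qreal a) = qreal a"
  "qcnj (p + q) = qcnj p + qcnj q" "qcnj (a *\<^sub>R q) = a *\<^sub>R qcnj q"
  by (simp_all add: quat_simps)

lemma qcnj_qmult_self: "qcnj q \<odot> q = qreal ((norm q)\<^sup>2)" "q \<odot> qcnj q = qreal ((norm q)\<^sup>2)"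
  by (simp_all add: power2_norm_eq_inner quat_simps algebra_simps)

lemma inner_quat: "p \<bullet> q = fst (qcnj p \<odot> q)"
  by (simp add: quat_simps)

lemma inner_qmult_left: "(u \<odot> p) \<bullet> (u \<odot> q) = (norm u)\<^sup>2 * (p \<bullet> q)"
proof -
  have "qcnj (u \<odot> p) \<odot> (u \<odot> q) = qcnj p \<odot> ((qcnj u \<odot> u) \<odot> q)"
    by (simp only: qcnj_qmult qmult_assoc)
  also have "\<dots> = (norm u)\<^sup>2 *\<^sub>R (qcnj p \<odot> q)"
    by (simp add: qcnj_qmult_self qmult_scaleR_right)
  finally show ?thesis unfolding inner_quat by simp
qed

lemma norm_qmult: "norm (p \<odot> q) = norm p * norm q"
proof -
  have "(norm (p \<odot> q))\<^sup>2 = (norm p * norm q)\<^sup>2"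
    using inner_qmult_left[of p q q] by (simp add: power2_norm_eq_inner power_mult_distrib)
  then show ?thesis by (simp add: power2_eq_iff_nonneg)
qed

lemma norm_qcnj [simp]: "norm (qcnj q) = norm q"
  by (simp add: norm_eq_sqrt_inner quat_simps)

lemma bounded_bilinear_qmult: "bounded_bilinear (\<odot>)"
proof
  show "\<exists>K. \<forall>a b. norm (a \<odot> b) \<le> norm a * norm b * K"
    by (intro exI[of _ 1]) (simp add: norm_qmult)
qed (simp_all add: qmult_add_left qmult_add_right qmult_scaleR_left qmult_scaleR_right)

lemma bounded_linear_qcnj: "bounded_linear qcnj"
  by (rule bounded_linear_intro[where K=1]) simp_all

lemmas continuous_on_qmult = bounded_bilinear.continuous_on[OF bounded_bilinear_qmult]
  and continuous_on_qcnj = bounded_linear.continuous_on[OF bounded_linear_qcnj]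

definition qinv :: "quat \<Rightarrow> quat" where
  "qinv q = (1 / (norm q)\<^sup>2) *\<^sub>R qcnj q"

lemma qmult_qinv: "q \<noteq> 0 \<Longrightarrow> q \<odot> qinv q = qreal 1" "q \<noteq> 0 \<Longrightarrow> qinv q \<odot> q = qreal 1"
  by (simp_all add: qinv_def qmult_scaleR_left qmult_scaleR_right qcnj_qmult_self) (simp_all add: qreal_def)

text \<open>A nonzero real part would force the imaginary part to vanish, leaving a real number with
  square -1.\<close>

lemma square_eq_minus_one:
  assumes "n \<odot> n = - qreal 1"
  shows "qcnj n = - n" "norm n = 1"
proof -
  have a: "fst n * fst n - snd n \<bullet> snd n = -1" and "fst n *\<^sub>R snd n + fst n *\<^sub>R snd n = 0"
    using assms by (simp_all add: qmult_def qreal_def prod_eq_iff cross_refl)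
  then have "2 *\<^sub>R (fst n *\<^sub>R snd n) = 0" by (simp only: scaleR_2)
  then have b: "fst n = 0 \<or> snd n = 0" by (simp only: scaleR_eq_0_iff) simp
  have "fst n = 0"
  proof (rule ccontr)
    assume "fst n \<noteq> 0"
    then have "snd n = 0" using b by simp
    then have "fst n * fst n = -1" using a by simp
    then show False using zero_le_square[of "fst n"] by linarith
  qed
  then show "qcnj n = - n" by (simp add: qcnj_def prod_eq_iff)
  have "norm (n \<odot> n) = 1" unfolding assms by (simp add: qreal_def norm_Pair)
  then have "norm n * norm n = 1" by (simp add: norm_qmult)
  then show "norm n = 1" by (metis abs_norm_cancel abs_square_eq_1 power2_eq_square)
qed

text \<open>The defect of the inequality is the squared length of the remainder
  \<open>m - a *\<^sub>R s - b *\<^sub>R t\<close> of the orthogonal projection. If the defect and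
  the component along \<open>s\<close> vanish, only the component along \<open>t\<close> is
  left.\<close>

lemma bessel2:
  fixes s t m :: "'a::real_inner"
  assumes "s \<bullet> t = 0" "norm s = norm t" "s \<noteq> 0"
  defines "p \<equiv> (m \<bullet> s)\<^sup>2 / (norm s)\<^sup>2" and "q \<equiv> (m \<bullet> t)\<^sup>2 / (norm s)\<^sup>2"
  shows "p + q \<le> (norm m)\<^sup>2"
    and "(norm m)\<^sup>2 = p + q \<Longrightarrow> p = 0 \<Longrightarrow> m = (m \<bullet> t / (norm s)\<^sup>2) *\<^sub>R t"
proof -
  define r where "r = (norm s)\<^sup>2"
  have r: "r > 0" "s \<bullet> s = r" "t \<bullet> t = r" 
    using assms(2,3) by (auto simp: r_def power2_norm_eq_inner[symmetric])
  define a b where "a = m \<bullet> s / r" "b = m \<bullet> t / r"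
  have ab: "m \<bullet> s = a * r" "m \<bullet> t = b * r" using r(1) by (simp_all add: a_b_def)
  have "(norm (m - a *\<^sub>R s - b *\<^sub>R t))\<^sup>2 = (norm m)\<^sup>2 - r * a\<^sup>2 - r * b\<^sup>2"
    unfolding power2_norm_eq_inner
    using assms(1) ab r(2,3) inner_commute[of s m] inner_commute[of t m] inner_commute[of t s]
    by (simp add: inner_diff_left inner_diff_right power2_eq_square algebra_simps)
  moreover have pq: "p = r * a\<^sup>2" "q = r * b\<^sup>2"
    unfolding p_def q_def ab r_def[symmetric] using r(1) by (simp_all add: power2_eq_square)
  ultimately have *: "(norm (m - a *\<^sub>R s - b *\<^sub>R t))\<^sup>2 = (norm m)\<^sup>2 - p - q" by simp
  then show "p + q \<le> (norm m)\<^sup>2" using zero_le_power2[of "norm (m - a *\<^sub>R s - b *\<^sub>R t)"] by linarith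
  assume "(norm m)\<^sup>2 = p + q" "p = 0"
  then have "m - a *\<^sub>R s - b *\<^sub>R t = 0" "a = 0" using * pq r(1) by auto
  then show "m = (m \<bullet> t / (norm s)\<^sup>2) *\<^sub>R t" unfolding a_b_def r_def by simp
qed

section \<open>Quaternionic line bundles\<close>

locale line_bundle = surface_atlas A for A :: "'m::t2_space chart set" +
  fixes L :: "('m, 'l) spin_data"
  assumes is_bundle: "quaternionic_line_bundle A L"
begin

lemma lproj_lscale [simp]: "lproj L (lscale L v q) = lproj L v"
  and lscale_one [simp]: "lscale L v (qreal 1) = v"
  and lscale_lscale [simp]: "lscale L (lscale L v p) q = lscale L v (p \<odot> q)"
  and lscale_add: "lscale L v (p + q) = ladd L (lscale L v p) (lscale L v q)"
proof -
  have "\<forall>v q. lproj L (lscale L v q) = lproj L v"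
    using is_bundle unfolding quaternionic_line_bundle_def by (elim conjE)
  then show "lproj L (lscale L v q) = lproj L v" by blast
  have "\<forall>v. lscale L v (qreal 1) = v"
    using is_bundle unfolding quaternionic_line_bundle_def by (elim conjE)
  then show "lscale L v (qreal 1) = v" by blast
  have "\<forall>v p q. lscale L (lscale L v p) q = lscale L v (p \<odot> q)"
    using is_bundle unfolding quaternionic_line_bundle_def by (elim conjE)
  then show "lscale L (lscale L v p) q = lscale L v (p \<odot> q)" by blast
  have "\<forall>v p q. lscale L v (p + q) = ladd L (lscale L v p) (lscale L v q)"
    using is_bundle unfolding quaternionic_line_bundle_def by (elim conjE)
  then show "lscale L v (p + q) = ladd L (lscale L v p) (lscale L v q)" by blast
qed

lemma lneg_lscale: "lneg L (lscale L v q) = lscale L v (- q)"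
  by (simp add: lneg_def)

lemma ex_frame: "\<exists>U t. (U, t) \<in> lframes L \<and> x \<in> U"
proof -
  have "(\<Union>(U, s)\<in>lframes L. U) = UNIV"
    using is_bundle unfolding quaternionic_line_bundle_def by (elim conjE)
  then have "x \<in> (\<Union>(U, s)\<in>lframes L. U)" by simp
  then show ?thesis by auto
qed

lemma frame:
  assumes "(U, t) \<in> lframes L"
  shows "open U" "x \<in> U \<Longrightarrow> lproj L (t x) = x"
    "x \<in> U \<Longrightarrow> lproj L v = x \<Longrightarrow> \<exists>!q. v = lscale L (t x) q"
proof -
  have "\<forall>(U, s)\<in>lframes L. open U \<and>
      (\<forall>x\<in>U. lproj L (s x) = x \<and> (\<forall>v. lproj L v = x \<longrightarrow> (\<exists>!q. v = lscale L (s x) q)))"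
    using is_bundle unfolding quaternionic_line_bundle_def by (elim conjE)
  from bspec[OF this assms] show "open U" "x \<in> U \<Longrightarrow> lproj L (t x) = x"
    "x \<in> U \<Longrightarrow> lproj L v = x \<Longrightarrow> \<exists>!q. v = lscale L (t x) q"
    by auto
qed

lemma coef_eqI: "\<exists>!q. v = lscale L b q \<Longrightarrow> v = lscale L b q \<Longrightarrow> coef L b v = q"
  unfolding coef_def by (rule the1_equality)

lemma frame_coef:
  assumes "(U, t) \<in> lframes L" "x \<in> U"
  shows "lproj L v = x \<Longrightarrow> lscale L (t x) (coef L (t x) v) = v" "coef L (t x) (lscale L (t x) q) = q"
proof -
  show "lscale L (t x) (coef L (t x) v) = v" if "lproj L v = x"
    using coef_eqI[OF frame(3)[OF assms that]] frame(3)[OF assms that] by metis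
  show "coef L (t x) (lscale L (t x) q) = q"
    by (rule coef_eqI[OF frame(3)[OF assms] refl]) (simp add: frame(2)[OF assms])
qed

lemma frame_coef_nonzero:
  assumes "(U, t) \<in> lframes L" "x \<in> U" "lproj L b = x" "\<not> lzero L b"
  shows "coef L (t x) b \<noteq> 0"
proof
  assume "coef L (t x) b = 0"
  then have b: "b = lscale L (t x) 0" using frame_coef(1)[OF assms(1-3)] by simp
  have "lscale L b 0 = b" unfolding b by simp
  then show False using assms(4) unfolding lzero_def by simp
qed

text \<open>If a frame \<open>t\<close> gives \<open>b\<close> and \<open>v\<close> the coefficients
  p and q, then \<open>b\<close> gives \<open>v\<close> the coefficient p^-1 q. Hence a nowhere
  vanishing section can serve as a global frame.\<close>

lemma nonzero_basis:
  assumes "\<not> lzero L b" "lproj L v = lproj L b"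
  shows "\<exists>!q. v = lscale L b q"
proof -
  obtain U t where t: "(U, t) \<in> lframes L" "lproj L b \<in> U" using ex_frame by blast
  note p = frame_coef_nonzero[OF t refl assms(1)]
  let ?p = "coef L (t (lproj L b)) b" and ?q = "coef L (t (lproj L b)) v"
  have b: "lscale L (t (lproj L b)) ?p = b" using frame_coef(1)[OF t refl] .
  have v: "lscale L (t (lproj L b)) ?q = v" using frame_coef(1)[OF t assms(2)] .
  have "lscale L b (qinv ?p \<odot> ?q) = lscale L (t (lproj L b)) (?p \<odot> (qinv ?p \<odot> ?q))"
    by (metis b lscale_lscale)
  then have 1: "v = lscale L b (qinv ?p \<odot> ?q)"
    using v p by (simp add: qmult_qinv flip: qmult_assoc)
  have "q = qinv ?p \<odot> ?q" if "v = lscale L b q" for q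
  proof -
    have "lscale L (t (lproj L b)) (?p \<odot> q) = v" by (metis b lscale_lscale that)
    then have "?p \<odot> q = ?q" using frame_coef(2)[OF t] by metis
    then show ?thesis using p by (metis qmult_assoc qmult_qinv(2) qmult_qreal(2) scaleR_one)
  qed
  with 1 show ?thesis by blast
qed

lemma nonzero_coef:
  assumes "\<not> lzero L b"
  shows "lproj L v = lproj L b \<Longrightarrow> lscale L b (coef L b v) = v" "coef L b (lscale L b q) = q"
proof -
  show "lscale L b (coef L b v) = v" if "lproj L v = lproj L b"
    using coef_eqI[OF nonzero_basis[OF assms that]] nonzero_basis[OF assms that] by metis
  show "coef L b (lscale L b q) = q"
    by (rule coef_eqI[OF nonzero_basis[OF assms] refl]) simp
qed

text \<open>Passes from a local frame, where regularity is given, to the frame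
  \<open>b\<close>.\<close>

lemma coef_frame:
  assumes "(U, t) \<in> lframes L" "x \<in> U" "lproj L b = x" "\<not> lzero L b" "lproj L v = x"
  shows "coef L b v = qinv (coef L (t x) b) \<odot> coef L (t x) v"
proof -
  have "lscale L (t x) (coef L (t x) b \<odot> coef L b v) = lscale L (lscale L (t x) (coef L (t x) b)) (coef L b v)"
    by simp
  also have "\<dots> = v" using frame_coef(1)[OF assms(1,2,3)] nonzero_coef(1)[OF assms(4)] assms(3,5) by simp
  finally have "coef L (t x) v = coef L (t x) b \<odot> coef L b v" using frame_coef(2)[OF assms(1,2)] by metis
  then show ?thesis
    using frame_coef_nonzero[OF assms(1-4)] by (simp add: qmult_qinv flip: qmult_assoc)
qed

lemma section_smooth:
  assumes "\<psi> \<in> section_of A L" "(U, t) \<in> lframes L" "c \<in> A"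
  shows "smooth_on (snd c ` (U \<inter> fst c)) (\<lambda>y. coef L (t (chart_inv c y)) (\<psi> (chart_inv c y)))"
proof -
  have "\<forall>(U, t)\<in>lframes L. smooth_map A U (\<lambda>x. coef L (t x) (\<psi> x))"
    using assms(1) unfolding section_of_def mem_Collect_eq by (elim conjE)
  from bspec[OF this assms(2)] show ?thesis
    using assms(3) unfolding smooth_map_def by (simp add: o_def)
qed

lemma continuous_on_chart_frames:
  fixes f :: "real^2 \<Rightarrow> 'b::real_normed_vector"
  assumes "c \<in> A" "\<And>U t. (U, t) \<in> lframes L \<Longrightarrow> continuous_on (snd c ` (U \<inter> fst c)) f"
  shows "continuous_on (snd c ` fst c) f"
proof -
  \<comment> \<open>Continuity is the case 0 of \<open>ck_on\<close>, so the local criterion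
    applies.\<close>
  have "ck_on 0 (snd c ` fst c) f"
  proof (rule ck_on_local)
    fix y assume "y \<in> snd c ` fst c"
    then obtain x where x: "x \<in> fst c" "y = snd c x" by blast
    obtain U t where t: "(U, t) \<in> lframes L" "x \<in> U" using ex_frame by blast
    show "\<exists>T. open T \<and> y \<in> T \<and> ck_on 0 T f"
      using x t assms(2)[OF t(1)] open_chart_image[OF assms(1) frame(1)[OF t(1)]]
      by (intro exI[of _ "snd c ` (U \<inter> fst c)"]) auto
  qed
  then show ?thesis by simp
qed

lemma smooth_on_chart_frames:
  assumes "c \<in> A" "\<And>U t. (U, t) \<in> lframes L \<Longrightarrow> smooth_on (snd c ` (U \<inter> fst c)) f"
  shows "smooth_on (snd c ` fst c) f"
proof (rule smooth_on_local)
  fix y assume "y \<in> snd c ` fst c"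
  then obtain x where x: "x \<in> fst c" "y = snd c x" by blast
  obtain U t where t: "(U, t) \<in> lframes L" "x \<in> U" using ex_frame by blast
  show "\<exists>T. open T \<and> y \<in> T \<and> smooth_on T f"
    using x t assms(2)[OF t(1)] open_chart_image[OF assms(1) frame(1)[OF t(1)]]
    by (intro exI[of _ "snd c ` (U \<inter> fst c)"]) auto
qed

end

section \<open>The integrands in the frame given by the spinor\<close>

locale spin_surface = riemannian_surface A g for A :: "'m::t2_space chart set" and g :: "'m bilin" +
  fixes L :: "('m, 'l) spin_data" and J :: "'l \<Rightarrow> 'l"
    and D :: "('m \<Rightarrow> 'l) \<Rightarrow> 'm \<Rightarrow> real^2 \<Rightarrow> 'l"
  assumes cpt: "compact (UNIV :: 'm set)"
    and spin: "spin_bundle A g L"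
    and cplx: "spin_complex_structure A g L J"
    and dirac: "dirac_structure A g L J D"

sublocale spin_surface \<subseteq> line_bundle A L
  using spin by unfold_locales (simp add: spin_bundle_def)

context spin_surface
begin

lemma linear_spair: "lproj L v = lproj L w \<Longrightarrow> linear (spair L v w)"
  and spair_lscale: "lproj L v = lproj L w \<Longrightarrow>
    spair L (lscale L v p) (lscale L w q) X = qcnj p \<odot> spair L v w X \<odot> q"
  and qcnj_spair: "lproj L v = lproj L w \<Longrightarrow> qcnj (spair L v w X) = - spair L w v X"
  and spair_nonzero: "\<not> lzero L v \<Longrightarrow> X \<noteq> 0 \<Longrightarrow> spair L v v X \<noteq> 0"
proof -
  have sp: "spin_pairing A L" using spin unfolding spin_bundle_def by blast
  have "\<forall>v w. lproj L v = lproj L w \<longrightarrow> linear (spair L v w)"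
    using sp unfolding spin_pairing_def by (elim conjE)
  then show "linear (spair L v w)" if "lproj L v = lproj L w" using that by blast
  have "\<forall>v w p q X. lproj L v = lproj L w \<longrightarrow>
      spair L (lscale L v p) (lscale L w q) X = qcnj p \<odot> spair L v w X \<odot> q"
    using sp unfolding spin_pairing_def by (elim conjE)
  then show "spair L (lscale L v p) (lscale L w q) X = qcnj p \<odot> spair L v w X \<odot> q"
    if "lproj L v = lproj L w" using that by blast
  have "\<forall>v w X. lproj L v = lproj L w \<longrightarrow> qcnj (spair L v w X) = - spair L w v X"
    using sp unfolding spin_pairing_def by (elim conjE)
  then show "qcnj (spair L v w X) = - spair L w v X" if "lproj L v = lproj L w" using that by blast
  have "\<forall>v X. \<not> lzero L v \<and> X \<noteq> 0 \<longrightarrow> spair L v v X \<noteq> 0"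
    using sp unfolding spin_pairing_def by (elim conjE)
  then show "spair L v v X \<noteq> 0" if "\<not> lzero L v" "X \<noteq> 0" using that by blast
qed

lemma smooth_form_frame:
  assumes "(U, t) \<in> lframes L"
  shows "smooth_form A U (\<lambda>x. spair L (t x) (t x))"
proof -
  have "\<forall>(U, s)\<in>lframes L. smooth_form A U (\<lambda>x. spair L (s x) (s x))"
    using spin unfolding spin_bundle_def spin_pairing_def by (elim conjE)
  from bspec[OF this assms] show ?thesis by simp
qed

lemma lproj_J [simp]: "lproj L (J v) = lproj L v"
  and J_lscale: "J (lscale L v q) = lscale L (J v) q"
  and J_J: "J (J v) = lneg L v"
  and J_section: "\<phi> \<in> section_of A L \<Longrightarrow> J \<circ> \<phi> \<in> section_of A L"
  and spair_rot: "lproj L v = lproj L w \<Longrightarrow> spair L v w (rot g (lproj L v) X) = spair L (J v) w X"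
    "lproj L v = lproj L w \<Longrightarrow> spair L v w (rot g (lproj L v) X) = spair L v (J w) X"
proof -
  have "\<forall>v. lproj L (J v) = lproj L v"
    using cplx unfolding spin_complex_structure_def by (elim conjE)
  then show "lproj L (J v) = lproj L v" by blast
  have "\<forall>v q. J (lscale L v q) = lscale L (J v) q"
    using cplx unfolding spin_complex_structure_def by (elim conjE)
  then show "J (lscale L v q) = lscale L (J v) q" by blast
  have "\<forall>v. J (J v) = lneg L v"
    using cplx unfolding spin_complex_structure_def by (elim conjE)
  then show "J (J v) = lneg L v" by blast
  have "\<forall>\<psi>\<in>section_of A L. J \<circ> \<psi> \<in> section_of A L"
    using cplx unfolding spin_complex_structure_def by (elim conjE)
  then show "J \<circ> \<phi> \<in> section_of A L" if "\<phi> \<in> section_of A L" using that by blast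
  have "\<forall>v w X. lproj L v = lproj L w \<longrightarrow>
        spair L v w (rot g (lproj L v) X) = spair L (J v) w X \<and>
        spair L v w (rot g (lproj L v) X) = spair L v (J w) X"
    using cplx unfolding spin_complex_structure_def by (elim conjE)
  then show "spair L v w (rot g (lproj L v) X) = spair L (J v) w X"
    "spair L v w (rot g (lproj L v) X) = spair L v (J w) X" if "lproj L v = lproj L w"
    using that by blast+
qed

end

locale spinor_field = spin_surface A g L J D
  for A :: "'m::t2_space chart set" and g :: "'m bilin" and L :: "('m, 'l) spin_data"
    and J :: "'l \<Rightarrow> 'l" and D :: "('m \<Rightarrow> 'l) \<Rightarrow> 'm \<Rightarrow> real^2 \<Rightarrow> 'l" +
  fixes \<psi> :: "'m \<Rightarrow> 'l"
  assumes spinor: "\<psi> \<in> nonvanishing_section A L"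
begin

lemma section_spinor: "\<psi> \<in> section_of A L"
  and lproj_spinor [simp]: "lproj L (\<psi> x) = x"
  and spinor_nonzero: "\<not> lzero L (\<psi> x)"
  using spinor unfolding nonvanishing_section_def section_of_def by auto

lemmas lscale_coef_spinor = nonzero_coef(1)[OF spinor_nonzero, unfolded lproj_spinor]
  and coef_spinor_lscale [simp] = nonzero_coef(2)[OF spinor_nonzero]

lemma lscale_spinor_inject: "lscale L (\<psi> x) p = lscale L (\<psi> x) q \<Longrightarrow> p = q"
  using coef_spinor_lscale by metis

lemma Kbar_dirac: "D \<psi> \<in> Kbar_form A g L J"
  and ext_deriv_spair: "ext_deriv A (\<lambda>y. spair L (\<psi> y) (\<psi> y)) x X Y =
          (spair L (D \<psi> x X) (\<psi> x) Y - spair L (D \<psi> x Y) (\<psi> x) X) +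
          (spair L (\<psi> x) (D \<psi> x X) Y - spair L (\<psi> x) (D \<psi> x Y) X)"
proof -
  have "\<forall>\<psi>\<in>section_of A L. D \<psi> \<in> Kbar_form A g L J"
    using dirac unfolding dirac_structure_def by (elim conjE)
  then show "D \<psi> \<in> Kbar_form A g L J" using section_spinor by blast
  have "\<forall>\<psi>\<in>section_of A L. \<forall>\<phi>\<in>section_of A L. \<forall>x X Y.
        ext_deriv A (\<lambda>y. spair L (\<psi> y) (\<phi> y)) x X Y =
          (spair L (D \<psi> x X) (\<phi> x) Y - spair L (D \<psi> x Y) (\<phi> x) X) +
          (spair L (\<psi> x) (D \<phi> x X) Y - spair L (\<psi> x) (D \<phi> x Y) X)"
    using dirac unfolding dirac_structure_def by (elim conjE)
  from this[rule_format, OF section_spinor section_spinor]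
  show "ext_deriv A (\<lambda>y. spair L (\<psi> y) (\<psi> y)) x X Y =
          (spair L (D \<psi> x X) (\<psi> x) Y - spair L (D \<psi> x Y) (\<psi> x) X) +
          (spair L (\<psi> x) (D \<psi> x X) Y - spair L (\<psi> x) (D \<psi> x Y) X)" .
qed

lemma lproj_dirac [simp]: "lproj L (D \<psi> x X) = x"
  and dirac_add: "D \<psi> x (X + Y) = ladd L (D \<psi> x X) (D \<psi> x Y)"
  and dirac_scale: "D \<psi> x (r *\<^sub>R X) = lscale L (D \<psi> x X) (qreal r)"
  and dirac_rot: "D \<psi> x (rot g x X) = lneg L (J (D \<psi> x X))"
  using Kbar_dirac unfolding Kbar_form_def bundle_form_def star_def by auto

text \<open>\<open>form\<close>, \<open>dirac_coef\<close> and \<open>J_coef\<close> are \<sigma>, m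
  and n of the overview.\<close>

definition form :: "'m \<Rightarrow> real^2 \<Rightarrow> quat" where
  "form x = spair L (\<psi> x) (\<psi> x)"

definition dirac_coef :: "'m \<Rightarrow> real^2 \<Rightarrow> quat" where
  "dirac_coef x X = coef L (\<psi> x) (D \<psi> x X)"

definition J_coef :: "'m \<Rightarrow> quat" where
  "J_coef x = coef L (\<psi> x) (J (\<psi> x))"

lemma D_eq: "D \<psi> x X = lscale L (\<psi> x) (dirac_coef x X)"
  unfolding dirac_coef_def by (rule lscale_coef_spinor[symmetric]) simp

lemma J_eq: "J (\<psi> x) = lscale L (\<psi> x) (J_coef x)"
  unfolding J_coef_def by (rule lscale_coef_spinor[symmetric]) simp

lemma J_coef_square: "J_coef x \<odot> J_coef x = - qreal 1"
proof (rule lscale_spinor_inject)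
  have "lscale L (\<psi> x) (J_coef x \<odot> J_coef x) = J (J (\<psi> x))"
    by (simp add: J_eq J_lscale)
  then show "lscale L (\<psi> x) (J_coef x \<odot> J_coef x) = lscale L (\<psi> x) (- qreal 1)"
    by (simp add: J_J lneg_def) (simp add: qreal_def)
qed

lemmas qcnj_J_coef = square_eq_minus_one(1)[OF J_coef_square]
  and norm_J_coef = square_eq_minus_one(2)[OF J_coef_square]

lemma linear_form: "linear (form x)"
  unfolding form_def by (rule linear_spair) simp

lemma qcnj_form: "qcnj (form x X) = - form x X"
  unfolding form_def by (rule qcnj_spair) simp

lemma form_nonzero: "X \<noteq> 0 \<Longrightarrow> form x X \<noteq> 0"
  unfolding form_def by (rule spair_nonzero[OF spinor_nonzero])

lemma form_zero [simp]: "form x 0 = 0"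
  using linear_0[OF linear_form] .

lemma spair_spinor: "spair L (lscale L (\<psi> x) p) (lscale L (\<psi> x) q) X = qcnj p \<odot> form x X \<odot> q"
  unfolding form_def by (rule spair_lscale) simp

text \<open>In the first slot n enters conjugated, as -n; in the second it multiplies from the
  right. Together, n anticommutes with the imaginary \<sigma>, that is, n is orthogonal to the
  values of \<sigma>.\<close>

lemma form_rot: "form x (rot g x X) = - (J_coef x \<odot> form x X)" "form x (rot g x X) = form x X \<odot> J_coef x"
proof -
  have "form x (rot g x X) = spair L (J (\<psi> x)) (lscale L (\<psi> x) (qreal 1)) X"
    using spair_rot(1)[of "\<psi> x" "\<psi> x" X] by (simp add: form_def)
  then show "form x (rot g x X) = - (J_coef x \<odot> form x X)"
    unfolding J_eq spair_spinor by (simp add: qcnj_J_coef qmult_minus_left)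
  have "form x (rot g x X) = spair L (lscale L (\<psi> x) (qreal 1)) (J (\<psi> x)) X"
    using spair_rot(2)[of "\<psi> x" "\<psi> x" X] by (simp add: form_def)
  then show "form x (rot g x X) = form x X \<odot> J_coef x"
    unfolding J_eq spair_spinor by simp
qed

lemma linear_dirac_coef: "linear (dirac_coef x)"
proof
  show "dirac_coef x (X + Y) = dirac_coef x X + dirac_coef x Y" for X Y
    by (rule lscale_spinor_inject[of x]) (simp add: lscale_add dirac_add flip: D_eq)
  show "dirac_coef x (r *\<^sub>R X) = r *\<^sub>R dirac_coef x X" for r X
  proof (rule lscale_spinor_inject)
    have "lscale L (\<psi> x) (dirac_coef x (r *\<^sub>R X)) = lscale L (D \<psi> x X) (qreal r)"
      by (simp add: dirac_scale flip: D_eq)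
    then show "lscale L (\<psi> x) (dirac_coef x (r *\<^sub>R X)) = lscale L (\<psi> x) (r *\<^sub>R dirac_coef x X)"
      by (simp add: D_eq)
  qed
qed

lemma dirac_coef_rot: "dirac_coef x (rot g x X) = - (J_coef x \<odot> dirac_coef x X)"
proof (rule lscale_spinor_inject)
  have "lscale L (\<psi> x) (dirac_coef x (rot g x X)) = lneg L (J (D \<psi> x X))"
    by (simp add: dirac_rot flip: D_eq)
  then show "lscale L (\<psi> x) (dirac_coef x (rot g x X)) = lscale L (\<psi> x) (- (J_coef x \<odot> dirac_coef x X))"
    unfolding D_eq[of x X] J_lscale J_eq lscale_lscale lneg_lscale .
qed

lemma dirac_coef_zero [simp]: "dirac_coef x 0 = 0"
  using linear_0[OF linear_dirac_coef] .

section \<open>Integrands in quaternionic coordinates\<close>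

lemma lnorm2_spinor: "lnorm2 L (lscale L (\<psi> x) p) Z = (norm p)\<^sup>2 * norm (form x Z)"
  unfolding lnorm2_def spair_spinor by (simp add: norm_qmult power2_eq_square)

lemma linner_spinor:
  "linner L (lscale L (\<psi> x) p) (lscale L (\<psi> x) q) Z = (p \<bullet> q) * norm (form x Z)"
proof -
  have "linner L (lscale L (\<psi> x) p) (lscale L (\<psi> x) q) Z =
      ((norm (p + q))\<^sup>2 - (norm p)\<^sup>2 - (norm q)\<^sup>2) / 2 * norm (form x Z)"
    unfolding linner_def lscale_add[symmetric] lnorm2_spinor by (simp add: left_diff_distrib)
  then show ?thesis
    unfolding power2_norm_eq_inner by (simp add: inner_add_left inner_add_right inner_commute)
qed

text \<open>All three second factors behave under the quarter turn as m does; then both terms of the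
  wedge contribute the same inner product, which absorbs the factor 1/2.\<close>

lemma wedge_density_dirac:
  assumes "\<And>X. \<nu> x X = lscale L (\<psi> x) (N X)" "N (rot g x Z) = - (J_coef x \<odot> N Z)"
  shows "wedge_density g L (star g (D \<psi>)) \<nu> x Z = (dirac_coef x Z \<bullet> N Z) * norm (form x Z)"
proof -
  have "dirac_coef x (rot g x (rot g x Z)) = - dirac_coef x Z"
    unfolding rot_rot using linear_neg[OF linear_dirac_coef] .
  moreover have "(J_coef x \<odot> dirac_coef x Z) \<bullet> (J_coef x \<odot> N Z) = dirac_coef x Z \<bullet> N Z"
    unfolding inner_qmult_left norm_J_coef by simp
  ultimately show ?thesis
    unfolding wedge_density_def wedge_def star_def D_eq assms linner_spinor dirac_coef_rot[of x Z] by simp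
qed

lemma integrand1_eq: "integrand1 g L D \<psi> x Z = (norm (dirac_coef x Z))\<^sup>2"
proof -
  have "wedge_density g L (star g (D \<psi>)) (D \<psi>) x Z = (dirac_coef x Z \<bullet> dirac_coef x Z) * norm (form x Z)"
    by (rule wedge_density_dirac[where N="dirac_coef x"]) (rule D_eq, rule dirac_coef_rot)
  \<comment> \<open>At \<open>Z = 0\<close> the quotient is 0 / 0 = 0, as is the right hand
    side.\<close>
  then show ?thesis
    unfolding integrand1_def lnorm2_def form_def[symmetric] power2_norm_eq_inner
    using form_nonzero[of Z x] by (cases "Z = 0") auto
qed

lemma integrand2_eq:
  "integrand2 g L D \<psi> x Z = (dirac_coef x Z \<bullet> form x Z)\<^sup>2 / (norm (form x Z))\<^sup>2"
proof -
  have "wedge_density g L (star g (D \<psi>)) (\<lambda>y X. lscale L (\<psi> y) (spair L (\<psi> y) (\<psi> y) X)) x Z =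
      (dirac_coef x Z \<bullet> form x Z) * norm (form x Z)"
    by (rule wedge_density_dirac) (simp_all add: form_rot(1) flip: form_def)
  then show ?thesis
    unfolding integrand2_def lnorm2_def form_def[symmetric]
    using form_nonzero[of Z x] by (cases "Z = 0") (auto simp: power2_eq_square power4_eq_xxxx)
qed

lemma integrand3_eq:
  "integrand3 g L J D \<psi> x Z = (dirac_coef x Z \<bullet> (J_coef x \<odot> form x Z))\<^sup>2 / (norm (form x Z))\<^sup>2"
proof -
  have "wedge_density g L (star g (D \<psi>)) (\<lambda>y X. lscale L (J (\<psi> y)) (spair L (\<psi> y) (\<psi> y) X)) x Z =
      (dirac_coef x Z \<bullet> (J_coef x \<odot> form x Z)) * norm (form x Z)"
    by (rule wedge_density_dirac) (simp_all add: J_eq form_rot(1) qmult_minus_right flip: form_def)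
  then show ?thesis
    unfolding integrand3_def lnorm2_def form_def[symmetric]
    using form_nonzero[of Z x] by (cases "Z = 0") (auto simp: power2_eq_square power4_eq_xxxx)
qed

text \<open>Scaling and turning the tangent vector multiplies \<sigma> and m from the left by u = a
  - bn, which commutes with n. Inner products and squared norms scale by |u|^2, hence so does each
  integrand.\<close>

lemma rot_combination:
  fixes a b
  defines "u \<equiv> \<lambda>x. qreal a - b *\<^sub>R J_coef x"
  shows "dirac_coef x (a *\<^sub>R X + b *\<^sub>R rot g x X) = u x \<odot> dirac_coef x X"
    and "form x (a *\<^sub>R X + b *\<^sub>R rot g x X) = u x \<odot> form x X"
    and "J_coef x \<odot> (u x \<odot> p) = u x \<odot> (J_coef x \<odot> p)"
    and "(norm (u x))\<^sup>2 = a\<^sup>2 + b\<^sup>2"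
proof -
  show "dirac_coef x (a *\<^sub>R X + b *\<^sub>R rot g x X) = u x \<odot> dirac_coef x X"
    by (simp add: u_def linear_add[OF linear_dirac_coef] linear_scale[OF linear_dirac_coef] dirac_coef_rot
        qmult_diff_left qmult_scaleR_left)
  show "form x (a *\<^sub>R X + b *\<^sub>R rot g x X) = u x \<odot> form x X"
    by (simp add: u_def linear_add[OF linear_form] linear_scale[OF linear_form] form_rot(1)
        qmult_diff_left qmult_scaleR_left)
  have "J_coef x \<odot> u x = u x \<odot> J_coef x"
    by (simp add: u_def qmult_diff_left qmult_diff_right qmult_scaleR_left qmult_scaleR_right)
  then show "J_coef x \<odot> (u x \<odot> p) = u x \<odot> (J_coef x \<odot> p)" by (simp flip: qmult_assoc)
  have "fst (J_coef x) = 0"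
    using qcnj_J_coef[of x] by (simp add: qcnj_def prod_eq_iff)
  moreover have "J_coef x \<bullet> J_coef x = 1"
    using norm_J_coef[of x] by (simp flip: power2_norm_eq_inner)
  ultimately show "(norm (u x))\<^sup>2 = a\<^sup>2 + b\<^sup>2"
    unfolding power2_norm_eq_inner u_def
    by (simp add: inner_diff_left inner_diff_right qreal_def inner_prod_def power2_eq_square algebra_simps)
qed

lemma integrands_K_power:
  "integrand1 g L D \<psi> x \<in> K_power g 2 x" "integrand2 g L D \<psi> x \<in> K_power g 2 x"
  "integrand3 g L J D \<psi> x \<in> K_power g 2 x"
  by (rule K_powerI;
      simp add: integrand1_eq integrand2_eq integrand3_eq rot_combination norm_qmult power_mult_distrib
        inner_qmult_left power2_eq_square[of "a\<^sup>2 + b\<^sup>2" for a b])+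

section \<open>Bessel's inequality and the total density\<close>

lemma bessel_setup:
  assumes "Z \<noteq> 0"
  shows "form x Z \<bullet> (J_coef x \<odot> form x Z) = 0" "norm (form x Z) = norm (J_coef x \<odot> form x Z)"
    "form x Z \<noteq> 0"
proof -
  \<comment> \<open>The conjugate of \<sigma> times n\<sigma> is imaginary because n is, so its real
    part, the inner product, vanishes.\<close>
  have "qcnj (qcnj (form x Z) \<odot> (J_coef x \<odot> form x Z)) = - (qcnj (form x Z) \<odot> (J_coef x \<odot> form x Z))"
    by (simp add: qcnj_qmult qcnj_J_coef qmult_assoc qmult_minus_left qmult_minus_right)
  then show "form x Z \<bullet> (J_coef x \<odot> form x Z) = 0"
    unfolding inner_quat by (simp add: qcnj_def prod_eq_iff)
qed (use form_nonzero[OF assms] in \<open>simp_all add: norm_qmult norm_J_coef\<close>)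

definition total_density :: "real \<Rightarrow> real \<Rightarrow> real \<Rightarrow> 'm \<Rightarrow> real^2 \<Rightarrow> real" where
  "total_density e1 e2 e3 x Z = e1 * integrand1 g L D \<psi> x Z +
    (e2 - e1) * integrand2 g L D \<psi> x Z + (e3 - e1) * integrand3 g L J D \<psi> x Z"

text \<open>Regrouped into the squares of the remainder and of the two components of m, the density
  has the nonnegative weights themselves as coefficients. This is the origin of the differences in
  \<open>energy\<close>.\<close>

lemma total_density_eq:
  "total_density e1 e2 e3 x Z = e1 * (integrand1 g L D \<psi> x Z - integrand2 g L D \<psi> x Z - integrand3 g L J D \<psi> x Z) +
    e2 * integrand2 g L D \<psi> x Z + e3 * integrand3 g L J D \<psi> x Z"
  unfolding total_density_def by (simp add: algebra_simps)

lemma integrands_bessel: "integrand2 g L D \<psi> x Z + integrand3 g L J D \<psi> x Z \<le> integrand1 g L D \<psi> x Z"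
  unfolding integrand1_eq integrand2_eq integrand3_eq
  using bessel2(1)[OF bessel_setup] by (cases "Z = 0") auto

lemma integrands_nonneg: "0 \<le> integrand2 g L D \<psi> x Z" "0 \<le> integrand3 g L J D \<psi> x Z"
  unfolding integrand2_eq integrand3_eq by simp_all

lemma total_density_nonneg:
  "0 \<le> e1 \<Longrightarrow> 0 \<le> e2 \<Longrightarrow> 0 \<le> e3 \<Longrightarrow> 0 \<le> total_density e1 e2 e3 x Z"
  unfolding total_density_eq
  using integrands_bessel[of x Z] integrands_nonneg[of x Z]
  by (intro add_nonneg_nonneg mult_nonneg_nonneg) auto

lemma total_density_K_power: "total_density e1 e2 e3 x \<in> K_power g 2 x"
proof -
  obtain r1 r2 r3 where "\<And>X. integrand1 g L D \<psi> x X = r1 * g x X X"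
    "\<And>X. integrand2 g L D \<psi> x X = r2 * g x X X" "\<And>X. integrand3 g L J D \<psi> x X = r3 * g x X X"
    using integrands_K_power[of x] K_powerE by metis
  then have "total_density e1 e2 e3 x X = (e1 * r1 + (e2 - e1) * r2 + (e3 - e1) * r3) * sqrt (g x X X) ^ 2" for X
    unfolding total_density_def using metric_nonneg[of x X] by (simp add: algebra_simps)
  then show ?thesis unfolding K_power_def by blast
qed

text \<open>Positive weights annihilate the remainder and the component along \<sigma>; the weight
  zero leaves the one along n\<sigma> free.\<close>

lemma total_density_eq_0_iff:
  assumes "e1 > 0" "e2 > 0" "Z \<noteq> 0"
  shows "total_density e1 e2 0 x Z = 0 \<longleftrightarrow> (\<exists>k. dirac_coef x Z = k *\<^sub>R (J_coef x \<odot> form x Z))"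
proof
  assume "total_density e1 e2 0 x Z = 0"
  moreover have "0 \<le> e1 * (integrand1 g L D \<psi> x Z - integrand2 g L D \<psi> x Z - integrand3 g L J D \<psi> x Z)"
    "0 \<le> e2 * integrand2 g L D \<psi> x Z"
    using assms integrands_bessel[of x Z] integrands_nonneg[of x Z] by auto
  ultimately have "e1 * (integrand1 g L D \<psi> x Z - integrand2 g L D \<psi> x Z - integrand3 g L J D \<psi> x Z) = 0"
      "e2 * integrand2 g L D \<psi> x Z = 0"
    unfolding total_density_eq by linarith+
  then have "integrand1 g L D \<psi> x Z = integrand2 g L D \<psi> x Z + integrand3 g L J D \<psi> x Z"
    "integrand2 g L D \<psi> x Z = 0"
    using assms by auto
  then show "\<exists>k. dirac_coef x Z = k *\<^sub>R (J_coef x \<odot> form x Z)"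
    unfolding integrand1_eq integrand2_eq integrand3_eq
    using bessel2(2)[OF bessel_setup[OF assms(3)]] by blast
next
  assume "\<exists>k. dirac_coef x Z = k *\<^sub>R (J_coef x \<odot> form x Z)"
  then obtain k where k: "dirac_coef x Z = k *\<^sub>R (J_coef x \<odot> form x Z)" by blast
  note b = bessel_setup[OF assms(3), of x]
  have "integrand2 g L D \<psi> x Z = 0"
    unfolding integrand2_eq k using b(1) by (simp add: inner_commute)
  moreover have "integrand1 g L D \<psi> x Z = integrand3 g L J D \<psi> x Z"
    unfolding integrand1_eq integrand3_eq k b(2)
    using b(2,3) by (simp add: power2_eq_square flip: power2_norm_eq_inner)
  ultimately show "total_density e1 e2 0 x Z = 0" unfolding total_density_eq by simp
qed

section \<open>Closedness of the form (\<psi>,\<psi>)\<close>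

lemma ext_deriv_form:
  "ext_deriv A form x X Y = (qcnj (dirac_coef x X) \<odot> form x Y - qcnj (dirac_coef x Y) \<odot> form x X) +
     (form x Y \<odot> dirac_coef x X - form x X \<odot> dirac_coef x Y)"
proof -
  have "spair L (D \<psi> x X) (\<psi> x) Y = qcnj (dirac_coef x X) \<odot> form x Y"
    "spair L (\<psi> x) (D \<psi> x X) Y = form x Y \<odot> dirac_coef x X" for X Y
    using spair_spinor[of x "dirac_coef x X" "qreal 1" Y] spair_spinor[of x "qreal 1" "dirac_coef x X" Y]
    by (simp_all flip: D_eq)
  then show ?thesis using ext_deriv_spair[of x X Y] unfolding form_def[abs_def] by simp
qed

text \<open>Each quarter turn contributes a factor n, so \<sigma> enters only through
  \<open>t\<close>, which is imaginary because n and \<sigma> anticommute. The sum in parentheses is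
  therefore twice the imaginary part of \<open>t\<close> times m.\<close>

lemma ext_deriv_form_rot:
  fixes x X
  defines "t \<equiv> J_coef x \<odot> form x X"
  shows "ext_deriv A form x X (rot g x X) = (-2) *\<^sub>R (qcnj (dirac_coef x X) \<odot> t + t \<odot> dirac_coef x X)"
    and "qcnj t = - t"
proof -
  have sn: "form x X \<odot> J_coef x = - t" using form_rot[of x X] by (simp add: t_def)
  have "qcnj (dirac_coef x (rot g x X)) \<odot> form x X = qcnj (dirac_coef x X) \<odot> t"
    by (simp add: dirac_coef_rot qcnj_qmult qcnj_J_coef qmult_minus_left qmult_minus_right qmult_assoc t_def)
  moreover have "form x X \<odot> dirac_coef x (rot g x X) = t \<odot> dirac_coef x X"
    by (simp add: dirac_coef_rot qmult_minus_right qmult_minus_left sn flip: qmult_assoc)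
  ultimately show "ext_deriv A form x X (rot g x X) = (-2) *\<^sub>R (qcnj (dirac_coef x X) \<odot> t + t \<odot> dirac_coef x X)"
    unfolding ext_deriv_form form_rot(1)
    by (simp add: qmult_minus_left qmult_minus_right scaleR_2 scaleR_add_right flip: t_def)
  show "qcnj t = - t"
    using sn by (simp add: t_def qcnj_qmult qcnj_form qcnj_J_coef qmult_minus_left qmult_minus_right)
qed

text \<open>The condition says that the product \<open>t \<odot> m\<close> is real; multiplying it
  by the conjugate of \<open>t\<close>, which is \<open>- t\<close>, exhibits \<open>m\<close> as a
  real multiple of \<open>t\<close>.\<close>

lemma ext_deriv_form_rot_eq_0_iff:
  assumes "X \<noteq> 0"
  shows "ext_deriv A form x X (rot g x X) = 0 \<longleftrightarrow> (\<exists>k. dirac_coef x X = k *\<^sub>R (J_coef x \<odot> form x X))"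
proof -
  define t m where "t = J_coef x \<odot> form x X" "m = dirac_coef x X"
  have t: "qcnj t = - t" unfolding t_m_def by (rule ext_deriv_form_rot(2))
  have nt: "norm t \<noteq> 0" using bessel_setup(2,3)[OF assms, of x] unfolding t_m_def by (metis norm_eq_zero)
  have "ext_deriv A form x X (rot g x X) = 0 \<longleftrightarrow> qcnj m \<odot> t + t \<odot> m = 0"
    unfolding ext_deriv_form_rot(1) t_m_def by simp
  also have "\<dots> \<longleftrightarrow> (\<exists>k. m = k *\<^sub>R t)"
  proof
    assume *: "qcnj m \<odot> t + t \<odot> m = 0"
    have "qcnj (t \<odot> m) = - (qcnj m \<odot> t)" by (simp add: qcnj_qmult t qmult_minus_right)
    then have "qcnj (t \<odot> m) = t \<odot> m" using * by (simp add: add_eq_0_iff2)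
    then have real: "t \<odot> m = qreal (fst (t \<odot> m))" by (simp add: qcnj_def qreal_def prod_eq_iff vec_eq_iff)
    have "(norm t)\<^sup>2 *\<^sub>R m = (qcnj t \<odot> t) \<odot> m" by (simp add: qcnj_qmult_self)
    also have "\<dots> = - (t \<odot> (t \<odot> m))" by (simp add: t qmult_minus_left qmult_assoc)
    also have "\<dots> = (- fst (t \<odot> m)) *\<^sub>R t" by (subst real) simp
    finally have "(norm t)\<^sup>2 *\<^sub>R m = (- fst (t \<odot> m)) *\<^sub>R t" .
    then have "(1 / (norm t)\<^sup>2) *\<^sub>R ((norm t)\<^sup>2 *\<^sub>R m) = (1 / (norm t)\<^sup>2) *\<^sub>R ((- fst (t \<odot> m)) *\<^sub>R t)"
      by (rule arg_cong)
    then have "m = (1 / (norm t)\<^sup>2 * - fst (t \<odot> m)) *\<^sub>R t"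
      using nt unfolding scaleR_scaleR by simp
    then show "\<exists>k. m = k *\<^sub>R t" by blast
  next
    assume "\<exists>k. m = k *\<^sub>R t"
    then show "qcnj m \<odot> t + t \<odot> m = 0"
      by (auto simp: t qmult_minus_left qmult_scaleR_left qmult_scaleR_right)
  qed
  finally show ?thesis unfolding t_m_def .
qed

lemma closed_form_iff:
  assumes "e1 > 0" "e2 > 0"
  shows "closed_form A form \<longleftrightarrow> (\<forall>x X. total_density e1 e2 0 x X = 0)"
proof
  assume cl: "closed_form A form"
  show "\<forall>x X. total_density e1 e2 0 x X = 0"
  proof (intro allI)
    fix x X
    show "total_density e1 e2 0 x X = 0"
    proof (cases "X = 0")
      case True
      then show ?thesis by (simp add: total_density_def integrand1_eq integrand2_eq integrand3_eq)
    next
      case False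
      then show ?thesis
        using total_density_eq_0_iff[OF assms] ext_deriv_form_rot_eq_0_iff cl unfolding closed_form_def by blast
    qed
  qed
next
  assume z: "\<forall>x X. total_density e1 e2 0 x X = 0"
  show "closed_form A form"
    unfolding closed_form_def
  proof (intro allI)
    fix x X Y
    show "ext_deriv A form x X Y = 0"
    proof (cases "X = 0")
      case True
      then show ?thesis by (simp add: ext_deriv_form qcnj_def flip: zero_prod_def)
    next
      case False
      \<comment> \<open>A 2-form on a plane is determined by its value on \<open>X\<close> and
        \<open>rot g x X\<close>.\<close>
      obtain a b where Y: "Y = a *\<^sub>R X + b *\<^sub>R rot g x X" using rot_decomposition[OF False] by metis
      have "ext_deriv A form x X Y = b *\<^sub>R ext_deriv A form x X (rot g x X)"
        unfolding Y ext_deriv_form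
        by (simp add: linear_add[OF linear_form] linear_scale[OF linear_form] linear_add[OF linear_dirac_coef]
            linear_scale[OF linear_dirac_coef] qmult_add_left qmult_add_right qmult_scaleR_left qmult_scaleR_right
            algebra_simps)
      then show ?thesis
        using total_density_eq_0_iff[OF assms False] ext_deriv_form_rot_eq_0_iff[OF False] z by simp
    qed
  qed
qed

end

context spinor_field
begin

section \<open>Regularity in charts and the integral of the energy density\<close>

lemma continuous_coef:
  assumes c: "c \<in> A" and v: "\<And>x. lproj L (v x) = x"
    and cont: "\<And>U t. (U, t) \<in> lframes L \<Longrightarrow>
      continuous_on (snd c ` (U \<inter> fst c)) (\<lambda>y. coef L (t (chart_inv c y)) (v (chart_inv c y)))"
  shows "continuous_on (snd c ` fst c) (\<lambda>y. coef L (\<psi> (chart_inv c y)) (v (chart_inv c y)))"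
proof (rule continuous_on_chart_frames[OF c])
  fix U t assume t: "(U, t) \<in> lframes L"
  let ?S = "snd c ` (U \<inter> fst c)"
  have U: "chart_inv c y \<in> U" if "y \<in> ?S" for y using that c by auto
  let ?p = "\<lambda>y. coef L (t (chart_inv c y)) (\<psi> (chart_inv c y))"
  have p: "continuous_on ?S ?p"
    using section_smooth[OF section_spinor t c] by (rule smooth_on_continuous)
  have "?p y \<noteq> 0" if "y \<in> ?S" for y
    using frame_coef_nonzero[OF t U[OF that] lproj_spinor spinor_nonzero] .
  then have "continuous_on ?S (\<lambda>y. qinv (?p y))"
    unfolding qinv_def using p by (intro continuous_intros continuous_on_qcnj) auto
  then have "continuous_on ?S (\<lambda>y. qinv (?p y) \<odot> coef L (t (chart_inv c y)) (v (chart_inv c y)))"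
    using cont[OF t] by (rule continuous_on_qmult)
  then show "continuous_on ?S (\<lambda>y. coef L (\<psi> (chart_inv c y)) (v (chart_inv c y)))"
    by (rule continuous_on_eq) (use coef_frame[OF t U lproj_spinor spinor_nonzero v] in simp)
qed

lemma continuous_J_coef:
  assumes "c \<in> A"
  shows "continuous_on (snd c ` fst c) (\<lambda>y. J_coef (chart_inv c y))"
proof -
  have "continuous_on (snd c ` fst c) (\<lambda>y. coef L (\<psi> (chart_inv c y)) ((J \<circ> \<psi>) (chart_inv c y)))"
    using smooth_on_continuous[OF section_smooth[OF J_section[OF section_spinor] _ assms]]
    by (intro continuous_coef[OF assms]) auto
  then show ?thesis by (simp add: J_coef_def)
qed

lemma continuous_dirac_coef:
  assumes "c \<in> A"
  shows "continuous_on (snd c ` fst c) (local_form A c dirac_coef w)"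
proof -
  have "continuous_on (snd c ` fst c)
      (\<lambda>y. coef L (\<psi> (chart_inv c y)) (D \<psi> (chart_inv c y) (tvec A c (chart_inv c y) w)))"
  proof (rule continuous_coef[OF assms])
    fix U t assume t: "(U, t) \<in> lframes L"
    have "\<forall>(U, s)\<in>lframes L. smooth_form A U (\<lambda>x X. coef L (s x) (D \<psi> x X))"
      using Kbar_dirac unfolding Kbar_form_def bundle_form_def mem_Collect_eq by (elim conjE)
    from bspec[OF this t] have "smooth_form A U (\<lambda>x X. coef L (t x) (D \<psi> x X))" by simp
    then have "smooth_on (snd c ` (U \<inter> fst c)) (local_form A c (\<lambda>x X. coef L (t x) (D \<psi> x X)) w)"
      using assms unfolding smooth_form_def by blast
    then show "continuous_on (snd c ` (U \<inter> fst c))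
        (\<lambda>y. coef L (t (chart_inv c y)) (D \<psi> (chart_inv c y) (tvec A c (chart_inv c y) w)))"
      unfolding local_form_def[abs_def] by (rule smooth_on_continuous)
  qed simp
  then show ?thesis by (simp add: dirac_coef_def local_form_def[abs_def])
qed

text \<open>If \<psi> has the coefficient p in a local frame, the form is the self-pairing of the
  frame multiplied by the conjugate of p on the left and by p on the right, a product of smooth
  functions.\<close>

lemma smooth_form_form: "smooth_form A UNIV form"
  unfolding smooth_form_def
proof (intro conjI ballI allI)
  fix c w assume c: "c \<in> A"
  have "smooth_on (snd c ` fst c) (local_form A c form w)"
  proof (rule smooth_on_chart_frames[OF c])
    fix U t assume t: "(U, t) \<in> lframes L"
    let ?S = "snd c ` (U \<inter> fst c)"
    let ?p = "\<lambda>y. coef L (t (chart_inv c y)) (\<psi> (chart_inv c y))"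
    let ?\<sigma> = "local_form A c (\<lambda>x. spair L (t x) (t x)) w"
    have S: "open ?S" using open_chart_image[OF c frame(1)[OF t]] .
    have "smooth_on ?S ?p" using section_smooth[OF section_spinor t c] .
    moreover have "smooth_on ?S ?\<sigma>" using smooth_form_frame[OF t] c unfolding smooth_form_def by blast
    ultimately have "smooth_on ?S (\<lambda>y. qcnj (?p y) \<odot> ?\<sigma> y \<odot> ?p y)"
      by (intro smooth_on_bounded_bilinear[OF bounded_bilinear_qmult S]
          smooth_on_bounded_linear[OF bounded_linear_qcnj S])
    moreover have "qcnj (?p y) \<odot> ?\<sigma> y \<odot> ?p y = local_form A c form w y" if "y \<in> ?S" for y
    proof -
      let ?x = "chart_inv c y"
      have x: "?x \<in> U" using that c by auto
      have "\<psi> ?x = lscale L (t ?x) (?p y)" using frame_coef(1)[OF t x lproj_spinor] by simp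
      then have "form ?x X = qcnj (?p y) \<odot> spair L (t ?x) (t ?x) X \<odot> ?p y" for X
        unfolding form_def using spair_lscale[OF refl] by metis
      then show ?thesis by (simp add: local_form_def)
    qed
    ultimately show "smooth_on ?S (local_form A c form w)"
      using smooth_on_cong[OF S] by (metis (no_types, lifting))
  qed
  then show "smooth_on (snd c ` (UNIV \<inter> fst c)) (local_form A c form w)" by simp
qed (rule linear_form)

lemma continuous_form:
  assumes "c \<in> A"
  shows "continuous_on (snd c ` fst c) (local_form A c form w)"
  using smooth_form_form assms smooth_on_continuous unfolding smooth_form_def by fastforce

lemma continuous_integrands:
  assumes c: "c \<in> A"
  shows "continuous_on (snd c ` fst c) (local_form A c (integrand1 g L D \<psi>) (axis 1 1))"
    "continuous_on (snd c ` fst c) (local_form A c (integrand2 g L D \<psi>) (axis 1 1))"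
    "continuous_on (snd c ` fst c) (local_form A c (integrand3 g L J D \<psi>) (axis 1 1))"
proof -
  note cont = continuous_form[OF c, of "axis 1 1"] continuous_dirac_coef[OF c, of "axis 1 1"] continuous_J_coef[OF c]
  have nz: "norm (local_form A c form (axis 1 1) y) \<noteq> 0" if "y \<in> snd c ` fst c" for y
    using form_nonzero tvec_basis(2)[OF c chart_inv_in[OF c that]] by (simp add: local_form_def)
  have e: "local_form A c (integrand1 g L D \<psi>) (axis 1 1) = (\<lambda>y. (norm (local_form A c dirac_coef (axis 1 1) y))\<^sup>2)"
    "local_form A c (integrand2 g L D \<psi>) (axis 1 1) =
      (\<lambda>y. (local_form A c dirac_coef (axis 1 1) y \<bullet> local_form A c form (axis 1 1) y)\<^sup>2 /
        (norm (local_form A c form (axis 1 1) y))\<^sup>2)"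
    "local_form A c (integrand3 g L J D \<psi>) (axis 1 1) =
      (\<lambda>y. (local_form A c dirac_coef (axis 1 1) y \<bullet> (J_coef (chart_inv c y) \<odot> local_form A c form (axis 1 1) y))\<^sup>2 /
        (norm (local_form A c form (axis 1 1) y))\<^sup>2)"
    by (auto simp: local_form_def integrand1_eq integrand2_eq integrand3_eq)
  show "continuous_on (snd c ` fst c) (local_form A c (integrand1 g L D \<psi>) (axis 1 1))"
    unfolding e by (intro continuous_intros cont)
  show "continuous_on (snd c ` fst c) (local_form A c (integrand2 g L D \<psi>) (axis 1 1))"
    unfolding e using nz by (intro continuous_intros cont) auto
  show "continuous_on (snd c ` fst c) (local_form A c (integrand3 g L J D \<psi>) (axis 1 1))"
    unfolding e using nz by (intro continuous_intros continuous_on_qmult cont) auto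
qed

lemma continuous_total_density:
  assumes "c \<in> A"
  shows "continuous_on (snd c ` fst c) (local_form A c (total_density e1 e2 e3) (axis 1 1))"
proof -
  have "local_form A c (total_density e1 e2 e3) (axis 1 1) = (\<lambda>y.
      e1 * local_form A c (integrand1 g L D \<psi>) (axis 1 1) y +
      (e2 - e1) * local_form A c (integrand2 g L D \<psi>) (axis 1 1) y +
      (e3 - e1) * local_form A c (integrand3 g L J D \<psi>) (axis 1 1) y)"
    by (auto simp: local_form_def total_density_def)
  then show ?thesis by (simp only:) (intro continuous_intros continuous_integrands assms)
qed

lemma integrable_integrands:
  "integrable_density A g (integrand1 g L D \<psi>)" "integrable_density A g (integrand2 g L D \<psi>)"
  "integrable_density A g (integrand3 g L J D \<psi>)"
  using cpt integrands_K_power continuous_integrands by (auto intro!: integrable_densityI)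

lemma energy_integral:
  "has_surface_integral A (form_of_density g (total_density e1 e2 e3)) (energy A g L J D e1 e2 e3 \<psi>)"
proof -
  have I: "has_surface_integral A (form_of_density g q) (surface_integral A (form_of_density g q))"
    if "integrable_density A g q" for q
    using that surface_integral_eqI[OF cpt] unfolding integrable_density_def by metis
  \<comment> \<open>The factor 1 brings the three terms into the shape of two nested linear
    combinations.\<close>
  have "form_of_density g (total_density e1 e2 e3) = (\<lambda>x X Y.
      1 * (e1 * form_of_density g (integrand1 g L D \<psi>) x X Y + (e2 - e1) * form_of_density g (integrand2 g L D \<psi>) x X Y) +
      (e3 - e1) * form_of_density g (integrand3 g L J D \<psi>) x X Y)"
    by (intro ext) (simp add: form_of_density_def total_density_def add_divide_distrib distrib_right)
  moreover have "energy A g L J D e1 e2 e3 \<psi> =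
      1 * (e1 * surface_integral A (form_of_density g (integrand1 g L D \<psi>)) +
        (e2 - e1) * surface_integral A (form_of_density g (integrand2 g L D \<psi>))) +
      (e3 - e1) * surface_integral A (form_of_density g (integrand3 g L J D \<psi>))"
    by (simp add: energy_def)
  ultimately show ?thesis
    by (simp only:) (intro has_surface_integral_linear_combination I integrable_integrands)
qed

lemma energy_nonneg:
  "0 \<le> e1 \<Longrightarrow> 0 \<le> e2 \<Longrightarrow> 0 \<le> e3 \<Longrightarrow> 0 \<le> energy A g L J D e1 e2 e3 \<psi>"
  using density_integral_nonneg[OF cpt energy_integral] total_density_nonneg by blast

lemma energy_eq_0_iff_closed:
  assumes "e1 > 0" "e2 > 0"
  shows "energy A g L J D e1 e2 0 \<psi> = 0 \<longleftrightarrow> closed_form A form"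
  unfolding closed_form_iff[OF assms]
  using assms by (intro density_integral_eq_0_iff[OF cpt energy_integral] total_density_nonneg
      total_density_K_power continuous_total_density) auto

end

section \<open>Immersions\<close>

context surface_atlas
begin

lemma differential_bounded_linear:
  assumes l: "bounded_linear l" and f: "smooth_map A UNIV f"
  shows "smooth_map A UNIV (\<lambda>x. l (f x))" "differential A (\<lambda>x. l (f x)) x X = l (differential A f x X)"
proof -
  show "smooth_map A UNIV (\<lambda>x. l (f x))"
    using smooth_on_bounded_linear[OF l open_chart_range] f unfolding smooth_map_def by (simp add: o_def)
  have "(f \<circ> chart_inv (chart_at A x)) differentiable (at (snd (chart_at A x) x))"
    using smooth_map_differentiable[OF f chart_at] by simp
  from frechet_derivative_at[OF bounded_linear.has_derivative[OF l this[unfolded frechet_derivative_works]]]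
  show "differential A (\<lambda>x. l (f x)) x X = l (differential A f x X)"
    unfolding differential_def by (simp add: o_def) metis
qed

end

lemma bounded_linear_qimag: "bounded_linear qimag"
  by (rule bounded_linear_intro[where K=1]) (simp_all add: qimag_def norm_Pair)

lemma norm_qimag [simp]: "norm (qimag v) = norm v"
  by (simp add: qimag_def norm_Pair)

context riemannian_surface
begin

lemma metric_polarization:
  assumes "linear h" "\<And>X. (norm (h X))\<^sup>2 = g x X X"
  shows "h X \<bullet> h Y = g x X Y"
proof -
  have "(norm (h (X + Y)))\<^sup>2 = g x (X + Y) (X + Y)" by (rule assms)
  then show ?thesis
    using assms(2)[of X] assms(2)[of Y] metric_sym[of x X Y]
    by (simp add: linear_add[OF assms(1)] metric_linear power2_norm_eq_inner inner_add_left inner_add_right inner_commute)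
qed

text \<open>\<open>B\<^sup>2\<close> is a multiple \<open>c\<close> of the identity and \<open>c\<^sup>2 = det B\<^sup>2 = 1\<close>; then \<open>B X - X\<close> is an eigenvector of the
  positive map \<open>B\<close> for the eigenvalue \<open>-1\<close>.\<close>

lemma positive_conformal_unimodular_eq_id:
  assumes B: "linear B" "\<And>X Y. g x (B X) Y = g x X (B Y)" "\<And>X. X \<noteq> 0 \<Longrightarrow> 0 < g x (B X) X"
      "det (matrix B) = 1"
    and c: "c > 0" "\<And>X Y. g x (B X) (B Y) = c * g x X Y"
  shows "B X = X"
proof -
  have BB: "B (B X) = c *\<^sub>R X" for X
  proof -
    let ?Z = "B (B X) + (- c) *\<^sub>R X"
    have "g x ?Z Y = 0" for Y
      using B(2)[of "B X" Y] c(2)[of X Y] by (simp only: metric_linear) simp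
    then have "?Z = 0" using metric_eq_0_iff by blast
    then show ?thesis by simp
  qed
  have "matrix B ** matrix B = matrix (\<lambda>X. c *\<^sub>R X)"
    using matrix_compose[OF B(1) B(1)] BB by (simp add: o_def)
  then have "det (matrix (\<lambda>X::real^2. c *\<^sub>R X)) = 1"
    using det_mul[of "matrix B" "matrix B"] B(4) by simp
  then have "c * c = 1" by (simp add: det_2 matrix_def axis_def)
  then have c1: "c = 1" using c(1) by (simp add: square_eq_1_iff)
  let ?Z = "B X - X"
  have "B ?Z = - ?Z" using BB[of X] c1 by (simp add: linear_diff[OF B(1)])
  then have "g x (B ?Z) ?Z = - g x ?Z ?Z" using metric_linear(3)[of x "-1" ?Z ?Z] by simp
  then have "?Z = 0" using B(3)[of ?Z] metric_nonneg[of x ?Z] by force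
  then show ?thesis by simp
qed

text \<open>An isometric \<open>f\<close> has a conformal differential, so the stretching
  \<open>B\<close> between it and the conformal \<open>\<omega>\<close> is conformal too; being
  positive self-adjoint of determinant 1, it is the identity.\<close>

lemma homotopy_class_isometric:
  assumes f: "isometric_immersion A g f" "in_regular_homotopy_class A g L f"
  shows "spin_iso A (induced_bundle (differential A f)) L"
proof -
  obtain \<omega> B where \<omega>: "conformal_form A g \<omega>"
    and B: "\<And>x. linear (B x)" "\<And>x X Y. g x (B x X) Y = g x X (B x Y)"
      "\<And>x X. X \<noteq> 0 \<Longrightarrow> 0 < g x (B x X) X" "\<And>x. det (matrix (B x)) = 1"
    and df: "\<And>x X. differential A f x X = \<omega> x (B x X)" and iso: "spin_iso A (induced_bundle \<omega>) L"
    using f(2) unfolding in_regular_homotopy_class_def by metis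
  have "B x X = X" for x X
  proof -
    obtain \<rho> where \<rho>: "\<rho> > 0" "\<And>X Y. \<omega> x X \<bullet> \<omega> x Y = \<rho> * g x X Y"
      using \<omega> unfolding conformal_form_def by blast
    have "g x (B x X) (B x Y) = (1 / \<rho>) * g x X Y" for X Y
    proof -
      have "g x X Y = \<omega> x (B x X) \<bullet> \<omega> x (B x Y)"
        using f(1) unfolding isometric_immersion_def df by simp
      then show ?thesis unfolding \<rho>(2) using \<rho>(1) by simp
    qed
    then show ?thesis
      using \<rho>(1)
      by (intro positive_conformal_unimodular_eq_id[where B="B x" and x=x and c="1 / \<rho>"] B) simp_all
  qed
  then have "differential A f = \<omega>" using df by (intro ext) simp
  then show ?thesis using iso by simp
qed

end

context spinor_field
begin

lemma spin_iso_induced_bundle: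
  assumes "\<And>x X. qimag (\<omega> x X) = form x X"
  shows "spin_iso A (induced_bundle \<omega>) L"
  unfolding spin_iso_def
proof (intro exI[of _ "\<lambda>v. lscale L (\<psi> (fst v)) (snd v)"] conjI allI impI ballI)
  let ?\<Phi> = "\<lambda>v. lscale L (\<psi> (fst v)) (snd v)"
  show "bij ?\<Phi>"
  proof (rule bijI)
    show "inj ?\<Phi>"
    proof (rule injI)
      fix v w :: "'m \<times> quat" assume e: "?\<Phi> v = ?\<Phi> w"
      then have "fst v = fst w" by (metis lproj_lscale lproj_spinor)
      then show "v = w" using e lscale_spinor_inject by (metis prod_eqI)
    qed
    show "surj ?\<Phi>"
    proof (rule surjI)
      show "?\<Phi> (lproj L u, coef L (\<psi> (lproj L u)) u) = u" for u
        using lscale_coef_spinor by simp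
    qed
  qed
  fix v w :: "'m \<times> quat" and q X
  show "lproj L (?\<Phi> v) = lproj (induced_bundle \<omega>) v" by (simp add: induced_bundle_def)
  show "?\<Phi> (lscale (induced_bundle \<omega>) v q) = lscale L (?\<Phi> v) q" by (simp add: induced_bundle_def)
  assume "lproj (induced_bundle \<omega>) v = lproj (induced_bundle \<omega>) w"
  then have fst: "fst v = fst w" by (simp add: induced_bundle_def)
  then show "?\<Phi> (ladd (induced_bundle \<omega>) v w) = ladd L (?\<Phi> v) (?\<Phi> w)"
    by (simp add: induced_bundle_def lscale_add)
  show "spair L (?\<Phi> v) (?\<Phi> w) X = spair (induced_bundle \<omega>) v w X"
    unfolding fst spair_spinor by (simp add: induced_bundle_def assms fst)
next
  let ?\<Phi> = "\<lambda>v. lscale L (\<psi> (fst v)) (snd v)"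
  fix Us assume "Us \<in> lframes (induced_bundle \<omega>)"
  \<comment> \<open>The only frame is the constant section 1, which is mapped to \<psi>, so
    smoothness of the isomorphism is smoothness of \<psi>.\<close>
  then have Us: "Us = (UNIV, \<lambda>x. (x, qreal 1))" by (simp add: induced_bundle_def)
  have "\<forall>(V, t)\<in>lframes L. smooth_map A V (\<lambda>x. coef L (t x) (\<psi> x))"
    using section_spinor unfolding section_of_def mem_Collect_eq by (elim conjE)
  then show "case Us of (U, s) \<Rightarrow> \<forall>(V, t)\<in>lframes L. smooth_map A (U \<inter> V) (\<lambda>x. coef L (t x) (?\<Phi> (s x)))"
    unfolding Us by simp
qed

lemma closed_form_of_immersion:
  assumes "smooth_map A UNIV f" "\<And>x X. qimag (differential A f x X) = form x X"
  shows "closed_form A form"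
proof -
  note q = differential_bounded_linear[OF bounded_linear_qimag assms(1)]
  have "form = differential A (\<lambda>x. qimag (f x))"
    using q(2) assms(2) by (intro ext) simp
  then show ?thesis unfolding closed_form_def using ext_deriv_differential[OF q(1)] by simp
qed

lemma ex_isometric_immersion:
  assumes cl: "closed_form A form" and con: "metric_constraint g L \<psi>" and per: "vanishing_periods A form"
  shows "\<exists>f. isometric_immersion A g f \<and> (\<forall>x X. qimag (differential A f x X) = form x X) \<and>
    in_regular_homotopy_class A g L f"
proof -
  obtain F where F: "smooth_map A UNIV F" "\<And>x X. differential A F x X = form x X"
    using ex_primitive[OF smooth_form_form] per cl unfolding vanishing_periods_def by blast
  \<comment> \<open>The differential of \<open>F\<close> is imaginary, so the real part of
    \<open>F\<close> is locally constant but need not vanish; it is dropped.\<close>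
  define f where "f x = snd (F x)" for x
  have f: "smooth_map A UNIV f" "differential A f x X = snd (form x X)" for x X
    using differential_bounded_linear[OF bounded_linear_snd F(1)] F(2) by (simp_all add: f_def[abs_def])
  have df: "qimag (differential A f x X) = form x X" for x X
    using qcnj_form[of x X] by (simp add: f(2) qimag_def qcnj_def prod_eq_iff)
  have lin: "linear (differential A f x)" for x by (rule linear_differential[OF f(1)])
  have norm: "(norm (differential A f x X))\<^sup>2 = g x X X" for x X
  proof -
    have "norm (differential A f x X) = norm (form x X)" by (simp flip: df)
    then show ?thesis using con unfolding metric_constraint_def lnorm2_def form_def by simp
  qed
  have "inj (differential A f x)" for x
    unfolding linear_injective_0[OF lin]
    using norm[of x] by (metis metric_eq_0_iff norm_zero zero_power2)
  then have imm: "immersion A f" unfolding immersion_def using f(1) by blast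
  have iso: "isometric_immersion A g f"
    unfolding isometric_immersion_def using imm metric_polarization[OF lin norm] by blast
  have "conformal_form A g (differential A f)"
    unfolding conformal_form_def
    using smooth_form_differential[OF f(1)] metric_polarization[OF lin norm] by (auto intro!: exI[of _ 1])
  moreover have "det (matrix (\<lambda>X::real^2. X)) = 1"
    by (simp add: det_2 matrix_def axis_def)
  \<comment> \<open>The differential of \<open>f\<close> is already conformal, so it is taken as
    \<open>\<omega>\<close> with the identity as stretching \<open>B\<close>.\<close>
  ultimately have "in_regular_homotopy_class A g L f"
    unfolding in_regular_homotopy_class_def
    using imm spin_iso_induced_bundle[OF df] metric_pos
    by (intro conjI exI[of _ "differential A f"] exI[of _ "\<lambda>x X. X"]) (auto simp: linear_iff)
  then show ?thesis using iso df by blast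
qed

end

context spin_surface
begin

lemma ex_spinor_of_immersion:
  assumes f: "isometric_immersion A g f" "in_regular_homotopy_class A g L f"
  obtains \<psi> where "\<psi> \<in> nonvanishing_section A L" "metric_constraint g L \<psi>"
    "\<And>x X. qimag (differential A f x X) = spair L (\<psi> x) (\<psi> x) X"
proof -
  let ?I = "induced_bundle (differential A f)"
  have "spin_iso A ?I L" using homotopy_class_isometric[OF f] .
  then obtain \<Phi> where
      1: "\<forall>v. lproj L (\<Phi> v) = lproj ?I v"
    and 2: "\<forall>(U, s)\<in>lframes ?I. \<forall>(V, t)\<in>lframes L. smooth_map A (U \<inter> V) (\<lambda>x. coef L (t x) (\<Phi> (s x)))"
    and 3: "\<forall>v w X. lproj ?I v = lproj ?I w \<longrightarrow> spair L (\<Phi> v) (\<Phi> w) X = spair ?I v w X"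
    unfolding spin_iso_def by (elim exE conjE)
  define \<psi> where "\<psi> x = \<Phi> (x, qreal 1)" for x
  have p: "spair L (\<psi> x) (\<psi> x) X = qimag (differential A f x X)" for x X
    using 3[rule_format, of "(x, qreal 1)" "(x, qreal 1)" X] by (simp add: \<psi>_def induced_bundle_def)
  have iso: "differential A f x X \<bullet> differential A f x Y = g x X Y" for x X Y
    using f(1) unfolding isometric_immersion_def by blast
  have proj: "lproj L (\<psi> x) = x" for x
    using 1[rule_format, of "(x, qreal 1)"] by (simp add: \<psi>_def induced_bundle_def)
  have "\<psi> \<in> section_of A L"
    unfolding section_of_def using proj 2 by (simp add: \<psi>_def induced_bundle_def)
  moreover have "\<not> lzero L (\<psi> x)" for x
  proof
    assume "lzero L (\<psi> x)"
    then have "\<psi> x = lscale L (\<psi> x) 0" by (simp add: lzero_def)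
    then have "spair L (\<psi> x) (\<psi> x) X = 0" for X
      using spair_lscale[of "\<psi> x" "\<psi> x" 0 0 X] by simp
    then have "differential A f x (axis 1 1) = 0" using p by (metis norm_eq_zero norm_qimag)
    then have "g x (axis 1 1) (axis 1 1) = 0" using iso by (metis inner_zero_left)
    then show False by (simp add: axis_eq_0_iff)
  qed
  ultimately have "\<psi> \<in> nonvanishing_section A L" unfolding nonvanishing_section_def by blast
  moreover have "metric_constraint g L \<psi>"
    unfolding metric_constraint_def lnorm2_def p using iso by (simp add: power2_norm_eq_inner)
  ultimately show ?thesis using p by (intro that) auto
qed

end

theorem theorem3:
  fixes A :: "'m::t2_space chart set"
    and g :: "'m bilin"
    and L :: "('m, 'l) spin_data"
    and J :: "'l \<Rightarrow> 'l"
    and D :: "('m \<Rightarrow> 'l) \<Rightarrow> 'm \<Rightarrow> real^2 \<Rightarrow> 'l"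
    and \<epsilon>\<^sub>1 \<epsilon>\<^sub>2 \<epsilon>\<^sub>3 :: real
  assumes surface: "oriented_surface A" "compact (UNIV :: 'm set)"
    and metric: "riemannian_metric A g"
    and spin: "spin_bundle A g L"
    and cplx: "spin_complex_structure A g L J"
    and dirac: "dirac_structure A g L J D"
    and nonneg: "0 \<le> \<epsilon>\<^sub>1" "0 \<le> \<epsilon>\<^sub>2" "0 \<le> \<epsilon>\<^sub>3"
  shows "(\<forall>\<psi>\<in>nonvanishing_section A L.
            integrable_density A g (integrand1 g L D \<psi>) \<and>
            integrable_density A g (integrand2 g L D \<psi>) \<and>
            integrable_density A g (integrand3 g L J D \<psi>)) \<and>
         (\<forall>\<psi>\<in>nonvanishing_section A L. metric_constraint g L \<psi> \<longrightarrow>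
            0 \<le> energy A g L J D \<epsilon>\<^sub>1 \<epsilon>\<^sub>2 \<epsilon>\<^sub>3 \<psi>) \<and>
         (\<epsilon>\<^sub>3 = 0 \<and> 0 < \<epsilon>\<^sub>1 \<and> 0 < \<epsilon>\<^sub>2 \<longrightarrow>
           (\<forall>\<psi>\<in>nonvanishing_section A L. metric_constraint g L \<psi> \<and>
              vanishing_periods A (\<lambda>x. spair L (\<psi> x) (\<psi> x)) \<longrightarrow>
              (energy A g L J D \<epsilon>\<^sub>1 \<epsilon>\<^sub>2 \<epsilon>\<^sub>3 \<psi> = 0 \<longleftrightarrow>
                (\<exists>f. isometric_immersion A g f \<and>
                   (\<forall>x X. qimag (differential A f x X) = spair L (\<psi> x) (\<psi> x) X) \<and>
                   in_regular_homotopy_class A g L f))) \<and>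
           (\<forall>f. isometric_immersion A g f \<and> in_regular_homotopy_class A g L f \<longrightarrow>
              (\<exists>\<psi>\<in>nonvanishing_section A L. metric_constraint g L \<psi> \<and>
                 (\<forall>x X. qimag (differential A f x X) = spair L (\<psi> x) (\<psi> x) X) \<and>
                 energy A g L J D \<epsilon>\<^sub>1 \<epsilon>\<^sub>2 \<epsilon>\<^sub>3 \<psi> = 0)))"
proof -
  interpret spin_surface A g L J D
    using surface metric spin cplx dirac by unfold_locales
  have loc: "spinor_field A g L J D \<psi>" if "\<psi> \<in> nonvanishing_section A L" for \<psi>
    using that by unfold_locales
  have 1: "integrable_density A g (integrand1 g L D \<psi>) \<and> integrable_density A g (integrand2 g L D \<psi>) \<and>
      integrable_density A g (integrand3 g L J D \<psi>)" if "\<psi> \<in> nonvanishing_section A L" for \<psi>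
    using spinor_field.integrable_integrands[OF loc[OF that]] by blast
  have 2: "0 \<le> energy A g L J D \<epsilon>\<^sub>1 \<epsilon>\<^sub>2 \<epsilon>\<^sub>3 \<psi>" if "\<psi> \<in> nonvanishing_section A L" for \<psi>
    using spinor_field.energy_nonneg[OF loc[OF that] nonneg] .
  \<comment> \<open>Serves the converse half of the equivalence and the final claim, so it asks of
    \<open>f\<close> only to be isometric with the given differential.\<close>
  have 3: "energy A g L J D \<epsilon>\<^sub>1 \<epsilon>\<^sub>2 0 \<psi> = 0"
    if pos: "0 < \<epsilon>\<^sub>1" "0 < \<epsilon>\<^sub>2" and \<psi>: "\<psi> \<in> nonvanishing_section A L"
      and f: "isometric_immersion A g f" "\<And>x X. qimag (differential A f x X) = spair L (\<psi> x) (\<psi> x) X"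
    for \<psi> f
  proof -
    interpret spinor_field A g L J D \<psi> using loc[OF \<psi>] .
    have "smooth_map A UNIV f" using f(1) unfolding isometric_immersion_def immersion_def by blast
    then have "closed_form A form"
      by (rule closed_form_of_immersion) (simp add: f(2) form_def)
    then show ?thesis using energy_eq_0_iff_closed[OF pos] by simp
  qed
  have 4: "\<exists>f. isometric_immersion A g f \<and> (\<forall>x X. qimag (differential A f x X) = spair L (\<psi> x) (\<psi> x) X) \<and>
      in_regular_homotopy_class A g L f"
    if pos: "0 < \<epsilon>\<^sub>1" "0 < \<epsilon>\<^sub>2" and \<psi>: "\<psi> \<in> nonvanishing_section A L" and con: "metric_constraint g L \<psi>"
      and per: "vanishing_periods A (\<lambda>x. spair L (\<psi> x) (\<psi> x))"
      and E: "energy A g L J D \<epsilon>\<^sub>1 \<epsilon>\<^sub>2 0 \<psi> = 0"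
    for \<psi>
  proof -
    interpret spinor_field A g L J D \<psi> using loc[OF \<psi>] .
    have "form = (\<lambda>x. spair L (\<psi> x) (\<psi> x))" by (intro ext) (simp add: form_def)
    then show ?thesis
      using ex_isometric_immersion con per E energy_eq_0_iff_closed[OF pos] by simp
  qed
  have 5: "\<exists>\<psi>\<in>nonvanishing_section A L. metric_constraint g L \<psi> \<and>
      (\<forall>x X. qimag (differential A f x X) = spair L (\<psi> x) (\<psi> x) X) \<and> energy A g L J D \<epsilon>\<^sub>1 \<epsilon>\<^sub>2 0 \<psi> = 0"
    if pos: "0 < \<epsilon>\<^sub>1" "0 < \<epsilon>\<^sub>2" and f: "isometric_immersion A g f" "in_regular_homotopy_class A g L f"
    for f
  proof -
    obtain \<psi> where "\<psi> \<in> nonvanishing_section A L" "metric_constraint g L \<psi>"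
      "\<And>x X. qimag (differential A f x X) = spair L (\<psi> x) (\<psi> x) X"
      using ex_spinor_of_immersion[OF f] by blast
    then show ?thesis using 3[OF pos _ f(1)] by blast
  qed
  show ?thesis
  proof (intro conjI ballI impI allI)
    show "integrable_density A g (integrand1 g L D \<psi>)" "integrable_density A g (integrand2 g L D \<psi>)"
      "integrable_density A g (integrand3 g L J D \<psi>)" if "\<psi> \<in> nonvanishing_section A L" for \<psi>
      using 1[OF that] by blast+
    show "0 \<le> energy A g L J D \<epsilon>\<^sub>1 \<epsilon>\<^sub>2 \<epsilon>\<^sub>3 \<psi>" if "\<psi> \<in> nonvanishing_section A L" for \<psi>
      using 2[OF that] .
  next
    fix \<psi> assume e: "\<epsilon>\<^sub>3 = 0 \<and> 0 < \<epsilon>\<^sub>1 \<and> 0 < \<epsilon>\<^sub>2" and \<psi>: "\<psi> \<in> nonvanishing_section A L"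
      and c: "metric_constraint g L \<psi> \<and> vanishing_periods A (\<lambda>x. spair L (\<psi> x) (\<psi> x))"
    show "energy A g L J D \<epsilon>\<^sub>1 \<epsilon>\<^sub>2 \<epsilon>\<^sub>3 \<psi> = 0 \<longleftrightarrow> (\<exists>f. isometric_immersion A g f \<and>
        (\<forall>x X. qimag (differential A f x X) = spair L (\<psi> x) (\<psi> x) X) \<and> in_regular_homotopy_class A g L f)"
      using 3[OF _ _ \<psi>] 4[OF _ _ \<psi>] e c by blast
  next
    fix f assume e: "\<epsilon>\<^sub>3 = 0 \<and> 0 < \<epsilon>\<^sub>1 \<and> 0 < \<epsilon>\<^sub>2"
      and f: "isometric_immersion A g f \<and> in_regular_homotopy_class A g L f"
    show "\<exists>\<psi>\<in>nonvanishing_section A L. metric_constraint g L \<psi> \<and>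
        (\<forall>x X. qimag (differential A f x X) = spair L (\<psi> x) (\<psi> x) X) \<and>
        energy A g L J D \<epsilon>\<^sub>1 \<epsilon>\<^sub>2 \<epsilon>\<^sub>3 \<psi> = 0"
      using 5[of f] e f by simp
  qed
qed

end
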